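(* Consider the maximum likelihood estimator $\hat\beta_n$ of $\beta$ (defined in the context) in the linear model with Hamiltonian $H_n(\omega)=n\big(\beta f(\bar\omega_+)+g(\bar\omega_+)\big)$, with $f,g\in C^{2m_*+1}([0,1])$ and $m_*\in\mathbb N$. Suppose that the function $A:[0,1]\to\mathbb R$, $A(a)=\beta f(a)+g(a)+I(a)$, has finitely many maximizers, denoted by $(a_j)_{j\in J}$, satisfying $A^{(k)}(a_j)=0$ for all $1\le k\le 2m_j-1$ and $A^{(2m_j)}(a_j)<0$ for all $j\in J$, with $(m_j)_{j\in J}\subset\mathbb N$ and $m_*=\max_{j\in J}m_j$. Define $$J_1^+=\{j\in J:f(a_j)=\max_{k\in J}f(a_k)\},\quad J_2^+=\{j\in J_1^+:m_j=\max_{k\in J_1^+}m_k\},$$ $$J_1^-=\{j\in J:f(a_j)=\min_{k\in J}f(a_k)\},\quad J_2^-=\{j\in J_1^-:m_j=\max_{k\in J_1^-}m_k\}.$$ Assume that $J_2^-\cup J_2^+\subset J_*:=\{j\in J:m_j=m_*\}$, and that there exist $j\in J_2^-$ and $k\in J_2^+$ such that $f'(a_j)f'(a_k)\ne0$. Then $$(\hat\beta_n-\beta)\,n^{1-1/(2m_* )}\longrightarrow U\quad\text{in law},$$ where the distribution of $U$ is given by $$\mathbb P[U\le t]=\sum_{j\in J_2^-}p_j\,\mathbf 1[f'(a_j)\ne0]\;\mathbb P\Big[Y_j\le\sum_{k\in J_2^-}\frac{f'(a_k)}{f'(a_j)}\,p_k^-(t)\,\mathbb EY_k(t)\Big],\qquad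 t<0,$$ $$\mathbb P[U>t]=\sum_{j\in J_2^+}p_j\,\mathbf 1[f'(a_j)\ne0]\;\mathbb P\Big[Y_j>\sum_{k\in J_2^+}\frac{f'(a_k)}{f'(a_j)}\,p_k^+(t)\,\mathbb EY_k(t)\Big],\qquad t>0,$$ $$\mathbb P[U=0]=1-\frac12\sum_{j\in J_2^+\cup J_2^-}p_j\,\mathbf 1[f'(a_j)\ne0].$$ Here, with $c_j=A^{(2m_j)}(a_j)/(2m_j)!$ and $\nu_j=\log\sqrt{1/((1-a_j)a_j)}$: for $t\in\mathbb R$ and $j\in J_*$, $Y_j(t)$ is a random variable with density proportional to $\exp(c_jx^{2m_j}+tf'(a_j)x)$, $Y_j=Y_j(0)$, $q_j(t)=\int_{\mathbb R}\exp(c_jx^{2m_j}+tf'(a_j)x)\,dx$, $$p_j=\frac{q_j(0)e^{\nu_j}}{\sum_{i\in J_*}q_i(0)e^{\nu_i}}\ (j\in J_* ),\qquad p_k^{\pm}(t)=\frac{q_k(t)e^{\nu_k}}{\sum_{i\in J_2^{\pm}}q_i(t)e^{\nu_i}}\ (k\in J_2^{\pm}).$$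
   Context: For $\omega\in\Omega_n=\{1,-1\}^n$, $\bar\omega_+=|\{i:\omega_i=1\}|/n$. The entropy function is $I(a)=-a\log a+(a-1)\log(1-a)$, $a\in[0,1]$, with the convention $0\cdot\log0=0$. The linear model is the probability measure $\mu_n$ on $\Omega_n$ proportional to $\exp(H_n(\omega))=\exp\big(n(\beta f(\bar\omega_+)+g(\bar\omega_+))\big)$, where $\beta\in\mathbb R$ and $f,g:[0,1]\to\mathbb R$ are non-constant known functions; $\beta$ is to be estimated from one sample $\omega$ of $\mu_n$. Let $\mathbb E_\gamma$ denote expectation under the measure with $\beta$ replaced by $\gamma$ and $u(\gamma)=u_n(\gamma)=\mathbb E_\gamma f(\bar\omega_+)$, which is strictly increasing in $\gamma$. The maximum likelihood estimator is the solution of $u(\hat\beta_n)=f(\bar\omega_+)$, i.e. $\hat\beta_n=u^{-1}(f(\bar\omega_+))$. $\mathbb N=\{1,2,\dots\}$, and convergence is as $n\to\infty$ under $\mu_n$.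
   Formalization: In the thresholds for Y_j the factor f'(a_k)/f'(a_j) is replaced by f'(a_k)/|f'(a_j)|, and in P[U=0] the sum over J_2^+ ∪ J_2^- is replaced by the sum over J_2^+ plus the sum over J_2^- (common indices counted twice); as printed these formulas need not define a law. *)

theory Defs
  imports "HOL-Probability.Probability"
begin

text \<open>
  \<open>C\<^sup>k(S)\<close> for a real interval \<open>S\<close>: derivatives are taken within \<open>S\<close>, hence one-sided
  at end points belonging to \<open>S\<close>. The values of the function outside \<open>S\<close> are irrelevant.
\<close>
definition Ck_on :: "nat \<Rightarrow> (real \<Rightarrow> real) \<Rightarrow> real set \<Rightarrow> bool" where
  "Ck_on k f S \<longleftrightarrow> (\<exists>D :: nat \<Rightarrow> real \<Rightarrow> real. D 0 = f \<and>
     (\<forall>i<k. \<forall>x\<in>S. (D i has_real_derivative D (Suc i) x) (at x within S)) \<and>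
     (\<forall>i\<le>k. continuous_on S (D i)))"

text \<open>The convention \<open>0 \<cdot> log 0 = 0\<close> is automatic here.\<close>
definition entropy_fun :: "real \<Rightarrow> real" where
  "entropy_fun a = - a * ln a + (a - 1) * ln (1 - a)"

definition spins :: "nat \<Rightarrow> (nat \<Rightarrow> int) set" where
  "spins n = ({1..n} \<rightarrow>\<^sub>E {1, -1})"

definition plus_frac :: "nat \<Rightarrow> (nat \<Rightarrow> int) \<Rightarrow> real" where
  "plus_frac n \<omega> = real (card {i \<in> {1..n}. \<omega> i = 1}) / real n"

definition hamiltonian ::
  "(real \<Rightarrow> real) \<Rightarrow> (real \<Rightarrow> real) \<Rightarrow> real \<Rightarrow> nat \<Rightarrow> (nat \<Rightarrow> int) \<Rightarrow> real" where
  "hamiltonian f g \<beta> n \<omega> = real n * (\<beta> * f (plus_frac n \<omega>) + g (plus_frac n \<omega>))"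

definition gibbs ::
  "(real \<Rightarrow> real) \<Rightarrow> (real \<Rightarrow> real) \<Rightarrow> real \<Rightarrow> nat \<Rightarrow> (nat \<Rightarrow> int) measure" where
  "gibbs f g \<beta> n = point_measure (spins n)
     (\<lambda>\<omega>. ennreal (exp (hamiltonian f g \<beta> n \<omega>) / (\<Sum>\<eta>\<in>spins n. exp (hamiltonian f g \<beta> n \<eta>))))"

definition mean_f :: "(real \<Rightarrow> real) \<Rightarrow> (real \<Rightarrow> real) \<Rightarrow> nat \<Rightarrow> real \<Rightarrow> real" where
  "mean_f f g n \<gamma> = (\<integral>\<omega>. f (plus_frac n \<omega>) \<partial>gibbs f g \<gamma> n)"

text \<open>
  The maximum likelihood estimator. The equation has no solution when \<open>f (plus_frac n \<omega>)\<close> is the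
  largest or smallest value of \<open>f\<close> on the grid \<open>{0, 1/n, \<dots>, 1}\<close>; there the estimator takes
  an unspecified real value.
\<close>
definition mle :: "(real \<Rightarrow> real) \<Rightarrow> (real \<Rightarrow> real) \<Rightarrow> nat \<Rightarrow> (nat \<Rightarrow> int) \<Rightarrow> real" where
  "mle f g n \<omega> = (THE b. mean_f f g n b = f (plus_frac n \<omega>))"

text \<open>The law on the real line with density proportional to the weight \<open>w\<close>.\<close>
definition law_prop :: "(real \<Rightarrow> real) \<Rightarrow> real measure" where
  "law_prop w = density lborel (\<lambda>x. ennreal (w x / (\<integral>y. w y \<partial>lborel)))"

end

theory Submission
  imports Defs "HOL-Real_Asymp.Real_Asymp"
begin

text \<open>
  Under the Gibbs measure the magnetisation \<open>k / n\<close> has weight \<open>binomial(n,k) exp (n (\<beta> f + g))\<close>,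
  which by Stirling's formula is \<open>exp (n A)\<close> up to a smooth factor, so a discrete Laplace method applies:
  the mass concentrates at the maximizers \<open>a\<^sub>j\<close> of \<open>A\<close>, those with \<open>m\<^sub>j = m\<^sub>*\<close> dominate, and
  \<open>n powr \<theta> (k / n - a\<^sub>j)\<close> with \<open>\<theta> = 1 / (2 m\<^sub>*)\<close> converges to \<open>Y\<^sub>j\<close>.

  Shifting \<open>\<beta>\<close> by \<open>t n powr (\<theta> - 1)\<close> multiplies the weights by \<open>exp (t n powr \<theta> f(k / n))\<close>. For
  \<open>t > 0\<close> this selects the maximizers with the largest \<open>f(a\<^sub>j)\<close> and tilts the local limits to
  \<open>Y\<^sub>j(t)\<close>; for \<open>t < 0\<close> those with the smallest. Hence the mean of \<open>f\<close> under the shifted measure is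
  \<open>f(a\<^sub>\<plusminus>) + n powr (- \<theta>) (T(t) + o(1))\<close> for an explicit threshold \<open>T(t)\<close>. Since the mean is
  strictly increasing in the parameter, the estimator exceeds \<open>\<beta> + t n powr (\<theta> - 1)\<close> exactly when
  \<open>f(k / n)\<close> exceeds this mean, and the limit of the probability of that event is read off from the
  local limits at \<open>t = 0\<close>.
\<close>

section \<open>Stirling's formula for binomial coefficients\<close>

text \<open>The scale is forced: near a dominating maximizer \<open>f(k / n)\<close> fluctuates by
  \<open>n powr (- \<theta>)\<close>, so a shift of \<beta> by \<open>n powr (\<theta> - 1)\<close>
  changes the exponent \<open>n \<beta> f(k / n)\<close> by an amount whose fluctuations are of
  order one. The obstacle is t = 0. Without a shift all dominating maximizers keep mass, the mean of
  f may lie strictly between their values \<open>f(a j)\<close>, and no threshold on the scale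
  \<open>n powr (- \<theta>)\<close> exists. Hence only tails at t \<noteq> 0 are computed. The
  limit law is glued from them, and its atom at 0 is the mass that they leave over: samples near
  maximizers with an intermediate value of f or with zero derivative, and, if the extreme values of
  f differ, half of the samples near the extreme ones. The limiting event is
  \<open>f'(a j) * Y j > T(t)\<close>. The atom involves two separate sums because an index lying in
  both \<open>J2p\<close> and \<open>J2m\<close> loses one half to each tail.\<close>

definition stirling_log :: "nat \<Rightarrow> real" where
  "stirling_log n = ln (fact n) - (real n + 1/2) * ln (real n) + real n"

text \<open>The increments \<open>1 - (n + 1/2) * ln (1 + 1/n)\<close> are O(1/n^2), since the
  summand 1/2 cancels the term of order 1/n. They are therefore summable, and telescoping gives the
  limit.\<close>

lemma stirling_log_convergent: "convergent stirling_log"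
proof -
  let ?s = "\<lambda>n. stirling_log (Suc n) - stirling_log n"
  have eq: "?s n = 1 - (real n + 1/2) * (ln (real n + 1) - ln (real n))" if "n \<ge> 1" for n
  proof -
    have "ln (fact (Suc n)) = ln (real n + 1) + ln (fact n :: real)"
      by (simp add: ln_mult flip: of_nat_Suc)
    then show ?thesis
      using that unfolding stirling_log_def by (simp add: algebra_simps)
  qed
  have "(\<lambda>n. 1 - (real n + 1/2) * (ln (real n + 1) - ln (real n))) \<in> O(\<lambda>n. 1 / real n ^ 2)"
    by real_asymp
  also have "?this \<longleftrightarrow> ?s \<in> O(\<lambda>n. 1 / real n ^ 2)"
    by (rule landau_o.big.in_cong) (use eq in \<open>auto intro!: eventually_sequentiallyI[of 1]\<close>)
  finally have "summable ?s"
    by (rule summable_comparison_test_bigo[rotated])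
      (simp add: inverse_power_summable inverse_eq_divide[symmetric])
  then have "(\<lambda>n. \<Sum>k<n. ?s k) \<longlonglongrightarrow> suminf ?s"
    by (rule summable_LIMSEQ)
  then have "(\<lambda>n. (stirling_log n - stirling_log 0) + stirling_log 0) \<longlonglongrightarrow> suminf ?s + stirling_log 0"
    by (intro tendsto_add tendsto_const) (simp add: sum_lessThan_telescope)
  then show ?thesis
    by (auto simp: convergent_def)
qed

lemma fact_eq_stirling_log:
  "n \<ge> 1 \<Longrightarrow> fact n = exp (stirling_log n + (real n + 1/2) * ln (real n) - real n)"
  by (simp add: stirling_log_def)

text \<open>This is an identity rather than an asymptotic statement: the whole error sits in three
  values of \<open>stirling_log\<close>. Convergence of that sequence then yields the pointwise
  limit, and its boundedness yields a uniform bound.\<close>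

lemma binomial_eq_entropy:
  assumes "1 \<le> k" "k < n"
  defines "x \<equiv> real k / real n"
  shows "sqrt (real n) * real (n choose k) =
    exp (stirling_log n - stirling_log k - stirling_log (n - k)) / sqrt (x * (1 - x))
      * exp (real n * entropy_fun x)"
proof -
  have x: "0 < x" "x < 1" and nx: "real k = real n * x" "real (n - k) = real n * (1 - x)"
    using assms by (auto simp: x_def field_simps of_nat_diff)
  have n: "real n > 0" using assms by simp
  have "real (n choose k) = fact n / (fact k * fact (n - k))"
    using assms by (simp add: binomial_fact)
  also have "\<dots> = exp (stirling_log n - stirling_log k - stirling_log (n - k)
      + ((real n + 1/2) * ln (real n) - (real k + 1/2) * ln (real k)
         - (real (n - k) + 1/2) * ln (real (n - k))))"
  proof -
    have *: "exp a / (exp b * exp c) = exp (a - b - c)" for a b c :: real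
      by (simp add: exp_diff)
    have "fact n / (fact k * fact (n - k)) =
        exp (stirling_log n + (real n + 1/2) * ln (real n) - real n) /
        (exp (stirling_log k + (real k + 1/2) * ln (real k) - real k) *
         exp (stirling_log (n - k) + (real (n - k) + 1/2) * ln (real (n - k)) - real (n - k)))"
      using assms(1,2)
      by (intro arg_cong2[where f = "(/)"] arg_cong2[where f = times] fact_eq_stirling_log) auto
    also have "\<dots> = exp (stirling_log n - stirling_log k - stirling_log (n - k)
      + ((real n + 1/2) * ln (real n) - (real k + 1/2) * ln (real k)
         - (real (n - k) + 1/2) * ln (real (n - k))))"
      unfolding * using assms(2) by (intro arg_cong[where f = exp]) (simp add: of_nat_diff)
    finally show ?thesis .
  qed
  also have "(real n + 1/2) * ln (real n) - (real k + 1/2) * ln (real k)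
         - (real (n - k) + 1/2) * ln (real (n - k))
     = real n * entropy_fun x - (ln (real n) + ln x + ln (1 - x)) / 2"
  proof -
    have "ln (real n * x) = ln (real n) + ln x" "ln (real n * (1 - x)) = ln (real n) + ln (1 - x)"
      using x n by (simp_all add: ln_mult)
    then show ?thesis
      unfolding nx entropy_fun_def by (simp only:) (simp add: field_simps)
  qed
  also have "exp (stirling_log n - stirling_log k - stirling_log (n - k)
      + (real n * entropy_fun x - (ln (real n) + ln x + ln (1 - x)) / 2))
    = exp (stirling_log n - stirling_log k - stirling_log (n - k)) * exp (real n * entropy_fun x)
       / exp ((ln (real n) + ln x + ln (1 - x)) / 2)"
    by (simp add: exp_add exp_diff)
  also have "exp ((ln (real n) + ln x + ln (1 - x)) / 2) = sqrt (real n) * sqrt (x * (1 - x))"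
    using x n by (simp add: exp_add add_divide_distrib real_sqrt_mult flip: ln_sqrt)
  finally show ?thesis using n by simp
qed

text \<open>A single term of the expansion of \<open>(x + (1 - x)) ^ n = 1\<close> at
  \<open>x = k / n\<close> is at most 1. The bound has no prefactor and holds up to the endpoints,
  where the Stirling form degenerates; it serves far from the maximizers.\<close>

lemma binomial_le_exp_entropy:
  assumes "k \<le> n"
  shows "real (n choose k) \<le> exp (real n * entropy_fun (real k / real n))"
proof (cases "k = 0 \<or> k = n")
  case True
  then show ?thesis by (cases "n = 0") (auto simp: entropy_fun_def)
next
  case False
  define x where "x = real k / real n"
  have x: "0 < x" "x < 1" and nx: "real k = real n * x" "real (n - k) = real n * (1 - x)"
    using assms False by (auto simp: x_def field_simps of_nat_diff)
  have "real (n choose k) * x ^ k * (1 - x) ^ (n - k) \<le> (\<Sum>i\<le>n. real (n choose i) * x ^ i * (1 - x) ^ (n - i))"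
    by (rule member_le_sum) (use x assms in auto)
  also have "\<dots> = 1"
    using binomial_ring[of x "1 - x" n] by simp
  also have "x ^ k = exp (real n * x * ln x)"
    using x by (simp add: powr_def flip: powr_realpow nx(1))
  also have "(1 - x) ^ (n - k) = exp (real n * (1 - x) * ln (1 - x))"
    using x by (simp add: powr_def flip: powr_realpow nx(2))
  finally have "real (n choose k) * exp (- (real n * entropy_fun x)) \<le> 1"
    by (simp add: entropy_fun_def mult.assoc exp_add[symmetric] algebra_simps)
  then show ?thesis
    unfolding x_def[symmetric] by (simp add: exp_minus field_simps)
qed

text \<open>
  Its value \<open>1 / sqrt (2 \<pi>)\<close> is irrelevant, since it cancels in all normalised sums.
\<close>
definition stirling_const :: real where
  "stirling_const = exp (- lim stirling_log)"

lemma stirling_const_pos: "stirling_const > 0"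
  by (simp add: stirling_const_def)

text \<open>Since x is interior, both \<open>k n\<close> and \<open>n - k n\<close> tend to
  infinity. All three values of \<open>stirling_log\<close> then have the same limit, and one copy
  with a negative sign survives in the exponent, which is \<open>stirling_const\<close>.\<close>

lemma binomial_entropy_tendsto:
  assumes k: "(\<lambda>n. real (k n) / real n) \<longlonglongrightarrow> x" and x: "0 < x" "x < 1"
  shows "(\<lambda>n. sqrt (real n) * real (n choose k n) * exp (- (real n * entropy_fun (real (k n) / real n))))
     \<longlonglongrightarrow> stirling_const / sqrt (x * (1 - x))"
proof -
  have lim: "stirling_log \<longlonglongrightarrow> lim stirling_log"
    using stirling_log_convergent by (simp add: convergent_LIMSEQ_iff)
  have k1: "\<forall>\<^sub>F n in sequentially. real (k n) / real n < 1"
    and k0: "\<forall>\<^sub>F n in sequentially. real (k n) / real n > 0"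
    using k x by (auto dest: order_tendstoD)
  have ev: "\<forall>\<^sub>F n in sequentially. 1 \<le> k n \<and> k n < n"
    using k1 k0 eventually_gt_at_top[of 0] by eventually_elim (auto simp: field_simps)
  have "filterlim (\<lambda>n. real (k n) / real n * real n) at_top sequentially"
    using filterlim_tendsto_pos_mult_at_top[OF k x(1) filterlim_real_sequentially] .
  moreover have "\<forall>\<^sub>F n in sequentially. real (k n) / real n * real n = real (k n)"
    using ev by eventually_elim simp
  ultimately have "filterlim (\<lambda>n. real (k n)) at_top sequentially"
    by (simp add: filterlim_cong[OF refl refl])
  then have K: "filterlim k at_top sequentially"
    by (simp add: filterlim_sequentially_iff_filterlim_real)
  have "(\<lambda>n. 1 - real (k n) / real n) \<longlonglongrightarrow> 1 - x"
    by (intro tendsto_intros k)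
  then have "filterlim (\<lambda>n. (1 - real (k n) / real n) * real n) at_top sequentially"
    using x by (intro filterlim_tendsto_pos_mult_at_top[where c = "1 - x"] filterlim_real_sequentially) auto
  moreover have "\<forall>\<^sub>F n in sequentially. (1 - real (k n) / real n) * real n = real (n - k n)"
    using ev by eventually_elim (simp add: field_simps of_nat_diff)
  ultimately have "filterlim (\<lambda>n. real (n - k n)) at_top sequentially"
    by (simp add: filterlim_cong[OF refl refl])
  then have NK: "filterlim (\<lambda>n. n - k n) at_top sequentially"
    by (simp add: filterlim_sequentially_iff_filterlim_real)
  have "(\<lambda>n. exp (stirling_log n - stirling_log (k n) - stirling_log (n - k n))
      / sqrt (real (k n) / real n * (1 - real (k n) / real n)))
    \<longlonglongrightarrow> exp (lim stirling_log - lim stirling_log - lim stirling_log) / sqrt (x * (1 - x))"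
    using x by (intro tendsto_intros lim k filterlim_compose[OF lim K] filterlim_compose[OF lim NK]) auto
  then have "(\<lambda>n. exp (stirling_log n - stirling_log (k n) - stirling_log (n - k n))
      / sqrt (real (k n) / real n * (1 - real (k n) / real n)))
    \<longlonglongrightarrow> stirling_const / sqrt (x * (1 - x))"
    by (simp add: stirling_const_def)
  then show ?thesis
  proof (rule Lim_transform_eventually)
    show "\<forall>\<^sub>F n in sequentially. exp (stirling_log n - stirling_log (k n) - stirling_log (n - k n))
        / sqrt (real (k n) / real n * (1 - real (k n) / real n))
      = sqrt (real n) * real (n choose k n) * exp (- (real n * entropy_fun (real (k n) / real n)))"
      using ev by eventually_elim (simp add: binomial_eq_entropy exp_minus)
  qed
qed

text \<open>The exponent is at most three times a bound of \<open>stirling_log\<close>, and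
  \<open>sqrt (x * (1 - x))\<close> is at least \<delta>. This constant enters the dominating
  function of the local Laplace argument.\<close>

lemma binomial_entropy_bound:
  assumes "0 < \<delta>"
  obtains C where "C > 0"
    "\<And>n k. \<lbrakk>n \<ge> 1; k \<le> n; \<delta> \<le> real k / real n; real k / real n \<le> 1 - \<delta>\<rbrakk> \<Longrightarrow>
       sqrt (real n) * real (n choose k) \<le> C * exp (real n * entropy_fun (real k / real n))"
proof -
  obtain B where B: "\<And>n. \<bar>stirling_log n\<bar> \<le> B"
    using convergent_imp_Bseq[OF stirling_log_convergent] by (auto simp: Bseq_def)
  show ?thesis
  proof (rule that)
    show "exp (3 * B) / \<delta> > 0" using assms by simp
    fix n k :: nat
    assume *: "n \<ge> 1" "k \<le> n" "\<delta> \<le> real k / real n" "real k / real n \<le> 1 - \<delta>"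
    define x where "x = real k / real n"
    have x: "\<delta> \<le> x" "\<delta> \<le> 1 - x" using * by (auto simp: x_def)
    have k: "1 \<le> k" "k < n"
      using x assms * by (auto simp: x_def Suc_le_eq intro!: Nat.gr0I order.not_eq_order_implies_strict)
    have "\<delta> = sqrt (\<delta> * \<delta>)" using assms by simp
    also have "\<dots> \<le> sqrt (x * (1 - x))"
      using x assms by (intro real_sqrt_le_mono mult_mono) auto
    finally have s: "\<delta> \<le> sqrt (x * (1 - x))" .
    have "sqrt (real n) * real (n choose k) =
      exp (stirling_log n - stirling_log k - stirling_log (n - k)) / sqrt (x * (1 - x))
      * exp (real n * entropy_fun x)"
      unfolding x_def by (rule binomial_eq_entropy[OF k])
    also have "\<dots> \<le> exp (3 * B) / \<delta> * exp (real n * entropy_fun x)"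
      using B[of n] B[of k] B[of "n - k"] s assms
      by (intro mult_right_mono frac_le) auto
    finally show "sqrt (real n) * real (n choose k) \<le> exp (3 * B) / \<delta> * exp (real n * entropy_fun (real k / real n))"
      by (simp add: x_def)
  qed
qed

section \<open>Expansion at the maximizers\<close>

text \<open>Links the two ways of speaking about higher derivatives: smoothness provides a chain
  \<open>D\<close>, whereas flatness of A is stated with iterated \<open>deriv\<close>. Openness of
  \<open>S\<close> matters because \<open>deriv\<close> looks at a neighbourhood.\<close>

lemma iterated_deriv_eq:
  fixes D :: "nat \<Rightarrow> real \<Rightarrow> real"
  assumes "open S" and D: "\<And>i x. i < N \<Longrightarrow> x \<in> S \<Longrightarrow> (D i has_real_derivative D (Suc i) x) (at x)"
    and "k \<le> N" "x \<in> S"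
  shows "(deriv ^^ k) (D 0) x = D k x"
  using assms(3,4)
proof (induction k arbitrary: x)
  case (Suc k)
  have "(D k has_real_derivative D (Suc k) x) (at x)"
    using D Suc.prems by auto
  then have "((deriv ^^ k) (D 0) has_real_derivative D (Suc k) x) (at x)"
    using \<open>open S\<close> Suc.prems(2)
    by (rule has_field_derivative_transform_within_open) (use Suc in auto)
  then show ?case by (simp add: DERIV_imp_deriv)
qed simp

text \<open>\<Psi> is the difference quotient of order N. By Taylor's formula with Lagrange
  remainder it equals \<open>D N t / fact N\<close> for some t between a and x, so continuity of
  \<open>D N\<close> at a carries over. The factorization itself holds for all x, directly from the
  definition of \<Psi>.\<close>

lemma taylor_quotient_continuous:
  fixes D :: "nat \<Rightarrow> real \<Rightarrow> real"
  assumes D: "\<And>i x. i < N \<Longrightarrow> l < x \<Longrightarrow> x < r \<Longrightarrow> (D i has_real_derivative D (Suc i) x) (at x)"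
    and N: "N > 0" and cont: "isCont (D N) a" and a: "l < a" "a < r"
    and flat: "\<And>i. 1 \<le> i \<Longrightarrow> i < N \<Longrightarrow> D i a = 0"
  obtains \<Psi> where "isCont \<Psi> a" "\<Psi> a = D N a / fact N"
    "\<And>x. D 0 x = D 0 a + \<Psi> x * (x - a) ^ N"
proof -
  define \<Psi> where "\<Psi> x = (if x = a then D N a / fact N else (D 0 x - D 0 a) / (x - a) ^ N)" for x
  have eq: "\<exists>t. \<bar>t - a\<bar> < \<bar>x - a\<bar> \<and> \<Psi> x = D N t / fact N" if "l < x" "x < r" "x \<noteq> a" for x
  proof -
    have "\<exists>t. (if x < a then x < t \<and> t < a else a < t \<and> t < x) \<and>
      D 0 x = (\<Sum>m<N. (D m a / fact m) * (x - a)^m) + (D N t / fact N) * (x - a)^N"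
      by (rule Taylor[where a = "min x a" and b = "max x a"]) (use D N that a in auto)
    then obtain t where t: "if x < a then x < t \<and> t < a else a < t \<and> t < x"
      "D 0 x = (\<Sum>m<N. (D m a / fact m) * (x - a)^m) + (D N t / fact N) * (x - a)^N" by blast
    have "(\<Sum>m<N. (D m a / fact m) * (x - a)^m) = (\<Sum>m<N. if m = 0 then D 0 a else 0)"
      by (rule sum.cong) (use flat in auto)
    with t(2) have "D 0 x = D 0 a + (D N t / fact N) * (x - a)^N"
      using N by simp
    then have "\<Psi> x = D N t / fact N" using that by (simp add: \<Psi>_def)
    moreover have "\<bar>t - a\<bar> < \<bar>x - a\<bar>" using t(1) that by (auto split: if_splits)
    ultimately show ?thesis by blast
  qed
  have "isCont \<Psi> a"
    unfolding continuous_at_eps_delta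
  proof (intro allI impI)
    fix e :: real assume "e > 0"
    have "isCont (\<lambda>x. D N x / fact N) a" using cont by (intro continuous_intros) auto
    with \<open>e > 0\<close> obtain d where d: "d > 0" "\<And>x. \<bar>x - a\<bar> < d \<Longrightarrow> \<bar>D N x / fact N - D N a / fact N\<bar> < e"
      unfolding continuous_at_eps_delta dist_real_def by blast
    show "\<exists>d>0. \<forall>x'. dist x' a < d \<longrightarrow> dist (\<Psi> x') (\<Psi> a) < e"
    proof (intro exI[of _ "min d (min (a - l) (r - a))"] conjI allI impI)
      fix x assume x: "dist x a < min d (min (a - l) (r - a))"
      show "dist (\<Psi> x) (\<Psi> a) < e"
      proof (cases "x = a")
        case False
        then obtain t where "\<bar>t - a\<bar> < \<bar>x - a\<bar>" "\<Psi> x = D N t / fact N"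
          using eq[of x] x by (auto simp: dist_real_def abs_less_iff)
        then show ?thesis using d(2)[of t] x by (simp add: dist_real_def \<Psi>_def)
      qed (use \<open>e > 0\<close> in simp)
    qed (use d a in auto)
  qed
  moreover have "\<Psi> a = D N a / fact N" by (simp add: \<Psi>_def)
  moreover have "D 0 x = D 0 a + \<Psi> x * (x - a) ^ N" for x
    using N by (simp add: \<Psi>_def)
  ultimately show thesis by (rule that)
qed

section \<open>The entropy function: derivatives, continuity, steepness at the endpoints\<close>

lemma entropy_fun_derivatives:
  obtains E :: "nat \<Rightarrow> real \<Rightarrow> real" where "E 0 = entropy_fun"
    "\<And>i x. 0 < x \<Longrightarrow> x < 1 \<Longrightarrow> (E i has_real_derivative E (Suc i) x) (at x)"
proof -
  \<comment> \<open>From order two on, the formula is that of the repeated derivative of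
    \<open>ln (1 - x) - ln x\<close>; the factorials are those of the derivatives of
    \<open>inverse\<close>.\<close>
  define E where "E = (\<lambda>i x :: real. if i = 0 then entropy_fun x else if i = 1 then ln (1 - x) - ln x
    else (-1) ^ (i - 1) * fact (i - 2) * inverse x ^ (i - 1) - fact (i - 2) * inverse (1 - x) ^ (i - 1))"
  have "(E i has_real_derivative E (Suc i) x) (at x)" if x: "0 < x" "x < 1" for i x
  proof -
    consider "i = 0" | "i = 1" | j where "i = Suc (Suc j)"
      by (metis One_nat_def not0_implies_Suc)
    then show ?thesis
    proof cases
      case 1
      have "((\<lambda>a. - a * ln a + (a - 1) * ln (1 - a)) has_real_derivative
          (- 1 * ln x + 1 / x * (- x)) + (1 * ln (1 - x) + - 1 / (1 - x) * (x - 1))) (at x)"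
        using x by (auto intro!: derivative_eq_intros)
      moreover have "1 / x * (- x) = - 1" "- 1 / (1 - x) * (x - 1) = 1"
        using x by (auto simp: divide_simps)
      ultimately have "((\<lambda>a. - a * ln a + (a - 1) * ln (1 - a)) has_real_derivative ln (1 - x) - ln x) (at x)"
        by simp
      with 1 show ?thesis by (simp add: E_def entropy_fun_def[abs_def])
    next
      case 2
      have "((\<lambda>a. ln (1 - a) - ln a) has_real_derivative - inverse x - inverse (1 - x)) (at x)"
        using x by (auto intro!: derivative_eq_intros simp: field_simps)
      with 2 show ?thesis by (simp add: E_def)
    next
      case 3
      have 1: "((\<lambda>a. inverse a ^ Suc j) has_real_derivative - (real (Suc j) * inverse x ^ Suc (Suc j))) (at x)"
        if "x \<noteq> 0" for x :: real
        using DERIV_power_Suc[OF DERIV_inverse[OF that], of j] by (simp add: algebra_simps)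
      have "((\<lambda>a. 1 - a) has_real_derivative - 1) (at x)"
        by (auto intro!: derivative_eq_intros)
      from DERIV_chain2[OF 1[of "1 - x"] this]
      have 2: "((\<lambda>a. inverse (1 - a) ^ Suc j) has_real_derivative real (Suc j) * inverse (1 - x) ^ Suc (Suc j)) (at x)"
        using x by (simp del: power_Suc of_nat_Suc)
      have "((\<lambda>a. (-1) ^ Suc j * fact j * inverse a ^ Suc j - fact j * inverse (1 - a) ^ Suc j) has_real_derivative
        (-1) ^ Suc j * fact j * (- (real (Suc j) * inverse x ^ Suc (Suc j))) - fact j * (real (Suc j) * inverse (1 - x) ^ Suc (Suc j))) (at x)"
        using x by (intro DERIV_diff DERIV_cmult 1 2) auto
      then have "((\<lambda>a. (-1) ^ Suc j * fact j * inverse a ^ Suc j - fact j * inverse (1 - a) ^ Suc j) has_real_derivative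
        (-1) ^ Suc (Suc j) * fact (Suc j) * inverse x ^ Suc (Suc j) - fact (Suc j) * inverse (1 - x) ^ Suc (Suc j)) (at x)"
        by (simp add: algebra_simps)
      with 3 show ?thesis by (simp add: E_def)
    qed
  qed
  moreover have "E 0 = entropy_fun" by (simp add: E_def)
  ultimately show thesis using that by blast
qed

lemma continuous_on_entropy_fun: "continuous_on {0..1} entropy_fun"
proof -
  have *: "continuous_on {0..1} (\<lambda>x::real. x * ln x)"
  proof (clarsimp simp: continuous_on_eq_continuous_within)
    fix x :: real assume x: "0 \<le> x" "x \<le> 1"
    show "continuous (at x within {0..1}) (\<lambda>x. x * ln x)"
    proof (cases "x = 0")
      case True
      have "((\<lambda>x::real. x * ln x) \<longlongrightarrow> 0) (at_right 0)" by real_asymp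
      with True show ?thesis
        by (simp add: continuous_within at_within_Icc_at_right)
    qed (use x in \<open>auto intro!: continuous_intros\<close>)
  qed
  have "continuous_on {0..1} (\<lambda>x::real. (1 - x) * ln (1 - x))"
    by (rule continuous_on_compose2[OF *, of _ "\<lambda>x. 1 - x"]) (auto intro!: continuous_intros)
  with * have "continuous_on {0..1} (\<lambda>x::real. - (x * ln x) - (1 - x) * ln (1 - x))"
    by (intro continuous_on_diff continuous_on_minus)
  then show ?thesis
    by (rule continuous_on_cong[THEN iffD1, rotated -1]) (auto simp: entropy_fun_def algebra_simps)
qed

lemma entropy_fun_ge: "0 < x \<Longrightarrow> x < 1 \<Longrightarrow> entropy_fun x \<ge> - x * ln x"
  by (auto simp: entropy_fun_def intro!: mult_nonpos_nonpos)

lemma entropy_fun_reflect: "entropy_fun (1 - x) = entropy_fun x"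
  by (simp add: entropy_fun_def algebra_simps)

text \<open>The entropy has infinite slope at 0 and 1, so moving slightly inwards from an endpoint
  gains more than a Lipschitz function B can lose.\<close>

lemma entropy_maximizer_interior:
  fixes B :: "real \<Rightarrow> real"
  assumes lip: "\<And>x y. x \<in> {0..1} \<Longrightarrow> y \<in> {0..1} \<Longrightarrow> \<bar>B x - B y\<bar> \<le> K * \<bar>x - y\<bar>"
    and x: "x \<in> {0..1}" "\<And>y. y \<in> {0..1} \<Longrightarrow> B y + entropy_fun y \<le> B x + entropy_fun x"
  shows "0 < x" "x < 1"
proof -
  have "K \<ge> 0" using lip[of 0 1] by auto
  \<comment> \<open>Chosen so that \<open>- ln e = K + 1\<close>: the entropy gain is then at least
    \<open>(K + 1) * e\<close>, while B changes by at most \<open>K * e\<close>.\<close>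
  define e where "e = exp (- (K + 1))"
  have e: "0 < e" "e < 1" "ln e = - (K + 1)" using \<open>K \<ge> 0\<close> by (auto simp: e_def)
  have "entropy_fun e \<ge> (K + 1) * e"
    using entropy_fun_ge[OF e(1,2)] unfolding e(3) by (simp add: algebra_simps)
  moreover have "(K + 1) * e > K * e" using e by (simp add: algebra_simps)
  ultimately have gt: "entropy_fun e > K * e" by linarith
  have "x \<noteq> 0"
    using x(2)[of e] lip[of e 0] e gt by (auto simp: entropy_fun_def)
  moreover have "x \<noteq> 1"
    using x(2)[of "1 - e"] lip[of "1 - e" 1] e gt entropy_fun_reflect[of e] by (auto simp: entropy_fun_def)
  ultimately show "0 < x" "x < 1" using x(1) by auto
qed

lemma Ck_on_lipschitz:
  assumes "Ck_on k f {l..r}" "k \<ge> 1"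
  obtains K where "\<And>x y. x \<in> {l..r} \<Longrightarrow> y \<in> {l..r} \<Longrightarrow> \<bar>f x - f y\<bar> \<le> K * \<bar>x - y\<bar>"
proof -
  obtain D where D: "D 0 = f" "\<And>i x. i < k \<Longrightarrow> x \<in> {l..r} \<Longrightarrow> (D i has_real_derivative D (Suc i) x) (at x within {l..r})"
    "\<And>i. i \<le> k \<Longrightarrow> continuous_on {l..r} (D i)"
    using assms(1) unfolding Ck_on_def by blast
  have "bounded (D 1 ` {l..r})"
    by (intro compact_imp_bounded compact_continuous_image D assms(2)) auto
  then obtain K where "\<forall>x\<in>{l..r}. norm (D 1 x) \<le> K"
    unfolding bounded_iff by (auto simp del: atLeastAtMost_iff)
  then have "norm (f x - f y) \<le> K * norm (x - y)" if "x \<in> {l..r}" "y \<in> {l..r}" for x y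
    using D(2)[of 0] assms(2) that
    by (intro field_differentiable_bound[where S = "{l..r}" and f' = "D 1"]) (auto simp: D(1))
  then show thesis by (intro that[of K]) auto
qed

lemma Ck_on_derivatives:
  assumes "Ck_on k f {l..r}"
  obtains D where "D 0 = f" "\<And>i x. i < k \<Longrightarrow> l < x \<Longrightarrow> x < r \<Longrightarrow> (D i has_real_derivative D (Suc i) x) (at x)"
proof -
  obtain D where D: "D 0 = f" "\<And>i x. i < k \<Longrightarrow> x \<in> {l..r} \<Longrightarrow> (D i has_real_derivative D (Suc i) x) (at x within {l..r})"
    using assms(1) unfolding Ck_on_def by blast
  then show thesis
    using that[of D] by (auto simp: at_within_Icc_at)
      (metis at_within_Icc_at atLeastAtMost_iff less_imp_le)
qed

section \<open>The discrete Laplace method\<close>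

lemma integrable_inverse_1_plus_square_UNIV: "integrable lborel (\<lambda>x::real. inverse (1 + x\<^sup>2))"
  using integrable_inverse_1_plus_square by (simp add: set_integrable_def einterval_def)

text \<open>Reduces every order m to the quadratic case, so that one Gaussian majorant serves all
  maximizers.\<close>

lemma square_minus_one_le_even_power:
  fixes y :: real
  assumes "1 \<le> m"
  shows "y\<^sup>2 - 1 \<le> y ^ (2 * m)"
proof (cases "\<bar>y\<bar> \<le> 1")
  case True
  then have "y\<^sup>2 \<le> 1" by (simp add: abs_square_le_1)
  moreover have "y ^ (2 * m) \<ge> 0" by (simp add: power_mult)
  ultimately show ?thesis by linarith
next
  case False
  then have "(y\<^sup>2) ^ 1 \<le> (y\<^sup>2) ^ m"
    using assms by (intro power_increasing) (auto simp: abs_square_le_1[symmetric] not_le less_imp_le)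
  then show ?thesis by (simp add: power_mult)
qed

text \<open>Both \<open>1 + \<bar>y\<bar>\<close> and half of \<open>1 + y * y\<close> are at most
  \<open>exp \<bar>y\<bar>\<close>, which raises the linear coefficient from D to D + 2. Completing
  the square gives the constant. The right-hand side is the integrable majorant used in every
  dominated convergence argument below.\<close>

lemma gaussian_tail_bound:
  fixes c D y :: real
  assumes "c > 0"
  shows "exp (- c * y\<^sup>2 + D * \<bar>y\<bar>) * (1 + \<bar>y\<bar>) \<le> 2 * exp ((D + 2)\<^sup>2 / (4 * c)) * inverse (1 + y\<^sup>2)"
proof -
  have 1: "1 + \<bar>y\<bar> \<le> exp \<bar>y\<bar>" using exp_ge_add_one_self[of "\<bar>y\<bar>"] by simp
  have 2: "1 + y\<^sup>2 \<le> 2 * exp \<bar>y\<bar>"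
    using exp_lower_Taylor_quadratic[of "\<bar>y\<bar>"] by simp
  have sq: "(D + 2)\<^sup>2 / (4 * c) - (- c * y\<^sup>2 + (D + 2) * \<bar>y\<bar>) = c * (\<bar>y\<bar> - (D + 2) / (2 * c))\<^sup>2"
    using assms by (simp add: power2_eq_square field_simps)
  have "0 \<le> c * (\<bar>y\<bar> - (D + 2) / (2 * c))\<^sup>2" using assms by simp
  with sq have 3: "- c * y\<^sup>2 + (D + 2) * \<bar>y\<bar> \<le> (D + 2)\<^sup>2 / (4 * c)" by linarith
  have "exp (- c * y\<^sup>2 + D * \<bar>y\<bar>) * (1 + \<bar>y\<bar>) * (1 + y\<^sup>2)
      \<le> exp (- c * y\<^sup>2 + D * \<bar>y\<bar>) * exp \<bar>y\<bar> * (2 * exp \<bar>y\<bar>)"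
    using 1 2 by (intro mult_mono) auto
  also have "\<dots> = 2 * exp (- c * y\<^sup>2 + (D + 2) * \<bar>y\<bar>)"
    by (simp add: exp_add[symmetric] algebra_simps)
  also have "\<dots> \<le> 2 * exp ((D + 2)\<^sup>2 / (4 * c))"
    using 3 by simp
  finally show ?thesis
    using sum_power2_gt_zero_iff[of 1 y] by (simp add: inverse_eq_divide pos_le_divide_eq)
qed

text \<open>
  On the scale \<open>n powr (- 1 / (2 M))\<close>, a maximizer of lower order \<open>m < M\<close> has vanishing mass.
\<close>
definition laplace_limit :: "nat \<Rightarrow> nat \<Rightarrow> real \<Rightarrow> real \<Rightarrow> real \<Rightarrow> real \<Rightarrow> real" where
  "laplace_limit M m c d t y = (if m = M then exp (c * y ^ (2 * m) + t * d * y) else 0)"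

text \<open>
  The sum is the integral of a step function of the rescaled variable \<open>y\<close>, to which dominated
  convergence applies.
\<close>
lemma local_laplace:
  fixes f B \<Psi> :: "real \<Rightarrow> real" and \<phi> :: "nat \<Rightarrow> nat \<Rightarrow> real" and \<phi>' :: "real \<Rightarrow> real"
    and M m :: nat and \<delta> a c d t K C Amax :: real
  defines "\<theta> \<equiv> 1 / (2 * real M)"
  assumes \<delta>: "0 < \<delta>" "2 * \<delta> \<le> a" "a \<le> 1 - 2 * \<delta>"
    and lip: "\<And>x. \<bar>x - a\<bar> < \<delta> \<Longrightarrow> \<bar>f x - f a\<bar> \<le> K * \<bar>x - a\<bar>"
    and deriv_f: "(f has_real_derivative d) (at a)"
    and m: "1 \<le> m" "m \<le> M"
    and \<Psi>: "isCont \<Psi> a" "\<Psi> a = c" "c < 0"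
      "\<And>x. \<bar>x - a\<bar> < \<delta> \<Longrightarrow> B x + entropy_fun x = Amax + \<Psi> x * (x - a) ^ (2 * m)"
      "\<And>x. \<bar>x - a\<bar> < \<delta> \<Longrightarrow> \<Psi> x \<le> c / 2"
    and C: "0 \<le> C"
    and \<phi>_bound: "\<And>n k. \<lbrakk>1 \<le> n; k \<le> n; \<bar>real k / real n - a\<bar> < \<delta>\<rbrakk> \<Longrightarrow>
        \<bar>\<phi> n k\<bar> \<le> C * (1 + real n powr \<theta> * \<bar>real k / real n - a\<bar>)"
    and \<phi>_lim: "AE y in lborel. \<forall>k :: nat \<Rightarrow> nat. (\<lambda>n. real n powr \<theta> * (real (k n) / real n - a)) \<longlonglongrightarrow> y
        \<longrightarrow> (\<lambda>n. \<phi> n (k n)) \<longlonglongrightarrow> \<phi>' y"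
    and \<phi>'_meas [measurable]: "\<phi>' \<in> borel_measurable borel"
  shows "(\<lambda>n. \<Sum>k | k \<le> n \<and> \<bar>real k / real n - a\<bar> < \<delta>.
            real n powr (\<theta> - 1/2) * real (n choose k) * exp (real n * (B (real k / real n) - Amax))
             * exp (t * real n powr \<theta> * (f (real k / real n) - f a)) * \<phi> n k)
     \<longlonglongrightarrow> stirling_const / sqrt (a * (1 - a)) * (\<integral>y. laplace_limit M m c d t y * \<phi>' y \<partial>lborel)" (is "?S \<longlonglongrightarrow> ?R")
    and "integrable lborel (\<lambda>y. laplace_limit M m c d t y * \<phi>' y)" (is "?int")
proof -
  define S where "S n = {k. k \<le> n \<and> \<bar>real k / real n - a\<bar> < \<delta>}" for n :: nat
  define s where "s n = real n powr (1 - \<theta>)" for n :: nat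
  define T where "T n k = real n powr (\<theta> - 1/2) * real (n choose k) * exp (real n * (B (real k / real n) - Amax))
             * exp (t * real n powr \<theta> * (f (real k / real n) - f a)) * \<phi> n k" for n k :: nat
  \<comment> \<open>Raising k by one moves the rescaled variable by \<open>1 / s n\<close>. The cell
    of k has this width, so the height \<open>s n * T n k\<close> makes its integral equal to
    \<open>T n k\<close>.\<close>
  define H where "H n k = s n * T n k" for n k
  define G where "G n y = (\<Sum>k\<in>S n. H n k * indicator {(real k - real n * a) / s n ..< (real k + 1 - real n * a) / s n} y)" for n y
  have \<theta>: "0 < \<theta>" "\<theta> \<le> 1/2" "2 * real m * \<theta> \<le> 1"
    using m by (auto simp: \<theta>_def field_simps)
  have a: "0 < a" "a < 1" using \<delta> by auto
  have fin: "finite (S n)" for n by (auto simp: S_def)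
  have s_pos: "s n > 0" if "n \<ge> 1" for n using that by (simp add: s_def)
  have s_ge1: "s n \<ge> 1" if "n \<ge> 1" for n
    using that \<theta> ge_one_powr_ge_zero[of "real n" "1 - \<theta>"] by (simp add: s_def)
  have s_eq: "real n powr \<theta> * s n = real n" if "n \<ge> 1" for n
    using that by (simp add: s_def flip: powr_add)
  \<comment> \<open>The half-open cells partition the line, and the cell containing y is found by a
    floor; at most one summand of \<open>G n y\<close> is nonzero.\<close>
  have ind: "y \<in> {(real k - real n * a) / s n ..< (real k + 1 - real n * a) / s n}
      \<longleftrightarrow> int k = \<lfloor>real n * a + s n * y\<rfloor>" if "n \<ge> 1" for n k y
    using s_pos[OF that] by (auto simp: field_simps floor_eq_iff eq_commute[of "int k"])
  have z_eq: "real n powr \<theta> * (real k / real n - a) = (real k - real n * a) / s n" if "n \<ge> 1" for n k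
    using that s_eq[OF that] s_pos[OF that] by (simp add: field_simps)
  have z_close: "\<bar>real n powr \<theta> * (real k / real n - a) - y\<bar> \<le> 1 / s n"
    if "n \<ge> 1" "int k = \<lfloor>real n * a + s n * y\<rfloor>" for n k y
  proof -
    have "(real k + 1 - real n * a) / s n = (real k - real n * a) / s n + 1 / s n"
      by (simp add: add_divide_distrib diff_divide_distrib)
    then show ?thesis
      using ind[of n y k, THEN iffD2, OF that] s_pos[OF that(1)] unfolding z_eq[OF that(1)]
      by (simp add: abs_le_iff)
  qed
  have G_eq: "G n y = (if \<exists>k\<in>S n. int k = \<lfloor>real n * a + s n * y\<rfloor> then H n (nat \<lfloor>real n * a + s n * y\<rfloor>) else 0)"
    if "n \<ge> 1" for n y
  proof (cases "\<exists>k\<in>S n. int k = \<lfloor>real n * a + s n * y\<rfloor>")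
    case True
    then obtain k where k: "k \<in> S n" "int k = \<lfloor>real n * a + s n * y\<rfloor>" by blast
    have "G n y = (\<Sum>i\<in>S n. if i = k then H n i else 0)"
      unfolding G_def using ind[OF that] k by (intro sum.cong refl) (auto simp: indicator_def)
    then show ?thesis using k fin True by (simp add: k(2)[symmetric])
  next
    case False
    then show ?thesis
      unfolding G_def using ind[OF that] by (auto intro!: sum.neutral simp: indicator_def)
  qed
  have G_meas [measurable]: "G n \<in> borel_measurable lborel" for n
    unfolding G_def by measurable
  have G_int: "integral\<^sup>L lborel (G n) = (\<Sum>k\<in>S n. T n k)" if "n \<ge> 1" for n
  proof -
    have "((real k + 1 - real n * a) / s n - (real k - real n * a) / s n) = 1 / s n" for k
      by (simp add: diff_divide_distrib add_divide_distrib)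
    moreover have "(real k - real n * a) / s n \<le> (real k + 1 - real n * a) / s n" for k
      using s_pos[OF that] by (simp add: divide_right_mono)
    ultimately show ?thesis
      unfolding G_def using s_pos[OF that]
      by (subst Bochner_Integration.integral_sum) (auto simp: H_def)
  qed
  have H_eq: "H n k = (sqrt (real n) * real (n choose k) * exp (- (real n * entropy_fun (real k / real n))))
      * exp (real n * (\<Psi> (real k / real n) * (real k / real n - a) ^ (2 * m)))
      * exp (t * real n powr \<theta> * (f (real k / real n) - f a)) * \<phi> n k"
    if "n \<ge> 1" "k \<in> S n" for n k
  proof -
    define x where "x = real k / real n"
    have s: "s n * real n powr (\<theta> - 1/2) = sqrt (real n)"
      using that by (simp add: s_def powr_half_sqrt flip: powr_add)
    have BA: "B x - Amax = - entropy_fun x + \<Psi> x * (x - a) ^ (2 * m)"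
      using \<Psi>(4)[of x] that by (simp add: S_def x_def)
    have "exp (real n * (B x - Amax)) = exp (- (real n * entropy_fun x)) * exp (real n * (\<Psi> x * (x - a) ^ (2 * m)))"
      unfolding BA by (simp add: algebra_simps flip: exp_add)
    with s show ?thesis
      unfolding H_def T_def x_def[symmetric] by (simp add: mult.assoc[symmetric])
  qed
  \<comment> \<open>The exponent \<open>1 - 2 * real m * \<theta>\<close> is nonnegative and
    vanishes exactly for m = M. This is what separates the surviving maximizers from those whose
    mass vanishes.\<close>
  have pow_eq: "real n * (x - a) ^ (2 * m) = real n powr (1 - 2 * real m * \<theta>) * (real n powr \<theta> * (x - a)) ^ (2 * m)"
    if "n \<ge> 1" for n x
  proof -
    have "(real n powr \<theta>) ^ (2 * m) = real n powr (2 * real m * \<theta>)"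
      using that by (simp add: powr_powr mult.commute flip: powr_realpow)
    then show ?thesis
      using that by (simp add: power_mult_distrib mult.assoc[symmetric] flip: powr_add)
  qed
  obtain C0 where C0: "C0 > 0" "\<And>n k. \<lbrakk>n \<ge> 1; k \<le> n; \<delta> \<le> real k / real n; real k / real n \<le> 1 - \<delta>\<rbrakk> \<Longrightarrow>
       sqrt (real n) * real (n choose k) \<le> C0 * exp (real n * entropy_fun (real k / real n))"
    using binomial_entropy_bound[OF \<delta>(1)] by blast
  have K: "K \<ge> 0"
  proof -
    have "0 \<le> \<bar>f (a + \<delta> / 2) - f a\<bar>" by simp
    also have "\<dots> \<le> K * (\<delta> / 2)" using lip[of "a + \<delta> / 2"] \<delta>(1) by simp
    finally show ?thesis using \<delta>(1) by (simp add: zero_le_mult_iff)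
  qed
  define D where "D = \<bar>t\<bar> * K"
  \<comment> \<open>The product of the bounds on the factors of \<open>H\<close>: \<open>C0\<close>
    for the binomial part, \<open>2 * C\<close> from \<phi>, \<open>exp (- c + D)\<close> from
    constant terms in the exponents, and the Gaussian majorant. Its coefficient is
    \<open>- c / 4\<close> because \<Psi> is only bounded by \<open>c / 2\<close> and passing from
    the grid point to y halves the square once more.\<close>
  define E where "E = C0 * C * 2 * exp (- c + D) * (2 * exp ((D + 2)\<^sup>2 / (4 * (- c / 4))))"
  have H_bound: "\<bar>H n k\<bar> \<le> E * inverse (1 + y\<^sup>2)"
    if n: "n \<ge> 1" and k: "k \<in> S n" "int k = \<lfloor>real n * a + s n * y\<rfloor>" for n k y
  proof -
    define x where "x = real k / real n"
    define z where "z = real n powr \<theta> * (x - a)"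
    have x: "\<bar>x - a\<bar> < \<delta>" and kn: "k \<le> n" using k by (auto simp: S_def x_def)
    have "1 / s n \<le> 1" using s_ge1[OF n] by simp
    \<comment> \<open>The grid point z and y share a cell of width at most one, so a square in z can
      be replaced by half the square in y minus a constant.\<close>
    then have zy: "\<bar>z - y\<bar> \<le> 1" using z_close[OF n k(2)] by (simp add: z_def x_def)
    then have z1: "\<bar>z\<bar> \<le> 1 + \<bar>y\<bar>" by linarith
    have "y\<^sup>2 = (z + (y - z))\<^sup>2" by simp
    also have "\<dots> \<le> 2 * z\<^sup>2 + 2 * (y - z)\<^sup>2"
      using zero_le_power2[of "z - (y - z)"] by (simp add: power2_eq_square algebra_simps)
    also have "(y - z)\<^sup>2 \<le> 1" using zy by (simp add: abs_square_le_1 abs_minus_commute)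
    finally have y2: "y\<^sup>2 / 2 - 1 \<le> z\<^sup>2" by simp
    have "z\<^sup>2 - 1 \<le> z ^ (2 * m)"
      by (rule square_minus_one_le_even_power[OF m(1)])
    also have "z ^ (2 * m) \<le> real n * (x - a) ^ (2 * m)"
    proof -
      have "1 \<le> real n powr (1 - 2 * real m * \<theta>)"
        using n \<theta>(3) by (intro ge_one_powr_ge_zero) auto
      moreover have "z ^ (2 * m) \<ge> 0" by (simp add: power_mult)
      ultimately show ?thesis
        unfolding pow_eq[OF n] z_def[symmetric] by (simp add: mult_le_cancel_right1)
    qed
    finally have zz: "y\<^sup>2 / 2 - 2 \<le> real n * (x - a) ^ (2 * m)" using y2 by linarith
    have "real n * (\<Psi> x * (x - a) ^ (2 * m)) = \<Psi> x * (real n * (x - a) ^ (2 * m))" by simp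
    also have "\<dots> \<le> c / 2 * (real n * (x - a) ^ (2 * m))"
      by (intro mult_right_mono \<Psi>(5) x) (simp add: power_mult)
    also have "\<dots> \<le> c / 2 * (y\<^sup>2 / 2 - 2)"
      using zz \<Psi>(3) by (intro mult_left_mono_neg) auto
    finally have e1: "exp (real n * (\<Psi> x * (x - a) ^ (2 * m))) \<le> exp (c / 4 * y\<^sup>2 - c)"
      by (simp add: algebra_simps)
    have "t * real n powr \<theta> * (f x - f a) \<le> \<bar>t\<bar> * real n powr \<theta> * \<bar>f x - f a\<bar>"
      by (metis abs_ge_self abs_mult abs_of_nonneg powr_ge_zero)
    also have "\<dots> \<le> \<bar>t\<bar> * real n powr \<theta> * (K * \<bar>x - a\<bar>)"
      by (intro mult_left_mono lip x) auto
    also have "\<dots> = D * \<bar>z\<bar>"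
      by (simp add: D_def z_def abs_mult)
    also have "\<dots> \<le> D * (1 + \<bar>y\<bar>)"
      using z1 K by (intro mult_left_mono) (auto simp: D_def)
    finally have e2: "exp (t * real n powr \<theta> * (f x - f a)) \<le> exp (D + D * \<bar>y\<bar>)"
      by (simp add: algebra_simps)
    have e3: "\<bar>\<phi> n k\<bar> \<le> C * (2 * (1 + \<bar>y\<bar>))"
    proof -
      have "\<bar>\<phi> n k\<bar> \<le> C * (1 + \<bar>z\<bar>)"
        using \<phi>_bound[OF n kn] x by (simp add: z_def x_def abs_mult)
      also have "\<dots> \<le> C * (2 * (1 + \<bar>y\<bar>))"
        using z1 C by (intro mult_left_mono) auto
      finally show ?thesis .
    qed
    have "sqrt (real n) * real (n choose k) \<le> C0 * exp (real n * entropy_fun x)"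
      unfolding x_def using x \<delta> by (intro C0 n kn) (auto simp: x_def)
    then have e0: "sqrt (real n) * real (n choose k) * exp (- (real n * entropy_fun x)) \<le> C0"
      by (simp add: exp_minus field_simps)
    have "\<bar>H n k\<bar> = (sqrt (real n) * real (n choose k) * exp (- (real n * entropy_fun x)))
      * exp (real n * (\<Psi> x * (x - a) ^ (2 * m))) * exp (t * real n powr \<theta> * (f x - f a)) * \<bar>\<phi> n k\<bar>"
      unfolding H_eq[OF n k(1)] x_def[symmetric] by (simp add: abs_mult)
    also have "\<dots> \<le> C0 * exp (c / 4 * y\<^sup>2 - c) * exp (D + D * \<bar>y\<bar>) * (C * (2 * (1 + \<bar>y\<bar>)))"
      using C0(1) C by (intro mult_mono e0 e1 e2 e3) auto
    also have "\<dots> = C0 * C * 2 * exp (- c + D) * (exp (- (- c / 4) * y\<^sup>2 + D * \<bar>y\<bar>) * (1 + \<bar>y\<bar>))"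
    proof -
      have "exp (c / 4 * y\<^sup>2 - c) * exp (D + D * \<bar>y\<bar>) = exp (- c + D) * exp (- (- c / 4) * y\<^sup>2 + D * \<bar>y\<bar>)"
        by (simp flip: exp_add)
      then show ?thesis
        by (metis (no_types, opaque_lifting) mult.assoc mult.commute mult.left_commute)
    qed
    also have "\<dots> \<le> C0 * C * 2 * exp (- c + D) * (2 * exp ((D + 2)\<^sup>2 / (4 * (- c / 4))) * inverse (1 + y\<^sup>2))"
      using C0(1) C \<Psi>(3) by (intro mult_left_mono gaussian_tail_bound) auto
    finally show ?thesis unfolding E_def by (simp only: mult.assoc)
  qed
  have E: "E \<ge> 0" using C0(1) C by (simp add: E_def)
  have G_bound: "\<bar>G n y\<bar> \<le> E * inverse (1 + y\<^sup>2)" if "n \<ge> 1" for n y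
    unfolding G_eq[OF that] using H_bound[OF that] E by auto (metis nat_int)
  define L where "L y = stirling_const / sqrt (a * (1 - a)) * (laplace_limit M m c d t y * \<phi>' y)" for y
  have L_meas [measurable]: "L \<in> borel_measurable lborel"
    unfolding L_def laplace_limit_def by measurable
  have s_lim: "(\<lambda>n. 1 / s n) \<longlonglongrightarrow> 0"
  proof -
    have "1 - \<theta> > 0" using \<theta> by simp
    then show ?thesis unfolding s_def by real_asymp
  qed
  \<comment> \<open>In Caratheodory's form of the derivative the rescaled increment of f is exactly
    \<open>Q x\<close> times the rescaled variable, so no remainder term has to be
    estimated.\<close>
  obtain Q where Q: "\<And>x. f x - f a = Q x * (x - a)" "isCont Q a" "Q a = d"
    using deriv_f unfolding CARAT_DERIV by blast
  \<comment> \<open>The null point y = 0 is excluded: for m < M the exponent is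
    \<open>c * y ^ (2 * m)\<close> times a diverging factor, asymptotically, and it tends to minus
    infinity only if y is nonzero.\<close>
  have G_lim: "AE y in lborel. (\<lambda>n. G n y) \<longlonglongrightarrow> L y"
    using \<phi>_lim AE_lborel_singleton[of 0]
  proof eventually_elim
    case (elim y)
    define k where "k n = nat \<lfloor>real n * a + s n * y\<rfloor>" for n
    define x where "x n = real (k n) / real n" for n
    define z where "z n = real n powr \<theta> * (x n - a)" for n
    have "filterlim (\<lambda>n. real n * a + s n * y) at_top sequentially"
      unfolding s_def using a \<theta> by (cases "y = 0"; real_asymp)
    then have "\<forall>\<^sub>F n in sequentially. real n * a + s n * y \<ge> 0"
      by (simp add: filterlim_at_top)
    then have evk: "\<forall>\<^sub>F n in sequentially. int (k n) = \<lfloor>real n * a + s n * y\<rfloor>"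
      by eventually_elim (simp add: k_def)
    have "(\<lambda>n. z n - y) \<longlonglongrightarrow> 0"
    proof (rule Lim_null_comparison[OF _ s_lim])
      show "\<forall>\<^sub>F n in sequentially. norm (z n - y) \<le> 1 / s n"
        using evk eventually_ge_at_top[of 1]
        by eventually_elim (simp add: z_def x_def z_close)
    qed
    then have z: "z \<longlonglongrightarrow> y" by (simp add: LIM_zero_iff)
    have "(\<lambda>n. z n * (1 / real n powr \<theta>)) \<longlonglongrightarrow> y * 0"
    proof (intro tendsto_mult z)
      show "(\<lambda>n. 1 / real n powr \<theta>) \<longlonglongrightarrow> 0" using \<theta> by real_asymp
    qed
    then have "(\<lambda>n. z n * (1 / real n powr \<theta>)) \<longlonglongrightarrow> 0"
      by simp
    moreover have "\<forall>\<^sub>F n in sequentially. z n * (1 / real n powr \<theta>) = x n - a"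
      by (rule eventually_sequentiallyI[of 1]) (simp add: z_def)
    ultimately have "(\<lambda>n. x n - a) \<longlonglongrightarrow> 0"
      by (rule Lim_transform_eventually)
    then have x: "x \<longlonglongrightarrow> a" by (simp add: LIM_zero_iff)
    have evS: "\<forall>\<^sub>F n in sequentially. k n \<in> S n"
    proof -
      have "\<forall>\<^sub>F n in sequentially. x n < a + \<delta>" "\<forall>\<^sub>F n in sequentially. x n > a - \<delta>"
        using order_tendstoD[OF x] \<delta> by auto
      then show ?thesis
        using eventually_ge_at_top[of 1]
      proof eventually_elim
        case (elim n)
        have "x n < 1" using elim(1) \<delta> by linarith
        then have "k n \<le> n" using elim(3) by (simp add: x_def field_simps)
        then show "k n \<in> S n" using elim by (auto simp: S_def x_def)
      qed
    qed
    have \<phi>: "(\<lambda>n. \<phi> n (k n)) \<longlonglongrightarrow> \<phi>' y"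
      using elim(1) z by (auto simp: z_def[abs_def] x_def[abs_def])
    have l1: "(\<lambda>n. sqrt (real n) * real (n choose k n) * exp (- (real n * entropy_fun (x n))))
        \<longlonglongrightarrow> stirling_const / sqrt (a * (1 - a))"
      unfolding x_def by (rule binomial_entropy_tendsto) (use x a in \<open>auto simp: x_def[abs_def]\<close>)
    have Qx: "(\<lambda>n. Q (x n)) \<longlonglongrightarrow> d" and \<Psi>x: "(\<lambda>n. \<Psi> (x n)) \<longlonglongrightarrow> c"
      using isCont_tendsto_compose[OF Q(2) x] isCont_tendsto_compose[OF \<Psi>(1) x] Q(3) \<Psi>(2) by auto
    have "(\<lambda>n. exp (t * (Q (x n) * z n))) \<longlonglongrightarrow> exp (t * (d * y))"
      by (intro tendsto_intros Qx z)
    then have l3: "(\<lambda>n. exp (t * real n powr \<theta> * (f (x n) - f a))) \<longlonglongrightarrow> exp (t * d * y)"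
      by (simp add: Q(1) z_def mult_ac)
    have l2: "(\<lambda>n. exp (real n * (\<Psi> (x n) * (x n - a) ^ (2 * m))) * exp (t * real n powr \<theta> * (f (x n) - f a)))
      \<longlonglongrightarrow> laplace_limit M m c d t y"
    proof (cases "m = M")
      case True
      have "real n * (\<Psi> (x n) * (x n - a) ^ (2 * m)) = \<Psi> (x n) * z n ^ (2 * m)" if "n \<ge> 1" for n
      proof -
        have "1 - 2 * real m * \<theta> = 0" using True m by (simp add: \<theta>_def)
        then have "real n * (x n - a) ^ (2 * m) = z n ^ (2 * m)"
          using pow_eq[OF that, of "x n"] that by (simp add: z_def)
        then show ?thesis by simp
      qed
      then have "\<forall>\<^sub>F n in sequentially. exp (\<Psi> (x n) * z n ^ (2 * m)) = exp (real n * (\<Psi> (x n) * (x n - a) ^ (2 * m)))"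
        by (intro eventually_sequentiallyI[of 1]) (simp only:)
      moreover have "(\<lambda>n. exp (\<Psi> (x n) * z n ^ (2 * m))) \<longlonglongrightarrow> exp (c * y ^ (2 * m))"
        by (intro tendsto_intros \<Psi>x z)
      ultimately have "(\<lambda>n. exp (real n * (\<Psi> (x n) * (x n - a) ^ (2 * m)))) \<longlonglongrightarrow> exp (c * y ^ (2 * m))"
        by (rule Lim_transform_eventually[rotated])
      from tendsto_mult[OF this l3] show ?thesis
        using True by (simp add: laplace_limit_def exp_add)
    next
      case False
      have "1 - 2 * real m * \<theta> > 0" using False m by (simp add: \<theta>_def field_simps)
      then have *: "filterlim (\<lambda>n. real n powr (1 - 2 * real m * \<theta>)) at_top sequentially"
        by real_asymp
      have "(\<lambda>n. \<Psi> (x n) * z n ^ (2 * m)) \<longlonglongrightarrow> c * y ^ (2 * m)"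
        by (intro tendsto_intros \<Psi>x z)
      moreover have "c * y ^ (2 * m) < 0"
        using \<Psi>(3) elim(2) by (simp add: mult_less_0_iff power_mult)
      ultimately have "filterlim (\<lambda>n. (\<Psi> (x n) * z n ^ (2 * m)) * real n powr (1 - 2 * real m * \<theta>)) at_bot sequentially"
        using * by (rule filterlim_tendsto_neg_mult_at_bot)
      moreover have "\<forall>\<^sub>F n in sequentially. (\<Psi> (x n) * z n ^ (2 * m)) * real n powr (1 - 2 * real m * \<theta>)
            = real n * (\<Psi> (x n) * (x n - a) ^ (2 * m))"
        using pow_eq by (intro eventually_sequentiallyI[of 1]) (simp add: z_def)
      ultimately have "filterlim (\<lambda>n. real n * (\<Psi> (x n) * (x n - a) ^ (2 * m))) at_bot sequentially"
        by (simp add: filterlim_cong[OF refl refl])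
      then have "(\<lambda>n. exp (real n * (\<Psi> (x n) * (x n - a) ^ (2 * m)))) \<longlonglongrightarrow> 0"
        by (rule filterlim_compose[OF exp_at_bot])
      from tendsto_mult[OF this l3] show ?thesis
        using False by (simp add: laplace_limit_def)
    qed
    have "(\<lambda>n. (sqrt (real n) * real (n choose k n) * exp (- (real n * entropy_fun (x n))))
      * (exp (real n * (\<Psi> (x n) * (x n - a) ^ (2 * m))) * exp (t * real n powr \<theta> * (f (x n) - f a))) * \<phi> n (k n))
      \<longlonglongrightarrow> stirling_const / sqrt (a * (1 - a)) * laplace_limit M m c d t y * \<phi>' y"
      by (intro tendsto_mult l1 l2 \<phi>)
    then have "(\<lambda>n. (sqrt (real n) * real (n choose k n) * exp (- (real n * entropy_fun (x n))))
      * (exp (real n * (\<Psi> (x n) * (x n - a) ^ (2 * m))) * exp (t * real n powr \<theta> * (f (x n) - f a))) * \<phi> n (k n))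
      \<longlonglongrightarrow> L y" by (simp add: L_def mult.assoc)
    then show ?case
    proof (rule Lim_transform_eventually)
      show "\<forall>\<^sub>F n in sequentially. (sqrt (real n) * real (n choose k n) * exp (- (real n * entropy_fun (x n))))
      * (exp (real n * (\<Psi> (x n) * (x n - a) ^ (2 * m))) * exp (t * real n powr \<theta> * (f (x n) - f a))) * \<phi> n (k n)
        = G n y"
        using evS evk eventually_ge_at_top[of 1]
      proof eventually_elim
        case (elim n)
        then have "G n y = H n (k n)"
          unfolding G_eq[OF elim(3)] k_def by auto
        also have "\<dots> = (sqrt (real n) * real (n choose k n) * exp (- (real n * entropy_fun (x n))))
          * (exp (real n * (\<Psi> (x n) * (x n - a) ^ (2 * m))) * exp (t * real n powr \<theta> * (f (x n) - f a))) * \<phi> n (k n)"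
          using H_eq[OF elim(3,1)] by (simp add: x_def mult.assoc)
        finally show ?case by simp
      qed
    qed
  qed
  let ?w = "\<lambda>y::real. E * inverse (1 + y\<^sup>2)"
  have w: "integrable lborel ?w"
    by (intro integrable_mult_right integrable_inverse_1_plus_square_UNIV)
  \<comment> \<open>The bounds require n \<ge> 1, so dominated convergence is applied to the shifted
    sequence.\<close>
  have bnd: "\<And>n. AE y in lborel. norm (G (Suc n) y) \<le> ?w y"
    using G_bound by auto
  have lim': "AE y in lborel. (\<lambda>n. G (Suc n) y) \<longlonglongrightarrow> L y"
    using G_lim by eventually_elim (rule LIMSEQ_Suc)
  have "(\<lambda>n. integral\<^sup>L lborel (G (Suc n))) \<longlonglongrightarrow> integral\<^sup>L lborel L"
    by (rule integral_dominated_convergence[OF _ _ w lim' bnd]) simp_all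
  then have "(\<lambda>n. \<Sum>k\<in>S (Suc n). T (Suc n) k) \<longlonglongrightarrow> integral\<^sup>L lborel L"
    using G_int by simp
  then have "(\<lambda>n. \<Sum>k\<in>S n. T n k) \<longlonglongrightarrow> integral\<^sup>L lborel L"
    by (rule LIMSEQ_imp_Suc)
  then show "?S \<longlonglongrightarrow> ?R"
    by (simp add: S_def T_def L_def[abs_def])
  define r where "r = stirling_const / sqrt (a * (1 - a))"
  have "integrable lborel L"
    by (rule integrable_dominated_convergence[OF _ _ w lim' bnd]) simp_all
  then have "integrable lborel (\<lambda>y. 1 / r * (r * (laplace_limit M m c d t y * \<phi>' y)))"
    unfolding L_def[abs_def] r_def by (rule integrable_mult_right)
  moreover have "r \<noteq> 0"
    using stirling_const_pos a by (auto simp: r_def)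
  ultimately show ?int
    by (simp del: mult.assoc add: mult.assoc[symmetric])
qed

section \<open>Laplace asymptotics with several maximizers\<close>

locale laplace_model =
  fixes f B :: "real \<Rightarrow> real" and J :: "'j set" and a :: "'j \<Rightarrow> real" and m :: "'j \<Rightarrow> nat" and M :: nat
    and df c :: "'j \<Rightarrow> real" and \<Psi> :: "'j \<Rightarrow> real \<Rightarrow> real" and Amax K :: real
  assumes finite_J: "finite J"
    and a_inj: "inj_on a J"
    and a_interior: "j \<in> J \<Longrightarrow> 0 < a j" "j \<in> J \<Longrightarrow> a j < 1"
    and m_bounds: "j \<in> J \<Longrightarrow> 1 \<le> m j" "j \<in> J \<Longrightarrow> m j \<le> M"
    and f_lipschitz: "x \<in> {0..1} \<Longrightarrow> y \<in> {0..1} \<Longrightarrow> \<bar>f x - f y\<bar> \<le> K * \<bar>x - y\<bar>"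
    and f_deriv: "j \<in> J \<Longrightarrow> (f has_real_derivative df j) (at (a j))"
    and B_continuous: "continuous_on {0..1} B"
    and \<Psi>_isCont: "j \<in> J \<Longrightarrow> isCont (\<Psi> j) (a j)"
    and \<Psi>_at: "j \<in> J \<Longrightarrow> \<Psi> j (a j) = c j"
    and c_neg: "j \<in> J \<Longrightarrow> c j < 0"
    and \<Psi>_expansion: "j \<in> J \<Longrightarrow> B x + entropy_fun x = Amax + \<Psi> j x * (x - a j) ^ (2 * m j)"
    and strict_max: "x \<in> {0..1} \<Longrightarrow> x \<notin> a ` J \<Longrightarrow> B x + entropy_fun x < Amax"
    and J_nonempty: "J \<noteq> {}"
begin

definition \<theta> :: real where "\<theta> = 1 / (2 * real M)"

text \<open>The normalization that gives a finite limit: the binomial coefficient contributes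
  \<open>n powr (- 1/2)\<close>, and the window around a dominating maximizer has about
  \<open>n powr (1 - \<theta>)\<close> relevant grid points.\<close>

definition V :: "nat \<Rightarrow> nat \<Rightarrow> real" where
  "V n k = real n powr (\<theta> - 1/2) * real (n choose k) * exp (real n * (B (real k / real n) - Amax))"

text \<open>Up to the common factor \<open>stirling_const\<close> this is
  \<open>exp (\<nu> j)\<close> in the theorem.\<close>

definition wt :: "'j \<Rightarrow> real" where "wt j = stirling_const / sqrt (a j * (1 - a j))"

abbreviation L :: "'j \<Rightarrow> real \<Rightarrow> real \<Rightarrow> real" where
  "L j \<equiv> laplace_limit M (m j) (c j) (df j)"

lemma M_pos: "M \<ge> 1"
proof -
  obtain j where "j \<in> J" using J_nonempty by blast
  with m_bounds[of j] show ?thesis by simp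
qed

lemma \<theta>_bounds: "0 < \<theta>" "\<theta> \<le> 1/2"
  using M_pos by (auto simp: \<theta>_def field_simps)

lemma K_nonneg: "K \<ge> 0"
  using f_lipschitz[of 0 1] by auto

lemma V_nonneg: "V n k \<ge> 0"
  by (simp add: V_def)

lemma good_radius:
  obtains \<delta> where "\<delta> > 0" "\<And>j. j \<in> J \<Longrightarrow> 2 * \<delta> \<le> a j" "\<And>j. j \<in> J \<Longrightarrow> a j \<le> 1 - 2 * \<delta>"
    "\<And>i j. i \<in> J \<Longrightarrow> j \<in> J \<Longrightarrow> i \<noteq> j \<Longrightarrow> 2 * \<delta> \<le> \<bar>a i - a j\<bar>"
    "\<And>j x. j \<in> J \<Longrightarrow> \<bar>x - a j\<bar> < \<delta> \<Longrightarrow> \<Psi> j x \<le> c j / 2"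
proof -
  have small: "\<forall>\<^sub>F \<delta> in at_right (0::real). \<delta> \<le> r" if "r > 0" for r
    using that eventually_at_right_real[OF that] by (auto elim!: eventually_mono)
  have "\<forall>\<^sub>F \<delta> in at_right (0::real). \<forall>j\<in>J. 2 * \<delta> \<le> a j"
  proof (intro eventually_ball_finite finite_J ballI)
    fix j assume "j \<in> J"
    then show "\<forall>\<^sub>F \<delta> in at_right (0::real). 2 * \<delta> \<le> a j"
      using small[of "a j / 2"] a_interior[of j] by (auto elim!: eventually_mono simp: field_simps)
  qed
  moreover have "\<forall>\<^sub>F \<delta> in at_right (0::real). \<forall>j\<in>J. a j \<le> 1 - 2 * \<delta>"
  proof (intro eventually_ball_finite finite_J ballI)
    fix j assume "j \<in> J"
    then show "\<forall>\<^sub>F \<delta> in at_right (0::real). a j \<le> 1 - 2 * \<delta>"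
      using small[of "(1 - a j) / 2"] a_interior[of j] by (auto elim!: eventually_mono simp: field_simps)
  qed
  moreover have "\<forall>\<^sub>F \<delta> in at_right (0::real). \<forall>i\<in>J. \<forall>j\<in>J. i \<noteq> j \<longrightarrow> 2 * \<delta> \<le> \<bar>a i - a j\<bar>"
  proof (intro eventually_ball_finite finite_J ballI)
    fix i j assume "i \<in> J" "j \<in> J"
    then have "i \<noteq> j \<Longrightarrow> \<bar>a i - a j\<bar> / 2 > 0" using a_inj by (auto simp: inj_on_def)
    then show "\<forall>\<^sub>F \<delta> in at_right (0::real). i \<noteq> j \<longrightarrow> 2 * \<delta> \<le> \<bar>a i - a j\<bar>"
      using small[of "\<bar>a i - a j\<bar> / 2"] by (cases "i = j") (auto elim!: eventually_mono)
  qed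
  moreover have "\<forall>\<^sub>F \<delta> in at_right (0::real). \<forall>j\<in>J. \<forall>x. \<bar>x - a j\<bar> < \<delta> \<longrightarrow> \<Psi> j x \<le> c j / 2"
  proof (intro eventually_ball_finite finite_J ballI)
    fix j assume j: "j \<in> J"
    have "- c j / 2 > 0" using c_neg[OF j] by simp
    with \<Psi>_isCont[OF j] obtain d where d: "d > 0" "\<And>x. \<bar>x - a j\<bar> < d \<Longrightarrow> \<bar>\<Psi> j x - \<Psi> j (a j)\<bar> < - c j / 2"
      unfolding continuous_at_eps_delta dist_real_def by blast
    have "\<Psi> j x \<le> c j / 2" if "\<bar>x - a j\<bar> < d" for x
      using d(2)[OF that] unfolding \<Psi>_at[OF j] by linarith
    then show "\<forall>\<^sub>F \<delta> in at_right (0::real). \<forall>x. \<bar>x - a j\<bar> < \<delta> \<longrightarrow> \<Psi> j x \<le> c j / 2"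
      using small[OF d(1)] by (auto elim!: eventually_mono)
  qed
  moreover have "\<forall>\<^sub>F \<delta> in at_right (0::real). 0 < \<delta>"
    by (rule eventually_at_right_less)
  ultimately have "\<forall>\<^sub>F \<delta> in at_right (0::real). 0 < \<delta> \<and> (\<forall>j\<in>J. 2 * \<delta> \<le> a j) \<and> (\<forall>j\<in>J. a j \<le> 1 - 2 * \<delta>)
    \<and> (\<forall>i\<in>J. \<forall>j\<in>J. i \<noteq> j \<longrightarrow> 2 * \<delta> \<le> \<bar>a i - a j\<bar>) \<and> (\<forall>j\<in>J. \<forall>x. \<bar>x - a j\<bar> < \<delta> \<longrightarrow> \<Psi> j x \<le> c j / 2)"
    by eventually_elim blast
  from eventually_happens'[OF trivial_limit_at_right_real this]
  obtain \<delta> where "0 < \<delta> \<and> (\<forall>j\<in>J. 2 * \<delta> \<le> a j) \<and> (\<forall>j\<in>J. a j \<le> 1 - 2 * \<delta>)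
    \<and> (\<forall>i\<in>J. \<forall>j\<in>J. i \<noteq> j \<longrightarrow> 2 * \<delta> \<le> \<bar>a i - a j\<bar>) \<and> (\<forall>j\<in>J. \<forall>x. \<bar>x - a j\<bar> < \<delta> \<longrightarrow> \<Psi> j x \<le> c j / 2)"
    by (elim exE)
  then show thesis by (intro that[of \<delta>]) auto
qed

text \<open>Outside the open balls around the maximizers a compact set remains, on which the
  continuous function \<open>B + entropy_fun\<close> attains a maximum below
  \<open>Amax\<close>.\<close>

lemma gap_away_from_maximizers:
  assumes "\<delta> > 0"
  obtains \<epsilon> where "\<epsilon> > 0"
    "\<And>x. x \<in> {0..1} \<Longrightarrow> (\<And>j. j \<in> J \<Longrightarrow> \<delta> \<le> \<bar>x - a j\<bar>) \<Longrightarrow> B x + entropy_fun x \<le> Amax - \<epsilon>"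
proof -
  define R where "R = {0..1} - (\<Union>j\<in>J. ball (a j) \<delta>)"
  have R: "x \<in> R" if "x \<in> {0..1}" "\<And>j. j \<in> J \<Longrightarrow> \<delta> \<le> \<bar>x - a j\<bar>" for x
    using that by (auto simp: R_def dist_real_def abs_minus_commute simp flip: not_less)
  have "compact R" unfolding R_def by (intro compact_diff open_UN) auto
  show thesis
  proof (cases "R = {}")
    case True
    show ?thesis
    proof (rule that[of 1])
      fix x assume "x \<in> {0..1::real}" "\<And>j. j \<in> J \<Longrightarrow> \<delta> \<le> \<bar>x - a j\<bar>"
      from R[OF this] True show "B x + entropy_fun x \<le> Amax - 1" by blast
    qed simp
  next
    case False
    have "continuous_on R (\<lambda>x. B x + entropy_fun x)"
      by (rule continuous_on_subset[OF continuous_on_add[OF B_continuous continuous_on_entropy_fun]])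
        (unfold R_def, blast)
    from continuous_attains_sup[OF \<open>compact R\<close> False this] obtain x0 where x0: "x0 \<in> R" "\<And>x. x \<in> R \<Longrightarrow> B x + entropy_fun x \<le> B x0 + entropy_fun x0"
      by blast
    have "x0 \<in> {0..1}" using x0(1) unfolding R_def by blast
    moreover have "x0 \<notin> a ` J"
    proof
      assume "x0 \<in> a ` J"
      then obtain j where "j \<in> J" "x0 = a j" by blast
      then have "x0 \<in> (\<Union>j\<in>J. ball (a j) \<delta>)" using assms by (intro UN_I[of j]) auto
      with x0(1) show False unfolding R_def by blast
    qed
    ultimately have less: "B x0 + entropy_fun x0 < Amax" using strict_max by blast
    show ?thesis
    proof (rule that[of "Amax - (B x0 + entropy_fun x0)"])
      fix x assume "x \<in> {0..1::real}" "\<And>j. j \<in> J \<Longrightarrow> \<delta> \<le> \<bar>x - a j\<bar>"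
      from x0(2)[OF R[OF this]] show "B x + entropy_fun x \<le> Amax - (Amax - (B x0 + entropy_fun x0))" by simp
    qed (use less in simp)
  qed
qed

text \<open>There are three kinds of grid points. Near \<open>a j\<close> with j in
  \<open>J'\<close> the tilt has bounded effect on the local scale and \<open>local_laplace\<close>
  applies. Near the other maximizers it costs a factor
  \<open>exp (- \<eta> * n powr \<theta>)\<close>, which beats the growth of \<phi>. Elsewhere the
  weights are at most \<open>exp (- \<epsilon> * n)\<close>, against tilts of at most
  \<open>exp (F * sqrt n)\<close>. Accordingly a crude bound on \<phi>, growing with n, suffices off
  \<open>J'\<close>, whereas dominated convergence at \<open>J'\<close> needs linear growth in the
  rescaled distance.\<close>

lemma global_laplace:
  fixes \<phi> :: "nat \<Rightarrow> nat \<Rightarrow> real" and \<phi>' :: "'j \<Rightarrow> real \<Rightarrow> real"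
  assumes J': "J' \<subseteq> J"
    and on: "\<And>j. j \<in> J' \<Longrightarrow> t * (f (a j) - f0) = 0"
    and off: "\<And>j. j \<in> J - J' \<Longrightarrow> t * (f (a j) - f0) < 0"
    and C: "0 \<le> C"
    and bound: "\<And>n k. 1 \<le> n \<Longrightarrow> k \<le> n \<Longrightarrow> \<bar>\<phi> n k\<bar> \<le> C * (1 + real n powr \<theta>)"
    and local_bound: "\<And>j n k. j \<in> J' \<Longrightarrow> 1 \<le> n \<Longrightarrow> k \<le> n \<Longrightarrow>
        \<bar>\<phi> n k\<bar> \<le> C * (1 + real n powr \<theta> * \<bar>real k / real n - a j\<bar>)"
    and lim: "\<And>j. j \<in> J' \<Longrightarrow> AE y in lborel. \<forall>k :: nat \<Rightarrow> nat.
        (\<lambda>n. real n powr \<theta> * (real (k n) / real n - a j)) \<longlonglongrightarrow> y \<longrightarrow> (\<lambda>n. \<phi> n (k n)) \<longlonglongrightarrow> \<phi>' j y"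
    and meas: "\<And>j. j \<in> J' \<Longrightarrow> \<phi>' j \<in> borel_measurable borel"
  shows "(\<lambda>n. \<Sum>k\<le>n. V n k * exp (t * real n powr \<theta> * (f (real k / real n) - f0)) * \<phi> n k)
     \<longlonglongrightarrow> (\<Sum>j\<in>J'. wt j * (\<integral>y. L j t y * \<phi>' j y \<partial>lborel))"
proof -
  obtain \<delta> where \<delta>: "\<delta> > 0" "\<And>j. j \<in> J \<Longrightarrow> 2 * \<delta> \<le> a j" "\<And>j. j \<in> J \<Longrightarrow> a j \<le> 1 - 2 * \<delta>"
    "\<And>i j. i \<in> J \<Longrightarrow> j \<in> J \<Longrightarrow> i \<noteq> j \<Longrightarrow> 2 * \<delta> \<le> \<bar>a i - a j\<bar>"
    "\<And>j x. j \<in> J \<Longrightarrow> \<bar>x - a j\<bar> < \<delta> \<Longrightarrow> \<Psi> j x \<le> c j / 2"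
    using good_radius by blast
  obtain \<epsilon> where \<epsilon>: "\<epsilon> > 0"
    "\<And>x. x \<in> {0..1} \<Longrightarrow> (\<And>j. j \<in> J \<Longrightarrow> \<delta> \<le> \<bar>x - a j\<bar>) \<Longrightarrow> B x + entropy_fun x \<le> Amax - \<epsilon>"
    using gap_away_from_maximizers[OF \<delta>(1)] by blast
  define N where "N j n = {k. k \<le> n \<and> \<bar>real k / real n - a j\<bar> < \<delta>}" for j and n :: nat
  define R where "R n = {..n} - (\<Union>j\<in>J. N j n)" for n
  define h where "h n k = V n k * exp (t * real n powr \<theta> * (f (real k / real n) - f0)) * \<phi> n k" for n k
  have finN: "finite (N j n)" for j n by (auto simp: N_def)
  have split: "(\<Sum>k\<le>n. h n k) = (\<Sum>j\<in>J. \<Sum>k\<in>N j n. h n k) + (\<Sum>k\<in>R n. h n k)" for n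
  proof -
    have "N i n \<inter> N j n = {}" if "i \<in> J" "j \<in> J" "i \<noteq> j" for i j
      using \<delta>(4)[OF that] by (auto simp: N_def)
    then have "(\<Sum>k\<in>(\<Union>j\<in>J. N j n). h n k) = (\<Sum>j\<in>J. \<Sum>k\<in>N j n. h n k)"
      by (intro sum.UNION_disjoint finite_J) (auto simp: finN)
    moreover have "(\<Sum>k\<le>n. h n k) = (\<Sum>k\<in>R n. h n k) + (\<Sum>k\<in>(\<Union>j\<in>J. N j n). h n k)"
      unfolding R_def by (rule sum.subset_diff) (auto simp: N_def)
    ultimately show ?thesis by simp
  qed
  have loc: "(\<lambda>n. \<Sum>k\<in>N j n. V n k * exp (t * real n powr \<theta> * (f (real k / real n) - f (a j))) * u n k)
      \<longlonglongrightarrow> wt j * (\<integral>y. L j t y * u' y \<partial>lborel)"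
    if j: "j \<in> J" and b: "\<And>n k. 1 \<le> n \<Longrightarrow> k \<le> n \<Longrightarrow> \<bar>u n k\<bar> \<le> D * (1 + real n powr \<theta> * \<bar>real k / real n - a j\<bar>)"
      and D: "0 \<le> D"
      and l: "AE y in lborel. \<forall>k :: nat \<Rightarrow> nat.
        (\<lambda>n. real n powr \<theta> * (real (k n) / real n - a j)) \<longlonglongrightarrow> y \<longrightarrow> (\<lambda>n. u n (k n)) \<longlonglongrightarrow> u' y"
      and ms: "u' \<in> borel_measurable borel"
    for j u u' D
  proof -
    note laplace_at_j = local_laplace(1)[where f = f and B = B and \<Psi> = "\<Psi> j" and a = "a j" and M = M and m = "m j" and \<delta> = \<delta>
        and c = "c j" and d = "df j" and K = K and C = D and t = t and Amax = Amax and \<phi> = u and \<phi>' = u']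
    show ?thesis
      unfolding N_def V_def wt_def \<theta>_def
    proof (rule laplace_at_j)
      show "\<bar>f x - f (a j)\<bar> \<le> K * \<bar>x - a j\<bar>" if "\<bar>x - a j\<bar> < \<delta>" for x
        using that \<delta>(1) \<delta>(2,3)[OF j] by (intro f_lipschitz) (auto simp: abs_less_iff)
      show "\<Psi> j x \<le> c j / 2" if "\<bar>x - a j\<bar> < \<delta>" for x
        using \<delta>(5)[OF j that] .
      show "\<bar>u n k\<bar> \<le> D * (1 + real n powr (1 / (2 * real M)) * \<bar>real k / real n - a j\<bar>)"
        if "1 \<le> n" "k \<le> n" for n k
        using b[OF that] unfolding \<theta>_def .
      show "AE y in lborel. \<forall>k :: nat \<Rightarrow> nat.
        (\<lambda>n. real n powr (1 / (2 * real M)) * (real (k n) / real n - a j)) \<longlonglongrightarrow> y \<longrightarrow> (\<lambda>n. u n (k n)) \<longlonglongrightarrow> u' y"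
        using l unfolding \<theta>_def .
      show "0 < \<delta>" by (fact \<delta>(1))
      show "2 * \<delta> \<le> a j" by (rule \<delta>(2)[OF j])
      show "a j \<le> 1 - 2 * \<delta>" by (rule \<delta>(3)[OF j])
      show "(f has_real_derivative df j) (at (a j))" by (rule f_deriv[OF j])
      show "1 \<le> m j" "m j \<le> M" by (rule m_bounds[OF j])+
      show "isCont (\<Psi> j) (a j)" by (rule \<Psi>_isCont[OF j])
      show "\<Psi> j (a j) = c j" by (rule \<Psi>_at[OF j])
      show "c j < 0" by (rule c_neg[OF j])
      show "B x + entropy_fun x = Amax + \<Psi> j x * (x - a j) ^ (2 * m j)" for x
        by (rule \<Psi>_expansion[OF j])
      show "0 \<le> D" by (fact D)
      show "u' \<in> borel_measurable borel" by (fact ms)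
    qed
  qed
  have in_J': "(\<lambda>n. \<Sum>k\<in>N j n. h n k) \<longlonglongrightarrow> wt j * (\<integral>y. L j t y * \<phi>' j y \<partial>lborel)" if j: "j \<in> J'" for j
  proof -
    \<comment> \<open>For t = 0 the tilt is trivial whatever \<open>f0\<close> is, so the untilted
      sums are covered with \<open>J'\<close> equal to \<open>J\<close>.\<close>
    have "t = 0 \<or> f0 = f (a j)" using on[OF j] by auto
    then have *: "t * x * (f y - f0) = t * x * (f y - f (a j))" for x y
      by auto
    show ?thesis
      unfolding h_def * by (rule loc[OF _ local_bound[OF j] C lim[OF j] meas[OF j]]) (use j J' in auto)
  qed
  have off_J': "(\<lambda>n. \<Sum>k\<in>N j n. h n k) \<longlonglongrightarrow> 0" if j: "j \<in> J - J'" for j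
  proof -
    \<comment> \<open>The deficit in the exponent relative to \<open>f0\<close>. Once
      \<open>exp (- \<eta> * n powr \<theta>)\<close> is factored out, the tilt is centred at
      \<open>f (a j)\<close> and the remaining sum converges by \<open>loc\<close> with weight
      function 1.\<close>
    define \<eta> where "\<eta> = - (t * (f (a j) - f0))"
    have \<eta>: "\<eta> > 0" using off[OF j] by (simp add: \<eta>_def)
    let ?g = "\<lambda>n. \<Sum>k\<in>N j n. V n k * exp (t * real n powr \<theta> * (f (real k / real n) - f (a j))) * 1"
    have "?g \<longlonglongrightarrow> wt j * (\<integral>y. L j t y * 1 \<partial>lborel)"
      using j by (intro loc[where D = 1]) auto
    moreover have "(\<lambda>n. C * ((1 + real n powr \<theta>) * exp (- \<eta> * real n powr \<theta>))) \<longlonglongrightarrow> 0"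
      by (rule tendsto_mult_right_zero) (use \<theta>_bounds \<eta> in real_asymp)
    ultimately have "(\<lambda>n. C * ((1 + real n powr \<theta>) * exp (- \<eta> * real n powr \<theta>)) * ?g n) \<longlonglongrightarrow> 0 * (wt j * (\<integral>y. L j t y * 1 \<partial>lborel))"
      by (rule tendsto_mult[rotated])
    then have lim0: "(\<lambda>n. C * ((1 + real n powr \<theta>) * exp (- \<eta> * real n powr \<theta>)) * ?g n) \<longlonglongrightarrow> 0"
      by simp
    show ?thesis
    proof (rule Lim_null_comparison[OF _ lim0], rule eventually_sequentiallyI[of 1])
      fix n :: nat assume n: "1 \<le> n"
      have "\<bar>h n k\<bar> \<le> C * ((1 + real n powr \<theta>) * exp (- \<eta> * real n powr \<theta>)) *
          (V n k * exp (t * real n powr \<theta> * (f (real k / real n) - f (a j))) * 1)" if k: "k \<in> N j n" for k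
      proof -
        have e: "exp (t * real n powr \<theta> * (f x - f0)) = exp (- \<eta> * real n powr \<theta>) * exp (t * real n powr \<theta> * (f x - f (a j)))" for x
          unfolding exp_add[symmetric] \<eta>_def by (simp add: algebra_simps)
        have "\<bar>h n k\<bar> = V n k * exp (t * real n powr \<theta> * (f (real k / real n) - f0)) * \<bar>\<phi> n k\<bar>"
          unfolding h_def using V_nonneg by (simp add: abs_mult)
        also have "\<dots> \<le> V n k * exp (t * real n powr \<theta> * (f (real k / real n) - f0)) * (C * (1 + real n powr \<theta>))"
          using k by (intro mult_left_mono bound n) (auto simp: V_nonneg N_def)
        finally show ?thesis unfolding e by (simp only: mult_ac mult_1)
      qed
      then have "\<bar>\<Sum>k\<in>N j n. h n k\<bar> \<le> (\<Sum>k\<in>N j n. C * ((1 + real n powr \<theta>) * exp (- \<eta> * real n powr \<theta>)) *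
          (V n k * exp (t * real n powr \<theta> * (f (real k / real n) - f (a j))) * 1))"
        by (intro order.trans[OF sum_abs] sum_mono)
      then show "norm (\<Sum>k\<in>N j n. h n k) \<le> C * ((1 + real n powr \<theta>) * exp (- \<eta> * real n powr \<theta>)) * ?g n"
        unfolding sum_distrib_left by simp
    qed
  qed
  have rest: "(\<lambda>n. \<Sum>k\<in>R n. h n k) \<longlonglongrightarrow> 0"
  proof -
    \<comment> \<open>Lipschitz continuity bounds \<open>\<bar>f x - f0\<bar>\<close> on the unit
      interval; the summand 1 keeps F positive also for t = 0.\<close>
    define F where "F = \<bar>t\<bar> * (K + \<bar>f 0 - f0\<bar>) + 1"
    have F: "F > 0" using K_nonneg by (simp add: F_def add_nonneg_pos)
    let ?b = "\<lambda>n. exp (- \<epsilon> * real n) * exp (F * sqrt (real n)) * (C * (1 + sqrt (real n)))"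
    have "(\<lambda>n. C * ((real n + 1) * (exp (- \<epsilon> * real n) * exp (F * sqrt (real n)) * (1 + sqrt (real n))))) \<longlonglongrightarrow> 0"
      by (rule tendsto_mult_right_zero) (use \<epsilon>(1) F in real_asymp)
    then have lim0: "(\<lambda>n. (real n + 1) * ?b n) \<longlonglongrightarrow> 0"
      by (simp only: mult_ac)
    show ?thesis
    proof (rule Lim_null_comparison[OF _ lim0], rule eventually_sequentiallyI[of 1])
      fix n :: nat assume n: "1 \<le> n"
      have hb: "\<bar>h n k\<bar> \<le> ?b n" if k: "k \<in> R n" for k
      proof -
        define x where "x = real k / real n"
        have kn: "k \<le> n" using k by (simp add: R_def)
        have x: "x \<in> {0..1}" using kn n by (auto simp: x_def)
        have "\<delta> \<le> \<bar>x - a j\<bar>" if "j \<in> J" for j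
          using k that kn by (force simp: R_def N_def x_def)
        then have A: "B x + entropy_fun x \<le> Amax - \<epsilon>" using \<epsilon>(2) x by blast
        have "real (n choose k) * exp (real n * (B x - Amax)) \<le> exp (real n * entropy_fun x) * exp (real n * (B x - Amax))"
          unfolding x_def by (intro mult_right_mono binomial_le_exp_entropy kn) auto
        also have "\<dots> = exp (real n * (B x + entropy_fun x - Amax))"
          unfolding exp_add[symmetric] by (simp add: algebra_simps)
        also have "\<dots> \<le> exp (real n * (- \<epsilon>))"
          unfolding exp_le_cancel_iff using A by (intro mult_left_mono) auto
        also have "real n * (- \<epsilon>) = - \<epsilon> * real n" by simp
        finally have "real n powr (\<theta> - 1/2) * (real (n choose k) * exp (real n * (B x - Amax))) \<le> 1 * exp (- \<epsilon> * real n)"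
          using n \<theta>_bounds powr_mono[of "\<theta> - 1/2" 0 "real n"] by (intro mult_mono) auto
        then have b1: "V n k \<le> exp (- \<epsilon> * real n)"
          unfolding V_def x_def[symmetric] by (simp only: mult.assoc mult_1)
        have n\<theta>: "real n powr \<theta> \<le> sqrt (real n)"
          using n \<theta>_bounds powr_mono[of \<theta> "1/2" "real n"] by (simp add: powr_half_sqrt)
        have "\<bar>f x - f0\<bar> \<le> \<bar>f x - f 0\<bar> + \<bar>f 0 - f0\<bar>" by linarith
        also have "\<bar>f x - f 0\<bar> \<le> K * \<bar>x - 0\<bar>" using x by (intro f_lipschitz) auto
        also have "K * \<bar>x - 0\<bar> \<le> K * 1" using x K_nonneg by (intro mult_left_mono) auto
        finally have fx: "\<bar>f x - f0\<bar> \<le> K + \<bar>f 0 - f0\<bar>" by simp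
        have "t * real n powr \<theta> * (f x - f0) \<le> \<bar>t * real n powr \<theta> * (f x - f0)\<bar>"
          by (rule abs_ge_self)
        also have "\<dots> = \<bar>t\<bar> * \<bar>f x - f0\<bar> * real n powr \<theta>" by (simp add: abs_mult)
        also have "\<dots> \<le> F * sqrt (real n)"
          unfolding F_def using fx n\<theta> by (intro mult_mono order.trans[OF mult_left_mono[OF fx]]) auto
        finally have b2: "exp (t * real n powr \<theta> * (f x - f0)) \<le> exp (F * sqrt (real n))" by simp
        have "C * (1 + real n powr \<theta>) \<le> C * (1 + sqrt (real n))"
          using n\<theta> C by (intro mult_left_mono) auto
        with bound[OF n kn] have b3: "\<bar>\<phi> n k\<bar> \<le> C * (1 + sqrt (real n))" by linarith
        have "\<bar>h n k\<bar> = V n k * exp (t * real n powr \<theta> * (f x - f0)) * \<bar>\<phi> n k\<bar>"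
          unfolding h_def x_def using V_nonneg by (simp add: abs_mult)
        also have "\<dots> \<le> ?b n"
          using V_nonneg by (intro mult_mono b1 b2 b3) auto
        finally show ?thesis .
      qed
      have b0: "?b n \<ge> 0" using C by simp
      have "\<bar>\<Sum>k\<in>R n. h n k\<bar> \<le> (\<Sum>k\<in>R n. ?b n)"
        by (intro order.trans[OF sum_abs] sum_mono hb)
      also have "\<dots> \<le> (\<Sum>k\<le>n. ?b n)"
        using b0 by (intro sum_mono2) (auto simp: R_def)
      also have "\<dots> = (real n + 1) * ?b n" by (simp add: add.commute)
      finally show "norm (\<Sum>k\<in>R n. h n k) \<le> (real n + 1) * ?b n" by simp
    qed
  qed
  have "(\<lambda>n. (\<Sum>j\<in>J. \<Sum>k\<in>N j n. h n k) + (\<Sum>k\<in>R n. h n k)) \<longlonglongrightarrow>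
      (\<Sum>j\<in>J. if j \<in> J' then wt j * (\<integral>y. L j t y * \<phi>' j y \<partial>lborel) else 0) + 0"
    using in_J' off_J' by (intro tendsto_add tendsto_sum rest) auto
  also have "(\<Sum>j\<in>J. if j \<in> J' then wt j * (\<integral>y. L j t y * \<phi>' j y \<partial>lborel) else 0) + 0
      = (\<Sum>j\<in>J'. wt j * (\<integral>y. L j t y * \<phi>' j y \<partial>lborel))"
    using finite_J J' by (simp add: sum.inter_restrict[symmetric] Int_absorb1)
  finally show ?thesis
    by (simp only: split[symmetric]) (simp only: h_def)
qed

end

section \<open>Exponential tilting and the likelihood equation\<close>

text \<open>For positive x this is the tangent bound on exp; for negative x the factor
  \<open>exp (t * x)\<close> only brings the product closer to 0. It shows that centred moments grow
  at least linearly in t, both for the finite sums and for the limiting integrals.\<close>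

lemma mult_exp_lower_bound:
  fixes x t :: real
  assumes "t \<ge> 0"
  shows "x * exp (t * x) \<ge> x + t * (max x 0)\<^sup>2"
proof (cases "x \<ge> 0")
  case True
  have "x * (1 + t * x) \<le> x * exp (t * x)"
    using exp_ge_add_one_self True by (intro mult_left_mono) auto
  with True show ?thesis by (simp add: power2_eq_square algebra_simps max_def)
next
  case False
  have "exp (t * x) \<le> 1" using False assms by (auto simp: mult_le_0_iff)
  then have "x * 1 \<le> x * exp (t * x)" using False by (intro mult_left_mono_neg) auto
  with False show ?thesis by (simp add: max_def)
qed

text \<open>The mean of the statistic s in the one-parameter exponential family with base weights
  w.\<close>

definition tilted_mean :: "'a set \<Rightarrow> ('a \<Rightarrow> real) \<Rightarrow> ('a \<Rightarrow> real) \<Rightarrow> real \<Rightarrow> real" where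
  "tilted_mean I w s \<gamma> = (\<Sum>k\<in>I. w k * exp (\<gamma> * s k) * s k) / (\<Sum>k\<in>I. w k * exp (\<gamma> * s k))"

context
  fixes I :: "'a set" and w s :: "'a \<Rightarrow> real"
  assumes fin: "finite I" and ne: "I \<noteq> {}" and w_pos: "\<And>k. k \<in> I \<Longrightarrow> w k > 0"
begin

lemma tilted_denom_pos: "(\<Sum>k\<in>I. w k * exp (\<gamma> * s k)) > 0"
  using fin ne w_pos by (intro sum_pos) auto

text \<open>Centring s at v multiplies all weights by the same positive factor. A comparison of
  quotients thus becomes the sign of one sum whose terms are monotone in \<gamma>.\<close>

lemma less_tilted_mean_iff:
  "v < tilted_mean I w s \<gamma> \<longleftrightarrow> (\<Sum>k\<in>I. w k * ((s k - v) * exp (\<gamma> * (s k - v)))) > 0"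
proof -
  have "(\<Sum>k\<in>I. w k * exp (\<gamma> * s k) * s k) - v * (\<Sum>k\<in>I. w k * exp (\<gamma> * s k))
      = exp (\<gamma> * v) * (\<Sum>k\<in>I. w k * ((s k - v) * exp (\<gamma> * (s k - v))))"
    unfolding sum_distrib_left sum_subtractf[symmetric]
    by (intro sum.cong refl) (simp add: right_diff_distrib exp_diff field_simps)
  moreover have "v < tilted_mean I w s \<gamma> \<longleftrightarrow>
      0 < (\<Sum>k\<in>I. w k * exp (\<gamma> * s k) * s k) - v * (\<Sum>k\<in>I. w k * exp (\<gamma> * s k))"
    using tilted_denom_pos[of \<gamma>] by (simp add: tilted_mean_def pos_less_divide_eq)
  ultimately show ?thesis
    using zero_less_mult_iff[of "exp (\<gamma> * v)"] by simp
qed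

text \<open>Centred at the mean for \<gamma>, the sum vanishes at \<gamma>. Every term
  \<open>x * exp (\<gamma> * x)\<close> is nondecreasing in \<gamma>, strictly unless x = 0, and two
  different values of s leave at least one nonzero x.\<close>

lemma tilted_mean_strict_mono:
  assumes "k1 \<in> I" "k2 \<in> I" "s k1 \<noteq> s k2" "\<gamma> < \<gamma>'"
  shows "tilted_mean I w s \<gamma> < tilted_mean I w s \<gamma>'"
proof -
  define v where "v = tilted_mean I w s \<gamma>"
  obtain k0 where k0: "k0 \<in> I" "s k0 \<noteq> v" using assms by metis
  have "(\<Sum>k\<in>I. w k * exp (\<gamma> * s k) * s k) - v * (\<Sum>k\<in>I. w k * exp (\<gamma> * s k)) = 0"
    using tilted_denom_pos[of \<gamma>] by (simp add: v_def tilted_mean_def)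
  moreover have "(\<Sum>k\<in>I. w k * exp (\<gamma> * s k) * s k) - v * (\<Sum>k\<in>I. w k * exp (\<gamma> * s k))
      = exp (\<gamma> * v) * (\<Sum>k\<in>I. w k * ((s k - v) * exp (\<gamma> * (s k - v))))"
    unfolding sum_distrib_left sum_subtractf[symmetric]
    by (intro sum.cong refl) (simp add: right_diff_distrib exp_diff field_simps)
  ultimately have "0 = (\<Sum>k\<in>I. w k * ((s k - v) * exp (\<gamma> * (s k - v))))"
    by simp
  also have "\<dots> < (\<Sum>k\<in>I. w k * ((s k - v) * exp (\<gamma>' * (s k - v))))"
  proof (rule sum_strict_mono_strong[OF fin k0(1)])
    have le: "x * exp (\<gamma> * x) \<le> x * exp (\<gamma>' * x)" and less: "x \<noteq> 0 \<Longrightarrow> x * exp (\<gamma> * x) < x * exp (\<gamma>' * x)" for x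
    proof -
      consider "x = 0" | "x > 0" | "x < 0" by linarith
      then have "x = 0 \<or> x * exp (\<gamma> * x) < x * exp (\<gamma>' * x)"
      proof cases
        case 2
        then show ?thesis using assms(4) by (intro disjI2 mult_strict_left_mono) auto
      next
        case 3
        then show ?thesis using assms(4) by (intro disjI2 mult_strict_left_mono_neg) auto
      qed simp
      then show "x * exp (\<gamma> * x) \<le> x * exp (\<gamma>' * x)" "x \<noteq> 0 \<Longrightarrow> x * exp (\<gamma> * x) < x * exp (\<gamma>' * x)"
        by auto
    qed
    show "w k * ((s k - v) * exp (\<gamma> * (s k - v))) \<le> w k * ((s k - v) * exp (\<gamma>' * (s k - v)))" if "k \<in> I" for k
      using w_pos[OF that] by (intro mult_left_mono le) auto
    show "w k0 * ((s k0 - v) * exp (\<gamma> * (s k0 - v))) < w k0 * ((s k0 - v) * exp (\<gamma>' * (s k0 - v)))"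
      using w_pos[OF k0(1)] k0(2) by (intro mult_strict_left_mono less) auto
  qed
  finally show ?thesis
    unfolding less_tilted_mean_iff v_def .
qed

lemma tilted_mean_exceeds:
  assumes "k \<in> I" "v < s k"
  shows "\<exists>\<gamma>. v < tilted_mean I w s \<gamma>"
proof -
  define P where "P = w k * (s k - v)\<^sup>2"
  define Q where "Q = (\<Sum>k\<in>I. w k * \<bar>s k - v\<bar>)"
  have P: "P > 0" using assms w_pos by (auto simp: P_def)
  have w_nonneg: "0 \<le> w k" if "k \<in> I" for k using w_pos[OF that] by simp
  have Q: "Q \<ge> 0" using w_nonneg by (auto simp: Q_def intro!: sum_nonneg)
  \<comment> \<open>With this choice the quadratic gain \<open>\<gamma> * P\<close> of the single
    index k exceeds the largest possible loss Q by one.\<close>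
  define \<gamma> where "\<gamma> = (Q + 1) / P"
  have \<gamma>: "\<gamma> \<ge> 0" using P Q by (simp add: \<gamma>_def)
  have "w k * (\<gamma> * (max (s k - v) 0)\<^sup>2) \<le> (\<Sum>k\<in>I. w k * (\<gamma> * (max (s k - v) 0)\<^sup>2))"
    using w_nonneg assms(1) fin \<gamma> by (intro member_le_sum) auto
  moreover have "w k * (\<gamma> * (max (s k - v) 0)\<^sup>2) = \<gamma> * P"
    using assms by (simp add: P_def max_def)
  moreover have "\<gamma> * P = Q + 1" using P by (simp add: \<gamma>_def)
  ultimately have "1 \<le> - Q + (\<Sum>k\<in>I. w k * (\<gamma> * (max (s k - v) 0)\<^sup>2))" by linarith
  also have "\<dots> = (\<Sum>k\<in>I. w k * (- \<bar>s k - v\<bar> + \<gamma> * (max (s k - v) 0)\<^sup>2))"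
    by (simp add: Q_def right_diff_distrib sum_subtractf)
  also have "\<dots> \<le> (\<Sum>k\<in>I. w k * ((s k - v) * exp (\<gamma> * (s k - v))))"
  proof (intro sum_mono mult_left_mono)
    fix k assume "k \<in> I"
    show "- \<bar>s k - v\<bar> + \<gamma> * (max (s k - v) 0)\<^sup>2 \<le> (s k - v) * exp (\<gamma> * (s k - v))"
      using mult_exp_lower_bound[OF \<gamma>, of "s k - v"] by linarith
  qed (use w_nonneg in auto)
  finally show ?thesis unfolding less_tilted_mean_iff by (intro exI[of _ \<gamma>]) linarith
qed

lemma continuous_tilted_mean: "continuous_on UNIV (tilted_mean I w s)"
  unfolding tilted_mean_def[abs_def]
  by (intro continuous_intros) (use tilted_denom_pos in \<open>auto simp: less_le\<close>)

end

lemma tilted_mean_uminus: "tilted_mean I w (\<lambda>k. - s k) \<gamma> = - tilted_mean I w s (- \<gamma>)"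
  by (simp add: tilted_mean_def sum_negf)

lemma tilted_mean_attains:
  assumes "finite I" and w: "\<And>k. k \<in> I \<Longrightarrow> w k > 0"
    and k: "k1 \<in> I" "k2 \<in> I" "s k1 < v" "v < s k2"
  shows "\<exists>!\<gamma>. tilted_mean I w s \<gamma> = v"
proof -
  have ne: "I \<noteq> {}" using k by auto
  obtain \<gamma>2 where 2: "v < tilted_mean I w s \<gamma>2"
    using tilted_mean_exceeds[where w = w and s = s, OF assms(1) ne _ k(2,4)] w by blast
  \<comment> \<open>Small means come from large ones for the statistic -s.\<close>
  obtain \<gamma>1 where 1: "tilted_mean I w s \<gamma>1 < v"
    using tilted_mean_exceeds[where w = w and s = "\<lambda>k. - s k" and v = "- v", OF assms(1) ne _ k(1)] k(3) w
    by (auto simp: tilted_mean_uminus)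
  have mono: "tilted_mean I w s \<gamma> < tilted_mean I w s \<gamma>'" if "\<gamma> < \<gamma>'" for \<gamma> \<gamma>'
    using k that by (intro tilted_mean_strict_mono[where ?k1.0 = k1 and ?k2.0 = k2] assms(1) ne w) auto
  have "\<gamma>1 \<le> \<gamma>2" using 1 2 mono[of \<gamma>2 \<gamma>1] by linarith
  then obtain \<gamma> where \<gamma>: "tilted_mean I w s \<gamma> = v"
    using IVT'[of "tilted_mean I w s" \<gamma>1 v \<gamma>2] 1 2
      continuous_on_subset[OF continuous_tilted_mean[where w = w and s = s, OF assms(1) ne], of "{\<gamma>1..\<gamma>2}"] w by force
  show ?thesis
  proof (rule ex1I[of _ \<gamma>])
    fix \<gamma>' assume "tilted_mean I w s \<gamma>' = v"
    with \<gamma> mono[of \<gamma> \<gamma>'] mono[of \<gamma>' \<gamma>] show "\<gamma>' = \<gamma>" by (cases \<gamma> \<gamma>' rule: linorder_cases) auto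
  qed (fact \<gamma>)
qed

section \<open>From spin configurations to the magnetization grid\<close>

lemma finite_spins: "finite (spins n)"
  by (auto simp: spins_def intro: finite_PiE)

text \<open>A configuration is determined by its set of plus sites; grouping these sets by
  cardinality produces the binomial coefficients.\<close>

lemma sum_spins:
  "(\<Sum>\<omega>\<in>spins n. h (card {i \<in> {1..n}. \<omega> i = 1})) = (\<Sum>k\<le>n. real (n choose k) * (h k :: real))"
proof -
  have bij: "bij_betw (\<lambda>\<omega>. {i \<in> {1..n}. \<omega> i = 1}) (spins n) (Pow {1..n})"
  proof (rule bij_betwI[where g = "\<lambda>S. \<lambda>i\<in>{1..n}. if i \<in> S then 1 else -1"])
    fix \<omega> assume "\<omega> \<in> spins n"
    then show "(\<lambda>i\<in>{1..n}. if i \<in> {i \<in> {1..n}. \<omega> i = 1} then 1 else -1) = \<omega>"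
      by (fastforce simp: spins_def PiE_iff extensional_def restrict_def fun_eq_iff)
  next
    fix S assume "S \<in> Pow {1..n}"
    then show "{i \<in> {1..n}. (\<lambda>i\<in>{1..n}. if i \<in> S then 1 else -1) i = (1::int)} = S"
      by (auto split: if_splits)
  qed (auto simp: spins_def)
  have "(\<Sum>\<omega>\<in>spins n. h (card {i \<in> {1..n}. \<omega> i = 1})) = (\<Sum>S\<in>Pow {1..n}. h (card S))"
    by (rule sum.reindex_bij_betw[OF bij])
  also have "\<dots> = (\<Sum>k\<le>n. \<Sum>S\<in>{S \<in> Pow {1..n}. card S = k}. h (card S))"
    by (rule sum.group[symmetric]) (auto intro: card_mono[of "{1..n}", simplified])
  also have "\<dots> = (\<Sum>k\<le>n. real (n choose k) * h k)"
  proof (intro sum.cong refl)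
    fix k
    have "card {S \<in> Pow {1..n}. card S = k} = n choose k"
      using n_subsets[of "{1..n}" k] by simp
    then show "(\<Sum>S\<in>{S \<in> Pow {1..n}. card S = k}. h (card S)) = real (n choose k) * h k"
      by simp
  qed
  finally show ?thesis .
qed

definition grid_weight :: "(real \<Rightarrow> real) \<Rightarrow> (real \<Rightarrow> real) \<Rightarrow> real \<Rightarrow> nat \<Rightarrow> nat \<Rightarrow> real" where
  "grid_weight f g \<gamma> n k = real (n choose k) * exp (real n * (\<gamma> * f (real k / real n) + g (real k / real n)))"

lemma sum_gibbs:
  "(\<Sum>\<omega>\<in>spins n. exp (hamiltonian f g \<gamma> n \<omega>) * h (card {i \<in> {1..n}. \<omega> i = 1}))
    = (\<Sum>k\<le>n. grid_weight f g \<gamma> n k * h k)"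
  using sum_spins[of "\<lambda>k. exp (real n * (\<gamma> * f (real k / real n) + g (real k / real n))) * h k" n]
  by (simp add: hamiltonian_def plus_frac_def grid_weight_def mult.assoc)

lemma partition_function:
  "(\<Sum>\<omega>\<in>spins n. exp (hamiltonian f g \<gamma> n \<omega>)) = (\<Sum>k\<le>n. grid_weight f g \<gamma> n k)"
  using sum_gibbs[of f g \<gamma> n "\<lambda>_. 1"] by simp

lemma integral_gibbs:
  "(\<integral>\<omega>. h (card {i \<in> {1..n}. \<omega> i = 1}) \<partial>gibbs f g \<gamma> n)
    = (\<Sum>k\<le>n. grid_weight f g \<gamma> n k * h k) / (\<Sum>k\<le>n. grid_weight f g \<gamma> n k)"
proof -
  let ?Z = "\<Sum>\<omega>\<in>spins n. exp (hamiltonian f g \<gamma> n \<omega>)"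
  have "(\<integral>\<omega>. h (card {i \<in> {1..n}. \<omega> i = 1}) \<partial>gibbs f g \<gamma> n)
      = (\<Sum>\<omega>\<in>spins n. exp (hamiltonian f g \<gamma> n \<omega>) / ?Z * h (card {i \<in> {1..n}. \<omega> i = 1}))"
    unfolding gibbs_def
    by (subst lebesgue_integral_point_measure_finite)
      (auto simp: finite_spins intro!: divide_nonneg_nonneg sum_nonneg)
  also have "\<dots> = (\<Sum>\<omega>\<in>spins n. exp (hamiltonian f g \<gamma> n \<omega>) * h (card {i \<in> {1..n}. \<omega> i = 1})) / ?Z"
    by (simp add: sum_divide_distrib)
  finally show ?thesis
    unfolding sum_gibbs partition_function .
qed

lemma space_gibbs [simp]: "space (gibbs f g \<gamma> n) = spins n"
  by (simp add: gibbs_def space_point_measure)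

lemma sets_gibbs [simp]: "sets (gibbs f g \<gamma> n) = Pow (spins n)"
  by (simp add: gibbs_def sets_point_measure)

lemma measure_gibbs:
  "measure (gibbs f g \<gamma> n) {\<omega> \<in> spins n. P (card {i \<in> {1..n}. \<omega> i = 1})}
    = (\<Sum>k\<le>n. grid_weight f g \<gamma> n k * of_bool (P k)) / (\<Sum>k\<le>n. grid_weight f g \<gamma> n k)"
proof -
  have "measure (gibbs f g \<gamma> n) {\<omega> \<in> spins n. P (card {i \<in> {1..n}. \<omega> i = 1})}
    = integral\<^sup>L (gibbs f g \<gamma> n) (indicator {\<omega> \<in> spins n. P (card {i \<in> {1..n}. \<omega> i = 1})})"
    by (simp add: Int_absorb2 Collect_conj_eq)
  also have "\<dots> = (\<integral>\<omega>. of_bool (P (card {i \<in> {1..n}. \<omega> i = 1})) \<partial>gibbs f g \<gamma> n)"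
    by (rule Bochner_Integration.integral_cong) (auto simp: indicator_def)
  also have "\<dots> = (\<Sum>k\<le>n. grid_weight f g \<gamma> n k * of_bool (P k)) / (\<Sum>k\<le>n. grid_weight f g \<gamma> n k)"
    by (rule integral_gibbs)
  finally show ?thesis .
qed

lemma prob_space_gibbs: "prob_space (gibbs f g \<gamma> n)"
proof -
  have "(\<Sum>k\<le>n. grid_weight f g \<gamma> n k) > 0"
    by (intro sum_pos) (auto simp: grid_weight_def)
  then have "measure (gibbs f g \<gamma> n) (spins n) = 1"
    using measure_gibbs[of f g \<gamma> n "\<lambda>_. True"] by simp
  then show ?thesis
    by (intro prob_spaceI) (simp add: Sigma_Algebra.measure_def)
qed

lemma mean_f_eq:
  "mean_f f g n \<gamma> = (\<Sum>k\<le>n. grid_weight f g \<gamma> n k * f (real k / real n)) / (\<Sum>k\<le>n. grid_weight f g \<gamma> n k)"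
  unfolding mean_f_def plus_frac_def by (rule integral_gibbs)

text \<open>The statistic is \<open>n * f\<close>, while \<open>n * g\<close> goes into the base
  weights; this accounts for the factor n in front of the mean.\<close>

lemma mean_f_eq_tilted_mean:
  assumes "n \<ge> 1"
  shows "real n * mean_f f g n \<gamma> =
    tilted_mean {..n} (\<lambda>k. real (n choose k) * exp (real n * g (real k / real n))) (\<lambda>k. real n * f (real k / real n)) \<gamma>"
proof -
  have "grid_weight f g \<gamma> n k = real (n choose k) * exp (real n * g (real k / real n)) * exp (\<gamma> * (real n * f (real k / real n)))" for k
    by (simp add: grid_weight_def distrib_left exp_add mult_ac)
  then show ?thesis
    unfolding mean_f_eq tilted_mean_def by (simp add: sum_distrib_left mult_ac)
qed

text \<open>The grid values at \<open>k1\<close> and \<open>k2\<close> place v strictly inside the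
  range of f on the grid. The likelihood equation then has exactly one solution, so
  \<open>THE\<close> denotes it, and strict monotonicity of the mean allows the estimator to be
  compared with \<gamma> without solving the equation.\<close>

lemma mle_greater_iff:
  assumes n: "n \<ge> 1" and k: "k1 \<le> n" "k2 \<le> n" "f (real k1 / real n) < v" "v < f (real k2 / real n)"
  shows "(THE b. mean_f f g n b = v) > \<gamma> \<longleftrightarrow> mean_f f g n \<gamma> < v"
proof -
  let ?w = "\<lambda>k. real (n choose k) * exp (real n * g (real k / real n))"
  let ?s = "\<lambda>k. real n * f (real k / real n)"
  have w: "?w k > 0" if "k \<in> {..n}" for k using that by simp
  have ex: "\<exists>!b. tilted_mean {..n} ?w ?s b = real n * v"
    using k n by (intro tilted_mean_attains[where ?k1.0 = k1 and ?k2.0 = k2] w) auto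
  have eq: "mean_f f g n b = v \<longleftrightarrow> tilted_mean {..n} ?w ?s b = real n * v" for b
    using n by (simp flip: mean_f_eq_tilted_mean[OF n])
  define b where "b = (THE b. mean_f f g n b = v)"
  have b: "tilted_mean {..n} ?w ?s b = real n * v"
    unfolding b_def eq using ex by (rule theI')
  have mono: "tilted_mean {..n} ?w ?s \<gamma> < tilted_mean {..n} ?w ?s \<gamma>'" if "\<gamma> < \<gamma>'" for \<gamma> \<gamma>'
    using k n that by (intro tilted_mean_strict_mono[where ?k1.0 = k1 and ?k2.0 = k2] w) auto
  have "b > \<gamma> \<longleftrightarrow> tilted_mean {..n} ?w ?s \<gamma> < real n * v"
    using b mono[of \<gamma> b] mono[of b \<gamma>] by (cases b \<gamma> rule: linorder_cases) auto
  then show ?thesis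
    using n unfolding b_def by (simp flip: mean_f_eq_tilted_mean[OF n])
qed

section \<open>The thresholds\<close>

text \<open>The unnormalized density of \<open>Y j t\<close>, to which \<open>laplace_limit\<close>
  reduces when m = M.\<close>

definition laplace_weight :: "nat \<Rightarrow> real \<Rightarrow> real \<Rightarrow> real \<Rightarrow> real \<Rightarrow> real" where
  "laplace_weight m c d t y = exp (c * y ^ (2 * m) + t * d * y)"

lemma laplace_weight_measurable [measurable]: "laplace_weight m c d t \<in> borel_measurable borel"
  unfolding laplace_weight_def[abs_def] by measurable

lemma laplace_weight_pos: "laplace_weight m c d t y > 0"
  by (simp add: laplace_weight_def)

lemma laplace_weight_reflect: "laplace_weight m c d t (- y) = laplace_weight m c d (- t) y"
  by (simp add: laplace_weight_def)

text \<open>The majorant is uniform over \<open>\<bar>t\<bar> \<le> T\<close>; this is what makes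
  the integrals continuous in t by dominated convergence along bounded sequences.\<close>

lemma laplace_weight_bound:
  assumes "1 \<le> m" "c < 0" "\<bar>t\<bar> \<le> T"
  shows "laplace_weight m c d t y * (1 + \<bar>y\<bar>) \<le>
    exp (- c) * (2 * exp ((T * \<bar>d\<bar> + 2)\<^sup>2 / (4 * - c))) * inverse (1 + y\<^sup>2)"
proof -
  have "y\<^sup>2 - 1 \<le> y ^ (2 * m)"
    by (rule square_minus_one_le_even_power[OF assms(1)])
  then have "c * y ^ (2 * m) \<le> c * (y\<^sup>2 - 1)"
    using assms(2) by (intro mult_left_mono_neg) auto
  moreover have "t * d * y \<le> \<bar>t\<bar> * \<bar>d\<bar> * \<bar>y\<bar>" by (metis abs_ge_self abs_mult)
  moreover have "\<bar>t\<bar> * \<bar>d\<bar> * \<bar>y\<bar> \<le> T * \<bar>d\<bar> * \<bar>y\<bar>"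
    using assms(3) by (intro mult_right_mono) auto
  ultimately have "c * y ^ (2 * m) + t * d * y \<le> - c + (- (- c) * y\<^sup>2 + T * \<bar>d\<bar> * \<bar>y\<bar>)"
    by (simp add: algebra_simps)
  then have "laplace_weight m c d t y \<le> exp (- c) * exp (- (- c) * y\<^sup>2 + T * \<bar>d\<bar> * \<bar>y\<bar>)"
    unfolding laplace_weight_def exp_add[symmetric] by simp
  then have "laplace_weight m c d t y * (1 + \<bar>y\<bar>) \<le> exp (- c) * (exp (- (- c) * y\<^sup>2 + T * \<bar>d\<bar> * \<bar>y\<bar>) * (1 + \<bar>y\<bar>))"
    unfolding mult.assoc[symmetric] by (intro mult_right_mono) auto
  also have "\<dots> \<le> exp (- c) * (2 * exp ((T * \<bar>d\<bar> + 2)\<^sup>2 / (4 * - c)) * inverse (1 + y\<^sup>2))"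
    using assms(2) by (intro mult_left_mono gaussian_tail_bound) auto
  finally show ?thesis by (simp only: mult.assoc)
qed

lemma laplace_weight_times_bound:
  assumes "1 \<le> m" "c < 0" "\<bar>t\<bar> \<le> T" "\<bar>u\<bar> \<le> C * (1 + \<bar>y\<bar>)"
  shows "norm (laplace_weight m c d t y * u) \<le>
    C * (exp (- c) * (2 * exp ((T * \<bar>d\<bar> + 2)\<^sup>2 / (4 * - c))) * inverse (1 + y\<^sup>2))"
proof -
  have "0 \<le> C * (1 + \<bar>y\<bar>)" using assms(4) by (rule order.trans[OF abs_ge_zero])
  then have C: "C \<ge> 0" by (auto simp: zero_le_mult_iff)
  have "norm (laplace_weight m c d t y * u) = laplace_weight m c d t y * \<bar>u\<bar>"
    using laplace_weight_pos[of m c d t y] by (simp add: abs_mult)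
  also have "\<dots> \<le> laplace_weight m c d t y * (C * (1 + \<bar>y\<bar>))"
    using laplace_weight_pos[of m c d t y] assms(4) by (intro mult_left_mono) auto
  also have "\<dots> = C * (laplace_weight m c d t y * (1 + \<bar>y\<bar>))" by simp
  also have "\<dots> \<le> C * (exp (- c) * (2 * exp ((T * \<bar>d\<bar> + 2)\<^sup>2 / (4 * - c))) * inverse (1 + y\<^sup>2))"
    by (intro mult_left_mono laplace_weight_bound assms C)
  finally show ?thesis .
qed

lemma integrable_laplace_weight_times:
  assumes "1 \<le> m" "c < 0" and [measurable]: "u \<in> borel_measurable borel"
    and "\<And>y. \<bar>u y\<bar> \<le> C * (1 + \<bar>y\<bar>)"
  shows "integrable lborel (\<lambda>y. laplace_weight m c d t y * u y)"
proof (rule Bochner_Integration.integrable_bound)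
  show "integrable lborel (\<lambda>y. C * (exp (- c) * (2 * exp ((\<bar>t\<bar> * \<bar>d\<bar> + 2)\<^sup>2 / (4 * - c))) * inverse (1 + y\<^sup>2)))"
    by (intro integrable_mult_right integrable_inverse_1_plus_square_UNIV)
  show "AE y in lborel. norm (laplace_weight m c d t y * u y) \<le>
      norm (C * (exp (- c) * (2 * exp ((\<bar>t\<bar> * \<bar>d\<bar> + 2)\<^sup>2 / (4 * - c))) * inverse (1 + y\<^sup>2)))"
    unfolding real_norm_def
    by (intro AE_I2 order.trans[OF _ abs_ge_self] laplace_weight_times_bound[unfolded real_norm_def] assms order.refl)
qed measurable

lemma integrable_laplace_weight:
  assumes "1 \<le> m" "c < 0"
  shows "integrable lborel (laplace_weight m c d t)"
  using integrable_laplace_weight_times[OF assms, of "\<lambda>_. 1" 1 d t] by simp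

lemma integrable_laplace_weight_linear:
  assumes "1 \<le> m" "c < 0"
  shows "integrable lborel (\<lambda>y. laplace_weight m c d t y * (b * y))"
  by (rule integrable_laplace_weight_times[OF assms, of _ "\<bar>b\<bar>"]) (auto simp: abs_mult distrib_left)

lemma integral_laplace_weight_pos:
  assumes "1 \<le> m" "c < 0" "l < r"
  shows "(\<integral>y. laplace_weight m c d t y * indicator {l..r} y \<partial>lborel) > 0"
proof -
  have int: "integrable lborel (\<lambda>y. laplace_weight m c d t y * indicator {l..r} y)"
    by (rule integrable_laplace_weight_times[OF assms(1,2), of _ 1]) (auto simp: indicator_def)
  have nonneg: "AE y in lborel. 0 \<le> laplace_weight m c d t y * indicator {l..r} y"
    using laplace_weight_pos[of m c d t] by (auto simp: indicator_def less_imp_le)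
  have "(\<integral>y. laplace_weight m c d t y * indicator {l..r} y \<partial>lborel) \<noteq> 0"
  proof
    assume "(\<integral>y. laplace_weight m c d t y * indicator {l..r} y \<partial>lborel) = 0"
    then have "AE y in lborel. laplace_weight m c d t y * indicator {l..r} y = 0"
      using integral_nonneg_eq_0_iff_AE[OF int nonneg] by simp
    then have "AE y in lborel. y \<notin> {l..r}"
      using laplace_weight_pos[of m c d t] by (auto simp: indicator_def less_le elim!: eventually_mono)
    then have "emeasure lborel {l..r} = 0"
      by (subst (asm) AE_iff_measurable[OF _ refl]) (auto simp: atLeastAtMost_def atLeast_def atMost_def Collect_conj_eq)
    then show False using assms(3) by simp
  qed
  moreover have "(\<integral>y. laplace_weight m c d t y * indicator {l..r} y \<partial>lborel) \<ge> 0"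
    using nonneg by (intro Bochner_Integration.integral_nonneg_AE)
  ultimately show ?thesis by simp
qed

lemma laplace_weight_integral_pos:
  assumes "1 \<le> m" "c < 0"
  shows "integral\<^sup>L lborel (laplace_weight m c d t) > 0"
proof -
  have "0 < (\<integral>y. laplace_weight m c d t y * indicator {0..1} y \<partial>lborel)"
    by (rule integral_laplace_weight_pos[OF assms]) simp
  also have "\<dots> \<le> integral\<^sup>L lborel (laplace_weight m c d t)"
    using laplace_weight_pos[of m c d t]
    by (intro integral_mono integrable_laplace_weight assms
        integrable_laplace_weight_times[OF assms, of _ 1]) (auto simp: indicator_def less_imp_le)
  finally show ?thesis .
qed

lemma integral_reflect_lborel: "(\<integral>y. f (- y) \<partial>lborel) = (\<integral>y. f y \<partial>lborel)"
  for f :: "real \<Rightarrow> real"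
  using lborel_integral_real_affine[of "-1" f 0] by simp

lemma continuous_integral_laplace_weight_times:
  assumes "1 \<le> m" "c < 0" and [measurable]: "u \<in> borel_measurable borel"
    and u: "\<And>y. \<bar>u y\<bar> \<le> C * (1 + \<bar>y\<bar>)"
  shows "isCont (\<lambda>t. \<integral>y. laplace_weight m c d t y * u y \<partial>lborel) t"
  unfolding continuous_at_sequentially comp_def
proof (intro allI impI)
  fix s :: "nat \<Rightarrow> real" assume s: "s \<longlonglongrightarrow> t"
  from convergent_imp_Bseq[OF convergentI[OF this]] obtain T where T: "\<And>n. \<bar>s n\<bar> \<le> T"
    by (auto simp: Bseq_def)
  show "(\<lambda>n. \<integral>y. laplace_weight m c d (s n) y * u y \<partial>lborel) \<longlonglongrightarrow> (\<integral>y. laplace_weight m c d t y * u y \<partial>lborel)"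
  proof (rule integral_dominated_convergence)
    show "integrable lborel (\<lambda>y. C * (exp (- c) * (2 * exp ((T * \<bar>d\<bar> + 2)\<^sup>2 / (4 * - c))) * inverse (1 + y\<^sup>2)))"
      by (intro integrable_mult_right integrable_inverse_1_plus_square_UNIV)
    show "AE y in lborel. (\<lambda>n. laplace_weight m c d (s n) y * u y) \<longlonglongrightarrow> laplace_weight m c d t y * u y"
      unfolding laplace_weight_def by (intro AE_I2 tendsto_intros s)
    show "AE y in lborel. norm (laplace_weight m c d (s n) y * u y)
        \<le> C * (exp (- c) * (2 * exp ((T * \<bar>d\<bar> + 2)\<^sup>2 / (4 * - c))) * inverse (1 + y\<^sup>2))" for n
      by (intro AE_I2 laplace_weight_times_bound assms(1,2) T u)
  qed measurable
qed

text \<open>Treats the upper and the lower tail at once: the set \<open>I\<close> will be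
  \<open>J2p\<close> in one instance and \<open>J2m\<close> in the other.\<close>

locale laplace_mixture =
  fixes I :: "'j set" and m :: "'j \<Rightarrow> nat" and c d v :: "'j \<Rightarrow> real"
  assumes finite_I: "finite I"
    and m_pos: "j \<in> I \<Longrightarrow> 1 \<le> m j"
    and c_neg: "j \<in> I \<Longrightarrow> c j < 0"
    and v_pos: "j \<in> I \<Longrightarrow> 0 < v j"
    and nondegenerate: "\<exists>j\<in>I. d j \<noteq> 0"
begin

abbreviation W :: "'j \<Rightarrow> real \<Rightarrow> real \<Rightarrow> real" where
  "W j \<equiv> laplace_weight (m j) (c j) (d j)"

text \<open>The mean of \<open>d j * Y j t\<close> under the mixture whose weights are proportional
  to \<open>v j * q j t\<close>. For \<open>v = wt\<close> these are the weights \<open>pp\<close>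
  or \<open>pm\<close>, so dividing by \<open>\<bar>d j\<bar>\<close> gives the boundary point in
  the tails of the theorem.\<close>

definition threshold :: "real \<Rightarrow> real" where
  "threshold t = (\<Sum>j\<in>I. v j * (\<integral>y. W j t y * (d j * y) \<partial>lborel)) / (\<Sum>j\<in>I. v j * integral\<^sup>L lborel (W j t))"

lemma mass_pos: "(\<Sum>j\<in>I. v j * integral\<^sup>L lborel (W j t)) > 0"
  using nondegenerate finite_I by (intro sum_pos mult_pos_pos v_pos laplace_weight_integral_pos m_pos c_neg) auto

text \<open>The substitution of -y for y exchanges t and -t because the power of y is even.
  Vanishing at 0 and all statements about negative t follow from this.\<close>

lemma threshold_uminus: "threshold (- t) = - threshold t"
proof -
  have "integral\<^sup>L lborel (W j (- t)) = integral\<^sup>L lborel (W j t)" for j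
    using integral_reflect_lborel[of "W j t"] by (simp add: laplace_weight_reflect)
  moreover have "(\<integral>y. W j (- t) y * (d j * y) \<partial>lborel) = - (\<integral>y. W j t y * (d j * y) \<partial>lborel)" for j
    using integral_reflect_lborel[of "\<lambda>y. W j t y * (d j * y)"] by (simp add: laplace_weight_reflect)
  ultimately show ?thesis by (simp add: threshold_def sum_negf)
qed

lemma isCont_threshold: "isCont threshold t"
proof -
  have 1: "isCont (\<lambda>t. \<integral>y. W j t y * (d j * y) \<partial>lborel) t" if "j \<in> I" for j
    by (rule continuous_integral_laplace_weight_times[OF m_pos[OF that] c_neg[OF that], of _ "\<bar>d j\<bar>"])
      (auto simp: abs_mult distrib_left)
  have 2: "isCont (\<lambda>t. integral\<^sup>L lborel (W j t)) t" if "j \<in> I" for j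
    using continuous_integral_laplace_weight_times[OF m_pos[OF that] c_neg[OF that], of "\<lambda>_. 1" 1] by simp
  show ?thesis
    unfolding threshold_def[abs_def] using 1 2 mass_pos[of t]
    by (intro continuous_intros) auto
qed

text \<open>With \<open>x = d j * y - b\<close>, the pointwise bound
  \<open>x * exp (t * x) \<ge> x + t * of_bool (x \<ge> 1)\<close> is integrated against the weight
  at t = 0. The moment centred at b thus grows at least linearly, with slope P the mass of the event
  x \<ge> 1. The case b = 0 gives positivity for t > 0, and arbitrary b gives divergence.\<close>

lemma threshold_lower_bound:
  obtains P where "P > 0"
    "\<And>t. t \<ge> 0 \<Longrightarrow> (\<Sum>j\<in>I. v j * (\<integral>y. W j 0 y * (d j * y - b) \<partial>lborel)) + t * P > 0 \<Longrightarrow> threshold t > b"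
proof -
  let ?u = "\<lambda>j y. of_bool (d j * y - b \<ge> 1) :: real"
  define P where "P = (\<Sum>j\<in>I. v j * (\<integral>y. W j 0 y * ?u j y \<partial>lborel))"
  have int_u: "integrable lborel (\<lambda>y. W j 0 y * ?u j y)" if "j \<in> I" for j
    by (rule integrable_laplace_weight_times[OF m_pos[OF that] c_neg[OF that], of _ 1]) auto
  have int_l: "integrable lborel (\<lambda>y. W j t y * (d j * y - b))" if "j \<in> I" for j t
    unfolding right_diff_distrib
    by (intro Bochner_Integration.integrable_diff integrable_laplace_weight_linear integrable_mult_left integrable_laplace_weight m_pos c_neg that)
  show ?thesis
  proof (rule that)
    obtain i where i: "i \<in> I" "d i \<noteq> 0" using nondegenerate by blast
    show "P > 0"
      unfolding P_def
    proof (rule sum_pos2[OF finite_I i(1)])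
      \<comment> \<open>The event is a half line with endpoint l, to the right or to the left
        according to the sign of \<open>d i\<close>; an interval of length one inside it witnesses
        positive mass.\<close>
      define l where "l = (b + 1) / d i"
      define lo hi where "lo = (if d i > 0 then l else l - 1)" and "hi = lo + 1"
      have sub: "d i * y - b \<ge> 1" if "y \<in> {lo..hi}" for y
      proof (cases "d i > 0")
        case True
        then have "y \<ge> (b + 1) / d i" using that by (simp add: lo_def l_def)
        with True show ?thesis by (simp add: field_simps)
      next
        case False
        then have "y \<le> (b + 1) / d i" "d i < 0" using that i(2) by (auto simp: lo_def hi_def l_def)
        then show ?thesis by (simp add: field_simps)
      qed
      have "0 < (\<integral>y. W i 0 y * indicator {lo..hi} y \<partial>lborel)"
        by (rule integral_laplace_weight_pos[OF m_pos[OF i(1)] c_neg[OF i(1)]]) (simp add: hi_def)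
      also have "\<dots> \<le> (\<integral>y. W i 0 y * ?u i y \<partial>lborel)"
      proof (rule integral_mono)
        show "integrable lborel (\<lambda>y. W i 0 y * indicator {lo..hi} y)"
          by (rule integrable_laplace_weight_times[OF m_pos[OF i(1)] c_neg[OF i(1)], of _ 1]) (auto simp: indicator_def)
        show "W i 0 y * indicator {lo..hi} y \<le> W i 0 y * ?u i y" for y
          using sub[of y] laplace_weight_pos[of "m i" "c i" "d i" 0 y]
          by (intro mult_left_mono) (auto simp: indicator_def)
      qed (rule int_u[OF i(1)])
      finally show "0 < v i * (\<integral>y. W i 0 y * ?u i y \<partial>lborel)"
        using v_pos[OF i(1)] by simp
    next
      fix j assume "j \<in> I"
      then show "0 \<le> v j * (\<integral>y. W j 0 y * ?u j y \<partial>lborel)"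
        using v_pos[of j] laplace_weight_pos[of "m j" "c j" "d j" 0]
        by (intro mult_nonneg_nonneg Bochner_Integration.integral_nonneg) (auto simp: less_imp_le)
    qed
    fix t :: real assume t: "t \<ge> 0" and pos: "(\<Sum>j\<in>I. v j * (\<integral>y. W j 0 y * (d j * y - b) \<partial>lborel)) + t * P > 0"
    have "(\<integral>y. W j 0 y * (d j * y - b) \<partial>lborel) + t * (\<integral>y. W j 0 y * ?u j y \<partial>lborel)
        \<le> exp (- t * b) * (\<integral>y. W j t y * (d j * y - b) \<partial>lborel)" if j: "j \<in> I" for j
    proof -
      have "(\<integral>y. W j 0 y * (d j * y - b) \<partial>lborel) + t * (\<integral>y. W j 0 y * ?u j y \<partial>lborel)
        = (\<integral>y. W j 0 y * (d j * y - b) + t * (W j 0 y * ?u j y) \<partial>lborel)"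
        using int_l[OF j] int_u[OF j] by simp
      also have "\<dots> \<le> (\<integral>y. exp (- t * b) * (W j t y * (d j * y - b)) \<partial>lborel)"
      proof (rule integral_mono)
        fix y
        define x where "x = d j * y - b"
        have "t * of_bool (x \<ge> 1) \<le> t * (max x 0)\<^sup>2"
          using t by (intro mult_left_mono) auto
        with mult_exp_lower_bound[OF t, of x] have "x + t * of_bool (x \<ge> 1) \<le> x * exp (t * x)"
          by linarith
        then have "W j 0 y * (x + t * of_bool (x \<ge> 1)) \<le> W j 0 y * (x * exp (t * x))"
          using laplace_weight_pos[of "m j" "c j" "d j" 0 y] by (intro mult_left_mono) auto
        also have "\<dots> = exp (- t * b) * (W j t y * x)"
        proof -
          \<comment> \<open>Tilting by the centred variable differs from tilting by
            \<open>d j * y\<close> only in the positive constant \<open>exp (- t * b)\<close>, which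
            does not affect signs.\<close>
          have "W j 0 y * exp (t * x) = exp (- t * b) * W j t y"
            unfolding laplace_weight_def exp_add[symmetric] x_def by (simp add: algebra_simps)
          then show ?thesis by (metis mult.assoc mult.commute)
        qed
        finally show "W j 0 y * (d j * y - b) + t * (W j 0 y * ?u j y) \<le> exp (- t * b) * (W j t y * (d j * y - b))"
          by (simp add: x_def distrib_left mult_ac)
      qed (use int_l[OF j] int_u[OF j] in auto)
      finally show ?thesis by simp
    qed
    then have "(\<Sum>j\<in>I. v j * ((\<integral>y. W j 0 y * (d j * y - b) \<partial>lborel) + t * (\<integral>y. W j 0 y * ?u j y \<partial>lborel)))
      \<le> (\<Sum>j\<in>I. v j * (exp (- t * b) * (\<integral>y. W j t y * (d j * y - b) \<partial>lborel)))"
      using v_pos by (intro sum_mono mult_left_mono) (auto simp: less_imp_le)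
    moreover have "(\<Sum>j\<in>I. v j * ((\<integral>y. W j 0 y * (d j * y - b) \<partial>lborel) + t * (\<integral>y. W j 0 y * ?u j y \<partial>lborel)))
      = (\<Sum>j\<in>I. v j * (\<integral>y. W j 0 y * (d j * y - b) \<partial>lborel)) + t * P"
      by (simp add: P_def distrib_left sum.distrib sum_distrib_left mult_ac)
    ultimately have "0 < (\<Sum>j\<in>I. v j * (exp (- t * b) * (\<integral>y. W j t y * (d j * y - b) \<partial>lborel)))"
      using pos by linarith
    also have "\<dots> = exp (- t * b) * (\<Sum>j\<in>I. v j * (\<integral>y. W j t y * (d j * y - b) \<partial>lborel))"
      by (simp add: sum_distrib_left mult_ac)
    finally have "0 < (\<Sum>j\<in>I. v j * (\<integral>y. W j t y * (d j * y - b) \<partial>lborel))"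
      by (simp add: zero_less_mult_iff)
    also have "\<dots> = (\<Sum>j\<in>I. v j * ((\<integral>y. W j t y * (d j * y) \<partial>lborel) - b * integral\<^sup>L lborel (W j t)))"
    proof (intro sum.cong refl arg_cong2[where f = times])
      fix j assume j: "j \<in> I"
      have "(\<integral>y. W j t y * (d j * y) - b * W j t y \<partial>lborel) = (\<integral>y. W j t y * (d j * y) \<partial>lborel) - (\<integral>y. b * W j t y \<partial>lborel)"
        by (intro Bochner_Integration.integral_diff integrable_laplace_weight_linear integrable_mult_right
            integrable_laplace_weight m_pos c_neg j)
      then show "(\<integral>y. W j t y * (d j * y - b) \<partial>lborel) = (\<integral>y. W j t y * (d j * y) \<partial>lborel) - b * integral\<^sup>L lborel (W j t)"
        by (simp add: right_diff_distrib left_diff_distrib mult_ac)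
    qed
    also have "\<dots> = (\<Sum>j\<in>I. v j * (\<integral>y. W j t y * (d j * y) \<partial>lborel)) - b * (\<Sum>j\<in>I. v j * integral\<^sup>L lborel (W j t))"
      by (simp add: right_diff_distrib sum_subtractf sum_distrib_left mult_ac)
    finally show "threshold t > b"
      unfolding threshold_def using mass_pos[of t] by (simp add: pos_less_divide_eq)
  qed
qed

lemma threshold_0: "threshold 0 = 0"
  using threshold_uminus[of 0] by simp

lemma threshold_pos:
  assumes "t > 0"
  shows "threshold t > 0"
proof -
  obtain P where P: "P > 0"
    "\<And>t. t \<ge> 0 \<Longrightarrow> (\<Sum>j\<in>I. v j * (\<integral>y. W j 0 y * (d j * y - 0) \<partial>lborel)) + t * P > 0 \<Longrightarrow> threshold t > 0"
    using threshold_lower_bound[of 0] by blast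
  have "(\<Sum>j\<in>I. v j * (\<integral>y. W j 0 y * (d j * y) \<partial>lborel)) = 0"
    using threshold_0 mass_pos[of 0] by (simp add: threshold_def)
  then show ?thesis using P(2)[of t] P(1) assms by simp
qed

lemma threshold_neg: "t < 0 \<Longrightarrow> threshold t < 0"
  using threshold_pos[of "- t"] by (simp add: threshold_uminus)

lemma threshold_at_top: "filterlim threshold at_top at_top"
  unfolding filterlim_at_top_dense
proof
  fix b
  obtain P where P: "P > 0"
    "\<And>t. t \<ge> 0 \<Longrightarrow> (\<Sum>j\<in>I. v j * (\<integral>y. W j 0 y * (d j * y - b) \<partial>lborel)) + t * P > 0 \<Longrightarrow> threshold t > b"
    using threshold_lower_bound[of b] by blast
  define N where "N = (\<Sum>j\<in>I. v j * (\<integral>y. W j 0 y * (d j * y - b) \<partial>lborel))"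
  have "threshold t > b" if "t > max 0 (- N / P)" for t
  proof (rule P(2))
    show "0 < (\<Sum>j\<in>I. v j * (\<integral>y. W j 0 y * (d j * y - b) \<partial>lborel)) + t * P"
      unfolding N_def[symmetric] using that P(1) by (simp add: field_simps)
  qed (use that in simp)
  then show "\<forall>\<^sub>F t in at_top. b < threshold t"
    by (rule eventually_at_top_dense[THEN iffD2, OF exI, OF allI, OF impI])
qed

end

lemma eventually_less_tendsto:
  fixes f g :: "'a \<Rightarrow> real"
  assumes "(f \<longlongrightarrow> l) F" "(g \<longlongrightarrow> r) F" "l < r"
  shows "\<forall>\<^sub>F x in F. f x < g x"
  using order_tendstoD(1)[OF tendsto_diff[OF assms(2,1)], of 0] assms(3) by simp

section \<open>Convergence of the tails of the estimator\<close>

locale linear_model = laplace_model f "\<lambda>x. \<beta> * f x + g x" J a m M df c \<Psi> Amax K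
  for f g :: "real \<Rightarrow> real" and \<beta> :: real and J :: "'j set" and a m M df c \<Psi> Amax K +
  assumes M_attained: "\<exists>j\<in>J. m j = M"
begin

definition tilt_sum :: "real \<Rightarrow> real \<Rightarrow> (nat \<Rightarrow> real) \<Rightarrow> nat \<Rightarrow> real" where
  "tilt_sum t f0 h n = (\<Sum>k\<le>n. V n k * exp (t * real n powr \<theta> * (f (real k / real n) - f0)) * h k)"

text \<open>All factors independent of k cancel in the quotient: the normalization of
  \<open>V\<close>, the maximum \<open>Amax\<close>, and the centring of the tilt at
  \<open>f0\<close>, which may therefore be chosen freely. A shift of
  \<open>t * n powr (\<theta> - 1)\<close> turns into the tilt \<open>t * n powr \<theta>\<close>
  because the Hamiltonian carries a factor n.\<close>

lemma grid_weight_ratio: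
  assumes n: "n \<ge> 1"
  shows "(\<Sum>k\<le>n. grid_weight f g (\<beta> + t * real n powr (\<theta> - 1)) n k * h k)
      / (\<Sum>k\<le>n. grid_weight f g (\<beta> + t * real n powr (\<theta> - 1)) n k)
    = tilt_sum t f0 h n / tilt_sum t f0 (\<lambda>_. 1) n"
proof -
  define r where "r = real n powr (1/2 - \<theta>) * exp (real n * Amax) * exp (t * real n powr \<theta> * f0)"
  have "grid_weight f g (\<beta> + t * real n powr (\<theta> - 1)) n k
      = r * (V n k * exp (t * real n powr \<theta> * (f (real k / real n) - f0)))" for k
  proof -
    define x where "x = real k / real n"
    have p: "real n powr (1/2 - \<theta>) * real n powr (\<theta> - 1/2) = 1"
      using n by (simp flip: powr_add)
    have q: "real n * real n powr (\<theta> - 1) = real n powr \<theta>"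
      using n powr_mult_base[of "real n" "\<theta> - 1"] by simp
    have "real n * ((\<beta> + t * real n powr (\<theta> - 1)) * f x + g x)
      = real n * Amax + t * real n powr \<theta> * f0 + real n * (\<beta> * f x + g x - Amax) + t * real n powr \<theta> * (f x - f0)"
      unfolding q[symmetric] by (simp add: algebra_simps)
    then have "exp (real n * ((\<beta> + t * real n powr (\<theta> - 1)) * f x + g x))
      = exp (real n * Amax) * exp (t * real n powr \<theta> * f0) * exp (real n * (\<beta> * f x + g x - Amax)) * exp (t * real n powr \<theta> * (f x - f0))"
      by (simp only: exp_add)
    then show ?thesis
      unfolding grid_weight_def r_def V_def x_def[symmetric] using p
      by (simp add: mult_ac)
  qed
  moreover have "r \<noteq> 0" using n by (simp add: r_def)
  ultimately show ?thesis
    by (simp add: tilt_sum_def mult.assoc flip: sum_distrib_left)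
qed

lemma wt_pos: "j \<in> J \<Longrightarrow> wt j > 0"
  using stirling_const_pos a_interior[of j] by (auto simp: wt_def)

abbreviation dominant :: "'j set \<Rightarrow> 'j set" where
  "dominant J' \<equiv> {j \<in> J'. m j = M}"

abbreviation W :: "'j \<Rightarrow> real \<Rightarrow> real \<Rightarrow> real" where
  "W j \<equiv> laplace_weight (m j) (c j) (df j)"

lemma sum_laplace_limit:
  assumes "J' \<subseteq> J"
  shows "(\<Sum>j\<in>J'. wt j * (\<integral>y. L j t y * h j y \<partial>lborel)) = (\<Sum>j\<in>dominant J'. wt j * (\<integral>y. W j t y * h j y \<partial>lborel))"
proof -
  have "(\<Sum>j\<in>dominant J'. wt j * (\<integral>y. W j t y * h j y \<partial>lborel)) = (\<Sum>j\<in>dominant J'. wt j * (\<integral>y. L j t y * h j y \<partial>lborel))"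
    by (intro sum.cong refl) (simp add: laplace_limit_def laplace_weight_def)
  also have "\<dots> = (\<Sum>j\<in>J'. wt j * (\<integral>y. L j t y * h j y \<partial>lborel))"
    by (rule sum.mono_neutral_left) (auto simp: laplace_limit_def intro: finite_subset[OF assms finite_J])
  finally show ?thesis by simp
qed

lemma local_tendsto:
  assumes j: "j \<in> J" and z: "(\<lambda>n. real n powr \<theta> * (real (k n) / real n - a j)) \<longlonglongrightarrow> y"
  shows "(\<lambda>n. f (real (k n) / real n)) \<longlonglongrightarrow> f (a j)"
    and "(\<lambda>n. real n powr \<theta> * (f (real (k n) / real n) - f (a j))) \<longlonglongrightarrow> df j * y"
proof -
  obtain Q where Q: "\<And>x. f x - f (a j) = Q x * (x - a j)" "isCont Q (a j)" "Q (a j) = df j"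
    using f_deriv[OF j] unfolding CARAT_DERIV by blast
  have "(\<lambda>n. 1 / real n powr \<theta>) \<longlonglongrightarrow> 0" using \<theta>_bounds by real_asymp
  from tendsto_mult[OF z this]
  have "(\<lambda>n. real n powr \<theta> * (real (k n) / real n - a j) * (1 / real n powr \<theta>)) \<longlonglongrightarrow> 0" by simp
  moreover have "\<forall>\<^sub>F n in sequentially. real n powr \<theta> * (real (k n) / real n - a j) * (1 / real n powr \<theta>) = real (k n) / real n - a j"
    by (rule eventually_sequentiallyI[of 1]) simp
  ultimately have "(\<lambda>n. real (k n) / real n - a j) \<longlonglongrightarrow> 0"
    by (rule Lim_transform_eventually)
  then have x: "(\<lambda>n. real (k n) / real n) \<longlonglongrightarrow> a j" by (simp add: LIM_zero_iff)
  show "(\<lambda>n. f (real (k n) / real n)) \<longlonglongrightarrow> f (a j)"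
    by (rule isCont_tendsto_compose[OF DERIV_isCont[OF f_deriv[OF j]] x])
  have "(\<lambda>n. Q (real (k n) / real n) * (real n powr \<theta> * (real (k n) / real n - a j))) \<longlonglongrightarrow> df j * y"
    using isCont_tendsto_compose[OF Q(2) x] Q(3) by (intro tendsto_mult z) simp
  then show "(\<lambda>n. real n powr \<theta> * (f (real (k n) / real n) - f (a j))) \<longlonglongrightarrow> df j * y"
    by (simp add: Q(1) mult_ac)
qed

lemma dominant_mixture:
  assumes "J' \<subseteq> J" "j \<in> J'" "m j = M" "df j \<noteq> 0"
  shows "laplace_mixture (dominant J') m c df wt"
  using assms m_bounds c_neg wt_pos finite_subset[OF assms(1) finite_J] by unfold_locales auto

text \<open>The rescaled mean is a quotient of two tilted sums. The function averaged in the
  numerator grows like \<open>n powr \<theta>\<close>, but on \<open>J'\<close> the value of f is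
  \<open>f0\<close>, so Lipschitz continuity bounds it by K times the rescaled distance to each such
  \<open>a j\<close>. The index \<open>j0\<close> makes the dominant part of \<open>J'\<close>
  nonempty, hence the limit of the denominator positive.\<close>

lemma mean_f_tendsto:
  assumes J': "J' \<subseteq> J" and nd: "j0 \<in> J'" "m j0 = M" "df j0 \<noteq> 0"
    and on: "\<And>j. j \<in> J' \<Longrightarrow> f (a j) = f0"
    and off: "\<And>j. j \<in> J - J' \<Longrightarrow> t * (f (a j) - f0) < 0"
  shows "(\<lambda>n. real n powr \<theta> * (mean_f f g n (\<beta> + t * real n powr (\<theta> - 1)) - f0))
    \<longlonglongrightarrow> laplace_mixture.threshold (dominant J') m c df wt t"
proof -
  interpret mix: laplace_mixture "dominant J'" m c df wt
    by (rule dominant_mixture[OF J' nd])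
  have lip: "\<bar>f (real k / real n) - f0\<bar> \<le> K * \<bar>real k / real n - a j\<bar>" if "j \<in> J'" "1 \<le> n" "k \<le> n" for j n k
    unfolding on[OF that(1), symmetric] using that J' a_interior[of j] by (intro f_lipschitz) auto
  have num: "(\<lambda>n. tilt_sum t f0 (\<lambda>k. real n powr \<theta> * (f (real k / real n) - f0)) n)
      \<longlonglongrightarrow> (\<Sum>j\<in>dominant J'. wt j * (\<integral>y. W j t y * (df j * y) \<partial>lborel))"
    unfolding tilt_sum_def sum_laplace_limit[OF J', symmetric, of t "\<lambda>j y. df j * y"]
  proof (rule global_laplace[OF J', where C = K])
    fix n k :: nat assume nk: "1 \<le> n" "k \<le> n"
    have "\<bar>real k / real n - a j0\<bar> \<le> 1"
    proof -
      have "0 \<le> real k / real n" "real k / real n \<le> 1" using nk by auto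
      moreover have "0 < a j0" "a j0 < 1" using nd(1) J' a_interior by auto
      ultimately show ?thesis by linarith
    qed
    then have "K * \<bar>real k / real n - a j0\<bar> \<le> K"
      using K_nonneg by (simp add: mult_left_le)
    with lip[OF nd(1) nk] have "\<bar>f (real k / real n) - f0\<bar> \<le> K" by linarith
    then have "real n powr \<theta> * \<bar>f (real k / real n) - f0\<bar> \<le> real n powr \<theta> * K"
      by (intro mult_left_mono) auto
    then show "\<bar>real n powr \<theta> * (f (real k / real n) - f0)\<bar> \<le> K * (1 + real n powr \<theta>)"
      using K_nonneg by (simp add: abs_mult distrib_left mult.commute)
    fix j assume "j \<in> J'"
    have "real n powr \<theta> * \<bar>f (real k / real n) - f0\<bar> \<le> real n powr \<theta> * (K * \<bar>real k / real n - a j\<bar>)"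
      by (intro mult_left_mono lip \<open>j \<in> J'\<close> nk) auto
    then show "\<bar>real n powr \<theta> * (f (real k / real n) - f0)\<bar> \<le> K * (1 + real n powr \<theta> * \<bar>real k / real n - a j\<bar>)"
      using K_nonneg by (simp add: abs_mult distrib_left mult_ac)
  next
    fix j assume j: "j \<in> J'"
    then have "j \<in> J" using J' by auto
    then show "AE y in lborel. \<forall>k :: nat \<Rightarrow> nat. (\<lambda>n. real n powr \<theta> * (real (k n) / real n - a j)) \<longlonglongrightarrow> y \<longrightarrow>
        (\<lambda>n. real n powr \<theta> * (f (real (k n) / real n) - f0)) \<longlonglongrightarrow> df j * y"
      using local_tendsto(2)[of j] on[OF j] by auto
  qed (use on off K_nonneg in auto)
  have "(\<lambda>n. tilt_sum t f0 (\<lambda>_. 1) n) \<longlonglongrightarrow> (\<Sum>j\<in>dominant J'. wt j * (\<integral>y. W j t y * 1 \<partial>lborel))"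
    unfolding tilt_sum_def sum_laplace_limit[OF J', symmetric, of t "\<lambda>_ _. 1"]
    by (rule global_laplace[OF J', where C = 1]) (use on off in auto)
  then have den: "(\<lambda>n. tilt_sum t f0 (\<lambda>_. 1) n) \<longlonglongrightarrow> (\<Sum>j\<in>dominant J'. wt j * integral\<^sup>L lborel (W j t))"
    by (simp only: mult_1_right)
  have lim: "(\<lambda>n. tilt_sum t f0 (\<lambda>k. real n powr \<theta> * (f (real k / real n) - f0)) n / tilt_sum t f0 (\<lambda>_. 1) n)
    \<longlonglongrightarrow> mix.threshold t"
    unfolding mix.threshold_def by (intro tendsto_divide num den less_imp_neq[OF mix.mass_pos, symmetric])
  have den_pos: "\<forall>\<^sub>F n in sequentially. tilt_sum t f0 (\<lambda>_. 1) n > 0"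
    by (rule order_tendstoD(1)[OF den mix.mass_pos])
  show ?thesis
  proof (rule Lim_transform_eventually[OF lim])
    show "\<forall>\<^sub>F n in sequentially. tilt_sum t f0 (\<lambda>k. real n powr \<theta> * (f (real k / real n) - f0)) n / tilt_sum t f0 (\<lambda>_. 1) n
      = real n powr \<theta> * (mean_f f g n (\<beta> + t * real n powr (\<theta> - 1)) - f0)"
      using den_pos eventually_ge_at_top[of 1]
    proof eventually_elim
      case (elim n)
      have "tilt_sum t f0 (\<lambda>k. real n powr \<theta> * (f (real k / real n) - f0)) n
          = (\<Sum>k\<le>n. real n powr \<theta> * (V n k * exp (t * real n powr \<theta> * (f (real k / real n) - f0)) * f (real k / real n)
              - f0 * (V n k * exp (t * real n powr \<theta> * (f (real k / real n) - f0)) * 1)))"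
        unfolding tilt_sum_def by (intro sum.cong refl) (simp add: algebra_simps)
      also have "\<dots> = real n powr \<theta> * (tilt_sum t f0 (\<lambda>k. f (real k / real n)) n - f0 * tilt_sum t f0 (\<lambda>_. 1) n)"
        by (simp only: tilt_sum_def sum_subtractf flip: sum_distrib_left)
      finally have num_eq: "tilt_sum t f0 (\<lambda>k. real n powr \<theta> * (f (real k / real n) - f0)) n
          = real n powr \<theta> * (tilt_sum t f0 (\<lambda>k. f (real k / real n)) n - f0 * tilt_sum t f0 (\<lambda>_. 1) n)" .
      show ?case
        unfolding num_eq mean_f_eq grid_weight_ratio[OF elim(2), where ?f0.0 = f0]
        using elim(1) by (simp add: field_simps)
    qed
  qed
qed

text \<open>The untilted case with all maximizers retained. Events enter through their indicators,
  whose limit need only exist along sequences of grid points with a prescribed limit of the rescaled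
  variable.\<close>

lemma gibbs_event_tendsto:
  assumes lim: "\<And>j. j \<in> J \<Longrightarrow> AE y in lborel. \<forall>k :: nat \<Rightarrow> nat.
        (\<lambda>n. real n powr \<theta> * (real (k n) / real n - a j)) \<longlonglongrightarrow> y \<longrightarrow> (\<lambda>n. of_bool (P n (k n))) \<longlonglongrightarrow> h j y"
    and meas: "\<And>j. j \<in> J \<Longrightarrow> h j \<in> borel_measurable borel"
  shows "(\<lambda>n. measure (gibbs f g \<beta> n) {\<omega> \<in> spins n. P n (card {i \<in> {1..n}. \<omega> i = 1})})
    \<longlonglongrightarrow> (\<Sum>j\<in>dominant J. wt j * (\<integral>y. W j 0 y * h j y \<partial>lborel)) / (\<Sum>j\<in>dominant J. wt j * integral\<^sup>L lborel (W j 0))"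
proof -
  have num: "(\<lambda>n. tilt_sum 0 0 (\<lambda>k. of_bool (P n k)) n) \<longlonglongrightarrow> (\<Sum>j\<in>dominant J. wt j * (\<integral>y. W j 0 y * h j y \<partial>lborel))"
    unfolding tilt_sum_def sum_laplace_limit[OF order.refl, symmetric, of 0 h]
    by (rule global_laplace[OF order.refl, where C = 1]) (use lim meas in \<open>auto simp: of_bool_def\<close>)
  have "(\<lambda>n. tilt_sum 0 0 (\<lambda>_. 1) n) \<longlonglongrightarrow> (\<Sum>j\<in>dominant J. wt j * (\<integral>y. W j 0 y * 1 \<partial>lborel))"
    unfolding tilt_sum_def sum_laplace_limit[OF order.refl, symmetric, of 0 "\<lambda>_ _. 1"]
    by (rule global_laplace[OF order.refl, where C = 1]) auto
  then have den: "(\<lambda>n. tilt_sum 0 0 (\<lambda>_. 1) n) \<longlonglongrightarrow> (\<Sum>j\<in>dominant J. wt j * integral\<^sup>L lborel (W j 0))"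
    by (simp only: mult_1_right)
  have pos: "(\<Sum>j\<in>dominant J. wt j * integral\<^sup>L lborel (W j 0)) > 0"
    using finite_J M_attained by (intro sum_pos mult_pos_pos wt_pos laplace_weight_integral_pos m_bounds c_neg) auto
  have lim: "(\<lambda>n. tilt_sum 0 0 (\<lambda>k. of_bool (P n k)) n / tilt_sum 0 0 (\<lambda>_. 1) n)
    \<longlonglongrightarrow> (\<Sum>j\<in>dominant J. wt j * (\<integral>y. W j 0 y * h j y \<partial>lborel)) / (\<Sum>j\<in>dominant J. wt j * integral\<^sup>L lborel (W j 0))"
    by (intro tendsto_divide num den less_imp_neq[OF pos, symmetric])
  show ?thesis
  proof (rule Lim_transform_eventually[OF lim], rule eventually_sequentiallyI[of 1])
    fix n :: nat assume "1 \<le> n"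
    have "\<beta> + 0 * real n powr (\<theta> - 1) = \<beta>" by simp
    note grid_weight_ratio[where t = 0 and ?f0.0 = 0 and h = "\<lambda>k. of_bool (P n k)", OF \<open>1 \<le> n\<close>, unfolded this]
    then show "tilt_sum 0 0 (\<lambda>k. of_bool (P n k)) n / tilt_sum 0 0 (\<lambda>_. 1) n
      = measure (gibbs f g \<beta> n) {\<omega> \<in> spins n. P n (card {i \<in> {1..n}. \<omega> i = 1})}"
      unfolding measure_gibbs by (rule sym)
  qed
qed

text \<open>The event is decided by comparing \<open>f (k / n)\<close> with the shifted mean. For j
  in \<open>J'\<close> both equal \<open>f0\<close> up to order \<open>n powr (- \<theta>)\<close>,
  and the rescaled difference compares \<open>df j * y\<close> with T. For the other j the value
  tends to \<open>f (a j)\<close>, which lies strictly on the side of \<open>f0\<close> determined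
  by the sign of t.\<close>

lemma mle_event_tendsto:
  assumes J': "J' \<subseteq> J" and nd: "j0 \<in> J'" "m j0 = M" "df j0 \<noteq> 0"
    and on: "\<And>j. j \<in> J' \<Longrightarrow> f (a j) = f0"
    and off: "\<And>j. j \<in> J - J' \<Longrightarrow> t * (f (a j) - f0) < 0"
    and t: "t \<noteq> 0"
    and x12: "x1 \<in> {0..1}" "x2 \<in> {0..1}" "\<And>j. j \<in> J \<Longrightarrow> f x1 < f (a j)" "\<And>j. j \<in> J \<Longrightarrow> f (a j) < f x2"
  defines "T \<equiv> laplace_mixture.threshold (dominant J') m c df wt t"
  shows "(\<lambda>n. measure (gibbs f g \<beta> n) {\<omega> \<in> spins n. mle f g n \<omega> > \<beta> + t * real n powr (\<theta> - 1)})
    \<longlonglongrightarrow> (\<Sum>j\<in>dominant J. wt j * (\<integral>y. W j 0 y * (if j \<in> J' then of_bool (df j * y > T) else of_bool (t < 0)) \<partial>lborel))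
       / (\<Sum>j\<in>dominant J. wt j * integral\<^sup>L lborel (W j 0))"
proof -
  interpret mix: laplace_mixture "dominant J'" m c df wt
    by (rule dominant_mixture[OF J' nd])
  have T: "T \<noteq> 0" unfolding T_def using mix.threshold_pos[of t] mix.threshold_neg[of t] t by linarith
  let ?\<gamma> = "\<lambda>n. \<beta> + t * real n powr (\<theta> - 1)"
  define P where "P n k \<longleftrightarrow> (THE b. mean_f f g n b = f (real k / real n)) > ?\<gamma> n" for n k
  have mean: "(\<lambda>n. real n powr \<theta> * (mean_f f g n (?\<gamma> n) - f0)) \<longlonglongrightarrow> T"
    unfolding T_def by (rule mean_f_tendsto[OF J' nd on off])
  have "(\<lambda>n. 1 / real n powr \<theta>) \<longlonglongrightarrow> 0" using \<theta>_bounds by real_asymp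
  from tendsto_mult[OF mean this]
  have "(\<lambda>n. real n powr \<theta> * (mean_f f g n (?\<gamma> n) - f0) * (1 / real n powr \<theta>)) \<longlonglongrightarrow> 0" by simp
  moreover have "\<forall>\<^sub>F n in sequentially. real n powr \<theta> * (mean_f f g n (?\<gamma> n) - f0) * (1 / real n powr \<theta>) = mean_f f g n (?\<gamma> n) - f0"
    by (rule eventually_sequentiallyI[of 1]) simp
  ultimately have "(\<lambda>n. mean_f f g n (?\<gamma> n) - f0) \<longlonglongrightarrow> 0"
    by (rule Lim_transform_eventually)
  then have mean0: "(\<lambda>n. mean_f f g n (?\<gamma> n)) \<longlonglongrightarrow> f0" by (simp add: LIM_zero_iff)
  have f_cont: "continuous_on {0..1} f"
  proof (rule lipschitz_on_continuous_on)
    show "K-lipschitz_on {0..1} f"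
      by (rule lipschitz_onI) (use f_lipschitz K_nonneg in \<open>auto simp: dist_real_def\<close>)
  qed
  \<comment> \<open>The points \<open>x1\<close> and \<open>x2\<close> need not lie on any grid;
    rounding them down gives grid points at which f has nearly the same values.\<close>
  have grid: "(\<lambda>n. f (real (nat \<lfloor>real n * x\<rfloor>) / real n)) \<longlonglongrightarrow> f x" and grid_le: "nat \<lfloor>real n * x\<rfloor> \<le> n"
    if "x \<in> {0..1}" for x n
  proof -
    show le: "nat \<lfloor>real n * x\<rfloor> \<le> n" for n
      using that mult_left_le[of x "real n"] by (simp add: nat_le_iff floor_le_iff)
    have unit: "real k / real n \<in> {0..1}" if "k \<le> n" for k n :: nat
      using that by (auto simp: divide_le_eq_1)
    have "(\<lambda>n. real (nat \<lfloor>real n * x\<rfloor>) / real n) \<longlonglongrightarrow> x"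
    proof (rule real_tendsto_sandwich)
      show "\<forall>\<^sub>F n in sequentially. x - 1 / real n \<le> real (nat \<lfloor>real n * x\<rfloor>) / real n"
      proof (rule eventually_sequentiallyI[of 1])
        fix n :: nat assume n: "1 \<le> n"
        have "(real n * x - 1) / real n \<le> real (nat \<lfloor>real n * x\<rfloor>) / real n"
          by (intro divide_right_mono) linarith+
        with n show "x - 1 / real n \<le> real (nat \<lfloor>real n * x\<rfloor>) / real n"
          by (simp add: diff_divide_distrib)
      qed
      show "\<forall>\<^sub>F n in sequentially. real (nat \<lfloor>real n * x\<rfloor>) / real n \<le> x"
      proof (rule eventually_sequentiallyI[of 1])
        fix n :: nat assume n: "1 \<le> n"
        have "0 \<le> real n * x" using that by simp
        then have "real (nat \<lfloor>real n * x\<rfloor>) / real n \<le> (real n * x) / real n"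
          by (intro divide_right_mono) linarith+
        with n show "real (nat \<lfloor>real n * x\<rfloor>) / real n \<le> x" by simp
      qed
      show "(\<lambda>n. x - 1 / real n) \<longlonglongrightarrow> x" by real_asymp
    qed simp
    then show "(\<lambda>n. f (real (nat \<lfloor>real n * x\<rfloor>) / real n)) \<longlonglongrightarrow> f x"
      by (rule continuous_on_tendsto_compose[OF f_cont]) (use that unit[OF le] in \<open>auto simp only: intro!: always_eventually\<close>)
  qed
  \<comment> \<open>Near a maximizer the observed value is eventually strictly between two values of
    f on the grid, so the unspecified values of the estimator do not interfere.\<close>
  have iff: "\<forall>\<^sub>F n in sequentially. P n (k n) \<longleftrightarrow> mean_f f g n (?\<gamma> n) < f (real (k n) / real n)"
    if j: "j \<in> J" and l: "(\<lambda>n. f (real (k n) / real n)) \<longlonglongrightarrow> f (a j)" for j k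
  proof -
    have "\<forall>\<^sub>F n in sequentially. f (real (nat \<lfloor>real n * x1\<rfloor>) / real n) < f (real (k n) / real n)"
      using x12(3)[OF j] by (intro eventually_less_tendsto[OF grid[OF x12(1)] l])
    moreover have "\<forall>\<^sub>F n in sequentially. f (real (k n) / real n) < f (real (nat \<lfloor>real n * x2\<rfloor>) / real n)"
      using x12(4)[OF j] by (intro eventually_less_tendsto[OF l grid[OF x12(2)]])
    ultimately show ?thesis
      using eventually_ge_at_top[of 1]
    proof eventually_elim
      case (elim n)
      show ?case
        unfolding P_def by (rule mle_greater_iff[OF elim(3) grid_le[OF x12(1)] grid_le[OF x12(2)] elim(1,2)])
    qed
  qed
  have "(\<lambda>n. measure (gibbs f g \<beta> n) {\<omega> \<in> spins n. P n (card {i \<in> {1..n}. \<omega> i = 1})})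
    \<longlonglongrightarrow> (\<Sum>j\<in>dominant J. wt j * (\<integral>y. W j 0 y * (if j \<in> J' then of_bool (df j * y > T) else of_bool (t < 0)) \<partial>lborel))
       / (\<Sum>j\<in>dominant J. wt j * integral\<^sup>L lborel (W j 0))"
  proof (rule gibbs_event_tendsto[where P = P
        and h = "\<lambda>j y. if j \<in> J' then of_bool (df j * y > T) else of_bool (t < 0)"])
    fix j assume j: "j \<in> J"
    \<comment> \<open>Removes the boundary case \<open>df j * y = T\<close>. If
      \<open>df j = 0\<close> the quotient is 0 by convention and that case cannot occur, as T is
      nonzero.\<close>
    have "AE y in lborel. y \<noteq> T / df j" by (rule AE_lborel_singleton)
    then show "AE y in lborel. \<forall>k :: nat \<Rightarrow> nat. (\<lambda>n. real n powr \<theta> * (real (k n) / real n - a j)) \<longlonglongrightarrow> y \<longrightarrow>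
       (\<lambda>n. of_bool (P n (k n))) \<longlonglongrightarrow> (if j \<in> J' then of_bool (df j * y > T) else of_bool (t < 0) :: real)"
    proof (eventually_elim, intro allI impI)
      fix y k assume y: "y \<noteq> T / df j" and z: "(\<lambda>n. real n powr \<theta> * (real (k n) / real n - a j)) \<longlonglongrightarrow> y"
      note l = local_tendsto[OF j z]
      have "\<forall>\<^sub>F n in sequentially. P n (k n) \<longleftrightarrow> (if j \<in> J' then df j * y > T else t < 0)"
      proof (cases "j \<in> J'")
        case True
        have ne: "df j * y \<noteq> T" using y T by (auto simp: field_simps)
        have l2: "(\<lambda>n. real n powr \<theta> * (f (real (k n) / real n) - f0)) \<longlonglongrightarrow> df j * y"
          using l(2) on[OF True] by simp
        show ?thesis
        proof (cases "df j * y > T")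
          case *: True
          from eventually_less_tendsto[OF mean l2 this] iff[OF j l(1)] eventually_ge_at_top[of 1]
          show ?thesis by eventually_elim (use True * in auto)
        next
          case *: False
          with ne have "df j * y < T" by simp
          from eventually_less_tendsto[OF l2 mean this] iff[OF j l(1)] eventually_ge_at_top[of 1]
          show ?thesis by eventually_elim (use True * in auto)
        qed
      next
        case False
        then have o: "t * (f (a j) - f0) < 0" using off j by blast
        show ?thesis
        proof (cases "t < 0")
          case *: True
          then have "f0 < f (a j)" using o by (simp add: mult_less_0_iff)
          from eventually_less_tendsto[OF mean0 l(1) this] iff[OF j l(1)]
          show ?thesis by eventually_elim (use False * in auto)
        next
          case *: False
          then have "f (a j) < f0" using o by (auto simp: mult_less_0_iff)
          from eventually_less_tendsto[OF l(1) mean0 this] iff[OF j l(1)]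
          show ?thesis by eventually_elim (use False * in auto)
        qed
      qed
      then have "\<forall>\<^sub>F n in sequentially. (if j \<in> J' then of_bool (df j * y > T) else of_bool (t < 0)) = (of_bool (P n (k n)) :: real)"
        by eventually_elim auto
      then show "(\<lambda>n. of_bool (P n (k n))) \<longlonglongrightarrow> (if j \<in> J' then of_bool (df j * y > T) else of_bool (t < 0) :: real)"
        by (rule Lim_transform_eventually[OF tendsto_const])
    qed
    show "(\<lambda>y. if j \<in> J' then of_bool (df j * y > T) else of_bool (t < 0) :: real) \<in> borel_measurable borel"
      by (cases "j \<in> J'") simp_all
  qed
  moreover have "{\<omega> \<in> spins n. P n (card {i \<in> {1..n}. \<omega> i = 1})} = {\<omega> \<in> spins n. mle f g n \<omega> > ?\<gamma> n}" for n
    by (simp add: P_def mle_def plus_frac_def)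
  ultimately show ?thesis by simp
qed

end

section \<open>Laws with positive weights and the tails of the limit law\<close>

lemma
  assumes w [measurable]: "w \<in> borel_measurable borel" and pos: "\<And>y. w y > 0"
    and int: "integrable lborel w" and mass: "integral\<^sup>L lborel w > 0"
  shows integral_law_prop: "u \<in> borel_measurable borel \<Longrightarrow>
      integral\<^sup>L (law_prop w) u = (\<integral>y. w y * u y \<partial>lborel) / integral\<^sup>L lborel w"
    and measure_law_prop: "S \<in> sets borel \<Longrightarrow>
      measure (law_prop w) S = (\<integral>y. w y * indicator S y \<partial>lborel) / integral\<^sup>L lborel w"
    and real_distribution_law_prop: "real_distribution (law_prop w)"
    and isCont_cdf_law_prop: "isCont (cdf (law_prop w)) x"
proof -
  have I: "integral\<^sup>L (law_prop w) u = (\<integral>y. w y * u y \<partial>lborel) / integral\<^sup>L lborel w"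
    if [measurable]: "u \<in> borel_measurable borel" for u :: "real \<Rightarrow> real"
  proof -
    have "integral\<^sup>L (law_prop w) u = (\<integral>y. w y / integral\<^sup>L lborel w * u y \<partial>lborel)"
      unfolding law_prop_def using pos mass
      by (subst integral_density) (auto simp: less_imp_le)
    then show ?thesis by simp
  qed
  then show "u \<in> borel_measurable borel \<Longrightarrow>
      integral\<^sup>L (law_prop w) u = (\<integral>y. w y * u y \<partial>lborel) / integral\<^sup>L lborel w" .
  have [simp]: "space (law_prop w) = UNIV" "sets (law_prop w) = sets borel"
    by (simp_all add: law_prop_def)
  have Mm: "measure (law_prop w) S = (\<integral>y. w y * indicator S y \<partial>lborel) / integral\<^sup>L lborel w" if S: "S \<in> sets borel" for S
    using I[of "indicator S"] S by simp
  then show "S \<in> sets borel \<Longrightarrow>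
      measure (law_prop w) S = (\<integral>y. w y * indicator S y \<partial>lborel) / integral\<^sup>L lborel w" .
  have "measure (law_prop w) UNIV = 1"
    using Mm[of UNIV] mass by simp
  then have "prob_space (law_prop w)"
    by (intro prob_spaceI) (simp add: Sigma_Algebra.measure_def)
  then interpret prob_space "law_prop w" .
  show rd: "real_distribution (law_prop w)"
    by unfold_locales simp_all
  interpret real_distribution "law_prop w" by (rule rd)
  have "(\<integral>y. w y * indicator {x} y \<partial>lborel) = 0"
    using AE_lborel_singleton[of x] by (intro integral_eq_zero_AE) (auto elim!: eventually_mono)
  then show "isCont (cdf (law_prop w)) x"
    unfolding isCont_cdf by (simp add: Mm)
qed

lemma law_prop_even_half:
  assumes w [measurable]: "w \<in> borel_measurable borel" and pos: "\<And>y. w y > 0"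
    and int: "integrable lborel w" and mass: "integral\<^sup>L lborel w > 0"
    and even: "\<And>y. w (- y) = w y"
  shows "measure (law_prop w) {..0} = 1/2" "measure (law_prop w) {0<..} = 1/2"
proof -
  interpret real_distribution "law_prop w"
    by (rule real_distribution_law_prop[OF assms(1-4)])
  have "{..0::real} = {0} \<union> {..<0}" by auto
  have z: "measure (law_prop w) {0} = 0"
    using isCont_cdf_law_prop[OF assms(1-4), of 0] by (simp add: isCont_cdf)
  have "measure (law_prop w) {..0} = measure (law_prop w) {0} + measure (law_prop w) {..<0}"
    unfolding \<open>{..0::real} = {0} \<union> {..<0}\<close> by (rule finite_measure_Union) auto
  moreover have "measure (law_prop w) {..<0} = measure (law_prop w) {0<..}"
    using integral_reflect_lborel[of "\<lambda>y. w y * indicator {..<0} y"]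
    by (simp add: measure_law_prop[OF assms(1-4)] even indicator_def)
  moreover have "measure (law_prop w) {..0} + measure (law_prop w) {0<..} = 1"
  proof -
    have "measure (law_prop w) ({..0} \<union> {0<..}) = measure (law_prop w) {..0} + measure (law_prop w) {0<..}"
      by (rule finite_measure_Union) auto
    moreover have "{..0} \<union> {0<..} = (UNIV :: real set)" by auto
    ultimately show ?thesis using prob_space by simp
  qed
  ultimately show "measure (law_prop w) {..0} = 1/2" "measure (law_prop w) {0<..} = 1/2"
    using z by linarith+
qed

lemma (in real_distribution) measure_greaterThan: "measure M {x<..} = 1 - cdf M x"
proof -
  have "UNIV - {..x} = {x<..}" by auto
  then show ?thesis using prob_compl[of "{..x}"] by (simp add: cdf_def)
qed

context laplace_mixture
begin

lemma W0_law:
  assumes "j \<in> I"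
  shows "real_distribution (law_prop (W j 0))"
    and "isCont (cdf (law_prop (W j 0))) x"
    and "measure (law_prop (W j 0)) {..0} = 1/2" "measure (law_prop (W j 0)) {0<..} = 1/2"
    and "S \<in> sets borel \<Longrightarrow> integral\<^sup>L lborel (W j 0) * measure (law_prop (W j 0)) S = (\<integral>y. W j 0 y * indicator S y \<partial>lborel)"
proof -
  note A = laplace_weight_measurable[of "m j" "c j" "d j" 0] laplace_weight_pos[of "m j" "c j" "d j" 0]
    integrable_laplace_weight[OF m_pos[OF assms] c_neg[OF assms], of "d j" 0]
    laplace_weight_integral_pos[OF m_pos[OF assms] c_neg[OF assms], of "d j" 0]
  show "real_distribution (law_prop (W j 0))" by (rule real_distribution_law_prop[OF A])
  show "isCont (cdf (law_prop (W j 0))) x" by (rule isCont_cdf_law_prop[OF A])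
  have "W j 0 (- y) = W j 0 y" for y by (simp add: laplace_weight_reflect)
  from law_prop_even_half[OF A this]
  show "measure (law_prop (W j 0)) {..0} = 1/2" "measure (law_prop (W j 0)) {0<..} = 1/2" by auto
  show "integral\<^sup>L lborel (W j 0) * measure (law_prop (W j 0)) S = (\<integral>y. W j 0 y * indicator S y \<partial>lborel)" if "S \<in> sets borel"
    using measure_law_prop[OF A that] A(4) by simp
qed

text \<open>
  One tail function of the limit law; \<open>R\<close> is \<open>atMost\<close> for the lower and \<open>greaterThan\<close> for the
  upper tail.
\<close>
definition tail :: "real \<Rightarrow> (real \<Rightarrow> real set) \<Rightarrow> real \<Rightarrow> real" where
  "tail Z R t = (\<Sum>j\<in>I. v j * integral\<^sup>L lborel (W j 0) / Z * of_bool (d j \<noteq> 0)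
     * measure (law_prop (W j 0)) (R (threshold t / \<bar>d j\<bar>)))"

text \<open>The threshold vanishes at t = 0 and the untilted law is symmetric without atoms, so
  every index with nonzero \<open>d j\<close> contributes half its weight. This is the origin of the
  factor 1/2 in the atom of the limit law.\<close>

lemma tail_0:
  shows "tail Z atMost 0 = 1/2 * (\<Sum>j\<in>I. v j * integral\<^sup>L lborel (W j 0) / Z * of_bool (d j \<noteq> 0))"
    and "tail Z greaterThan 0 = 1/2 * (\<Sum>j\<in>I. v j * integral\<^sup>L lborel (W j 0) / Z * of_bool (d j \<noteq> 0))"
  unfolding tail_def threshold_0 sum_distrib_left by (auto intro!: sum.cong simp: W0_law)

text \<open>Continuity of the threshold is composed with that of the distribution function. For
  \<open>d j = 0\<close> the argument is a division by zero, but the factor \<open>of_bool\<close>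
  removes the term.\<close>

lemma isCont_tail:
  shows "isCont (tail Z atMost) t" and "isCont (tail Z greaterThan) t"
proof -
  have c: "isCont (\<lambda>t. cdf (law_prop (W j 0)) (threshold t / \<bar>d j\<bar>)) t" if "j \<in> I" "d j \<noteq> 0" for j
    by (rule isCont_o2[OF _ W0_law(2)[OF that(1)]]) (use that in \<open>intro continuous_intros isCont_threshold, auto\<close>)
  have m: "isCont (\<lambda>t. of_bool (d j \<noteq> 0) * measure (law_prop (W j 0)) {..threshold t / \<bar>d j\<bar>}) t"
    "isCont (\<lambda>t. of_bool (d j \<noteq> 0) * measure (law_prop (W j 0)) {threshold t / \<bar>d j\<bar><..}) t" if j: "j \<in> I" for j
  proof -
    interpret real_distribution "law_prop (W j 0)" by (rule W0_law(1)[OF j])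
    show "isCont (\<lambda>t. of_bool (d j \<noteq> 0) * measure (law_prop (W j 0)) {..threshold t / \<bar>d j\<bar>}) t"
      using c[OF j] by (cases "d j = 0") (simp_all add: cdf_def)
    show "isCont (\<lambda>t. of_bool (d j \<noteq> 0) * measure (law_prop (W j 0)) {threshold t / \<bar>d j\<bar><..}) t"
      using c[OF j] by (cases "d j = 0") (simp_all add: measure_greaterThan)
  qed
  show "isCont (tail Z atMost) t" and "isCont (tail Z greaterThan) t"
    unfolding tail_def[abs_def] mult.assoc by (intro continuous_intros m; assumption)+
qed

lemma tail_at_top: "((tail Z greaterThan) \<longlongrightarrow> 0) at_top"
proof -
  have "((\<lambda>t. of_bool (d j \<noteq> 0) * measure (law_prop (W j 0)) {threshold t / \<bar>d j\<bar><..}) \<longlongrightarrow> 0) at_top" if j: "j \<in> I" for j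
  proof (cases "d j = 0")
    case False
    interpret real_distribution "law_prop (W j 0)" by (rule W0_law(1)[OF j])
    have "filterlim (\<lambda>t. 1 / \<bar>d j\<bar> * threshold t) at_top at_top"
      by (rule filterlim_tendsto_pos_mult_at_top[OF tendsto_const _ threshold_at_top]) (use False in simp)
    then have "filterlim (\<lambda>t. threshold t / \<bar>d j\<bar>) at_top at_top" by simp
    from filterlim_compose[OF cdf_lim_at_top_prob this]
    have "((\<lambda>t. 1 - cdf (law_prop (W j 0)) (threshold t / \<bar>d j\<bar>)) \<longlongrightarrow> 1 - 1) at_top"
      by (intro tendsto_diff tendsto_const)
    with False show ?thesis by (simp add: measure_greaterThan)
  qed simp
  then have "((tail Z greaterThan) \<longlongrightarrow> (\<Sum>j\<in>I. v j * integral\<^sup>L lborel (W j 0) / Z * 0)) at_top"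
    unfolding tail_def[abs_def] mult.assoc by (intro tendsto_sum tendsto_mult tendsto_const)
  then show ?thesis by simp
qed

lemma tail_at_bot: "((tail Z atMost) \<longlongrightarrow> 0) at_bot"
proof -
  have "((\<lambda>t. of_bool (d j \<noteq> 0) * measure (law_prop (W j 0)) {..threshold t / \<bar>d j\<bar>}) \<longlongrightarrow> 0) at_bot" if j: "j \<in> I" for j
  proof (cases "d j = 0")
    case False
    interpret real_distribution "law_prop (W j 0)" by (rule W0_law(1)[OF j])
    have "filterlim (\<lambda>t. - threshold (- t)) at_bot at_bot"
      unfolding filterlim_uminus_at_bot minus_minus
      by (rule filterlim_compose[OF threshold_at_top filterlim_uminus_at_top_at_bot])
    then have "filterlim threshold at_bot at_bot" by (simp add: threshold_uminus)
    then have "filterlim (\<lambda>t. 1 / \<bar>d j\<bar> * threshold t) at_bot at_bot"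
      by (intro filterlim_tendsto_pos_mult_at_bot[OF tendsto_const]) (use False in simp)
    then have "filterlim (\<lambda>t. threshold t / \<bar>d j\<bar>) at_bot at_bot" by simp
    from filterlim_compose[OF cdf_lim_at_bot this] False show ?thesis by (simp add: cdf_def)
  qed simp
  then have "((tail Z atMost) \<longlongrightarrow> (\<Sum>j\<in>I. v j * integral\<^sup>L lborel (W j 0) / Z * 0)) at_bot"
    unfolding tail_def[abs_def] mult.assoc by (intro tendsto_sum tendsto_mult tendsto_const)
  then show ?thesis by simp
qed

end

text \<open>Nothing is known about the distribution functions at 0 itself. The value of the
  candidate F there is forced by right-continuity, and the jump between its two branches becomes the
  atom.\<close>

lemma weak_limit_from_tails:
  fixes M :: "nat \<Rightarrow> real measure" and Gm Gp :: "real \<Rightarrow> real"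
  assumes M: "\<And>n. real_distribution (M n)"
    and lo: "\<And>t. t < 0 \<Longrightarrow> (\<lambda>n. measure (M n) {..t}) \<longlonglongrightarrow> Gm t"
    and up: "\<And>t. t > 0 \<Longrightarrow> (\<lambda>n. measure (M n) {t<..}) \<longlonglongrightarrow> Gp t"
    and cont: "\<And>t. isCont Gm t" "\<And>t. isCont Gp t"
    and tails: "(Gm \<longlongrightarrow> 0) at_bot" "(Gp \<longlongrightarrow> 0) at_top"
  obtains U where "real_distribution U" "\<And>t. t < 0 \<Longrightarrow> measure U {..t} = Gm t"
    "\<And>t. t > 0 \<Longrightarrow> measure U {t<..} = Gp t" "measure U {0} = 1 - (Gp 0 + Gm 0)" "weak_conv_m M U"
proof -
  define F where "F t = (if t < 0 then Gm t else 1 - Gp t)" for t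
  have lim: "(\<lambda>n. cdf (M n) t) \<longlonglongrightarrow> F t" if "t \<noteq> 0" for t
  proof (cases "t < 0")
    case True
    with lo[OF True] show ?thesis by (simp add: F_def cdf_def)
  next
    case False
    with that have "t > 0" by simp
    have "(\<lambda>n. 1 - measure (M n) {t<..}) \<longlonglongrightarrow> 1 - Gp t"
      by (intro tendsto_intros up \<open>t > 0\<close>)
    with False show ?thesis
      by (simp add: F_def real_distribution.measure_greaterThan[OF M])
  qed
  \<comment> \<open>\<open>Gm\<close> and \<open>Gp\<close> are not assumed monotone, nor ordered
    across 0; away from 0 both properties are inherited from the distribution functions converging
    to F.\<close>
  have mono0: "F s \<le> F t" if "s \<noteq> 0" "t \<noteq> 0" "s \<le> t" for s t
    by (rule LIMSEQ_le[OF lim[OF that(1)] lim[OF that(2)]])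
      (use that(3) M in \<open>auto intro!: finite_borel_measure.cdf_nondecreasing real_distribution.finite_borel_measure_M\<close>)
  have right: "(F \<longlongrightarrow> F t) (at_right t)" for t
  proof (cases "t < 0")
    case True
    have "\<forall>\<^sub>F x in at_right t. Gm x = F x"
      using eventually_at_right_real[OF True] by eventually_elim (auto simp: F_def)
    moreover have "(Gm \<longlongrightarrow> F t) (at_right t)"
      using cont(1)[of t] True by (auto simp: F_def isCont_def intro: tendsto_within_subset)
    ultimately show ?thesis by (rule Lim_transform_eventually[rotated])
  next
    case False
    have "\<forall>\<^sub>F x in at_right t. 1 - Gp x = F x"
      using eventually_at_right_less[of t] by eventually_elim (use False in \<open>auto simp: F_def\<close>)
    moreover have "(Gp \<longlongrightarrow> Gp t) (at_right t)"
      using cont(2)[of t] by (auto simp: isCont_def intro: tendsto_within_subset)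
    then have "((\<lambda>x. 1 - Gp x) \<longlongrightarrow> F t) (at_right t)"
      using False by (auto simp: F_def intro!: tendsto_intros)
    ultimately show ?thesis by (rule Lim_transform_eventually[rotated])
  qed
  have mono: "F s \<le> F t" if st: "s \<le> t" for s t
  proof -
    consider "s = t" | "s \<noteq> 0" "t \<noteq> 0" | "s = 0" "0 < t" | "s < 0" "t = 0" using st by fastforce
    then show ?thesis
    proof cases
      case 3
      have "\<forall>\<^sub>F x in at_right 0. F x \<le> F t"
        using eventually_at_right_real[OF 3(2)] by eventually_elim (auto intro: mono0)
      with right[of 0] 3(1) show ?thesis by (auto intro: tendsto_upperbound)
    next
      case 4
      have "\<forall>\<^sub>F x in at_right 0. F s \<le> F x"
        using eventually_at_right_less[of 0] by eventually_elim (use 4 in \<open>auto intro: mono0\<close>)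
      with right[of 0] 4(2) show ?thesis by (auto intro: tendsto_lowerbound)
    qed (auto intro: mono0 st)
  qed
  have "\<forall>\<^sub>F t in at_bot. Gm t = F t"
    unfolding eventually_at_bot_dense by (rule exI[of _ 0]) (simp add: F_def)
  with tails(1) have bot: "(F \<longlongrightarrow> 0) at_bot"
    by (rule Lim_transform_eventually)
  have top: "(F \<longlongrightarrow> 1) at_top"
  proof -
    have "((\<lambda>t. 1 - Gp t) \<longlongrightarrow> 1 - 0) at_top" by (intro tendsto_intros tails)
    moreover have "\<forall>\<^sub>F t in at_top. 1 - Gp t = F t"
      unfolding eventually_at_top_linorder by (rule exI[of _ 0]) (simp add: F_def)
    ultimately have "(F \<longlongrightarrow> 1 - 0) at_top"
      by (rule Lim_transform_eventually)
    then show ?thesis by simp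
  qed
  define U where "U = interval_measure F"
  have rcont: "continuous (at_right t) F" for t using right[of t] by (simp add: continuous_within)
  have U: "real_distribution U"
    unfolding U_def by (rule real_distribution_interval_measure[OF mono rcont bot top])
  interpret real_distribution U by (rule U)
  have cdfU: "cdf U = F" unfolding U_def by (rule cdf_interval_measure[OF mono rcont bot])
  show thesis
  proof (rule that[OF U])
    show "measure U {..t} = Gm t" if "t < 0" for t
      using that fun_cong[OF cdfU, of t] by (simp add: cdf_def F_def)
    show "measure U {t<..} = Gp t" if "t > 0" for t
      using that by (simp add: measure_greaterThan cdfU F_def)
    have "{..0::real} = {0} \<union> {..<0}" by auto
    then have "cdf U 0 = measure U {0} + measure U {..<0}"
      unfolding cdf_def by (subst finite_measure_Union[symmetric]) auto
    \<comment> \<open>The left limit of F at 0; the atom is the jump from here to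
      \<open>F 0 = 1 - Gp 0\<close>.\<close>
    moreover have "measure U {..<0} = Gm 0"
    proof (rule tendsto_unique[OF trivial_limit_at_left_real cdf_at_left])
      have "(Gm \<longlongrightarrow> Gm 0) (at_left 0)"
        using cont(1)[of 0] by (auto simp: isCont_def intro: tendsto_within_subset)
      moreover have "\<forall>\<^sub>F x in at_left 0. Gm x = cdf U x"
        unfolding cdfU by (auto simp: F_def eventually_at_filter)
      ultimately show "(cdf U \<longlongrightarrow> Gm 0) (at_left 0)"
        by (rule Lim_transform_eventually)
    qed
    ultimately show "measure U {0} = 1 - (Gp 0 + Gm 0)"
      by (simp add: cdfU F_def)
    show "weak_conv_m M U"
      unfolding weak_conv_m_def weak_conv_def
    proof (intro allI impI)
      fix x assume x: "isCont (cdf U) x"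
      show "(\<lambda>n. cdf (M n) x) \<longlonglongrightarrow> cdf U x"
      proof (cases "x = 0")
        case True
        \<comment> \<open>Convergence at 0 is required only if F is continuous there. The value at 0
          is then squeezed between values at nearby points on either side, where convergence is
          known.\<close>
        have F0: "(F \<longlongrightarrow> F 0) (at_left 0)" "(F \<longlongrightarrow> F 0) (at_right 0)"
          using x True by (auto simp: cdfU isCont_def intro: tendsto_within_subset)
        have nd: "cdf (M n) s \<le> cdf (M n) t" if "s \<le> t" for n s t
          using that M by (auto intro!: finite_borel_measure.cdf_nondecreasing real_distribution.finite_borel_measure_M)
        have "(\<lambda>n. cdf (M n) 0) \<longlonglongrightarrow> F 0"
        proof (rule order_tendstoI)
          fix b assume "b < F 0"
          then have "\<forall>\<^sub>F s in at_left 0. b < F s" using order_tendstoD(1)[OF F0(1)] by blast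
          moreover have "\<forall>\<^sub>F s in at_left 0. s < (0::real)" by (simp add: eventually_at_filter)
          ultimately have "\<forall>\<^sub>F s in at_left 0. b < F s \<and> s < 0" by eventually_elim simp
          then obtain s where s: "b < F s" "s < 0"
            using eventually_happens'[OF trivial_limit_at_left_real] by blast
          then have "\<forall>\<^sub>F n in sequentially. b < cdf (M n) s" by (intro order_tendstoD(1)[OF lim]) auto
          then show "\<forall>\<^sub>F n in sequentially. b < cdf (M n) 0"
            by eventually_elim (use nd s(2) in \<open>meson less_imp_le less_le_trans\<close>)
        next
          fix b assume "F 0 < b"
          then have "\<forall>\<^sub>F s in at_right 0. F s < b" using order_tendstoD(2)[OF F0(2)] by blast
          moreover have "\<forall>\<^sub>F s in at_right 0. (0::real) < s" by (simp add: eventually_at_filter)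
          ultimately have "\<forall>\<^sub>F s in at_right 0. F s < b \<and> 0 < s" by eventually_elim simp
          then obtain s where s: "F s < b" "0 < s"
            using eventually_happens'[OF trivial_limit_at_right_real] by blast
          then have "\<forall>\<^sub>F n in sequentially. cdf (M n) s < b" by (intro order_tendstoD(2)[OF lim]) auto
          then show "\<forall>\<^sub>F n in sequentially. cdf (M n) 0 < b"
            by eventually_elim (use nd s(2) in \<open>meson less_imp_le le_less_trans\<close>)
        qed
        with True show ?thesis by (simp add: cdfU)
      qed (simp add: cdfU lim)
    qed
  qed
qed

text \<open>A nonzero derivative at an interior point produces smaller values on one side and larger
  ones on the other. At the maximizers with extreme f this supplies the points \<open>x1\<close> and
  \<open>x2\<close> that make the likelihood equation solvable.\<close>

lemma nonzero_derivative_not_extremal: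
  fixes f :: "real \<Rightarrow> real"
  assumes "(f has_real_derivative l) (at x)" "l \<noteq> 0" "0 < x" "x < 1"
  shows "\<exists>y\<in>{0..1}. f y < f x" "\<exists>y\<in>{0..1}. f x < f y"
proof -
  have 1: "\<exists>y\<in>{0..1}. f y < f x" if "(f has_real_derivative l) (at x)" "l \<noteq> 0" for f :: "real \<Rightarrow> real" and l
  proof (cases "l > 0")
    case True
    from DERIV_pos_inc_left[OF that(1) this] obtain d where d: "d > 0" "\<And>h. h > 0 \<Longrightarrow> h < d \<Longrightarrow> f (x - h) < f x"
      by blast
    have "f (x - min (d / 2) x) < f x" using d(1) assms by (intro d(2)) auto
    moreover have "x - min (d / 2) x \<in> {0..1}" using d(1) assms by auto
    ultimately show ?thesis by blast
  next
    case False
    with that have "l < 0" by simp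
    from DERIV_neg_dec_right[OF that(1) this] obtain d where d: "d > 0" "\<And>h. h > 0 \<Longrightarrow> h < d \<Longrightarrow> f (x + h) < f x"
      by blast
    have "f (x + min (d / 2) (1 - x)) < f x" using d(1) assms by (intro d(2)) auto
    moreover have "x + min (d / 2) (1 - x) \<in> {0..1}" using d(1) assms by auto
    ultimately show ?thesis by blast
  qed
  show "\<exists>y\<in>{0..1}. f y < f x" by (rule 1[OF assms(1,2)])
  show "\<exists>y\<in>{0..1}. f x < f y" using 1[OF DERIV_minus[OF assms(1)]] assms(2) by auto
qed

section \<open>Explicit tails of the estimator\<close>

context linear_model
begin

definition total_mass :: real where
  "total_mass = (\<Sum>j\<in>dominant J. wt j * integral\<^sup>L lborel (W j 0))"

lemma total_mass_pos: "total_mass > 0"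
  unfolding total_mass_def using finite_J M_attained
  by (intro sum_pos mult_pos_pos wt_pos laplace_weight_integral_pos m_bounds c_neg) auto

text \<open>For negative \<open>df j\<close> the reflection of y, which leaves the untilted weight
  invariant, turns the half line around; hence only \<open>\<bar>df j\<bar>\<close> appears. For
  \<open>df j = 0\<close> the condition reads T < 0 or 0 \<le> T with the opposite sign of T, so the
  integral is 0.\<close>

lemma integral_half_line:
  assumes "j \<in> J" "T \<noteq> 0"
  shows "T > 0 \<Longrightarrow> (\<integral>y. W j 0 y * of_bool (df j * y > T) \<partial>lborel)
      = of_bool (df j \<noteq> 0) * (\<integral>y. W j 0 y * indicator {T / \<bar>df j\<bar><..} y \<partial>lborel)"
    and "T < 0 \<Longrightarrow> (\<integral>y. W j 0 y * of_bool (df j * y \<le> T) \<partial>lborel)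
      = of_bool (df j \<noteq> 0) * (\<integral>y. W j 0 y * indicator {..T / \<bar>df j\<bar>} y \<partial>lborel)"
proof -
  have r: "W j 0 (- y) = W j 0 y" for y by (simp add: laplace_weight_reflect)
  consider "df j = 0" | "df j > 0" | "df j < 0" by linarith
  then have "(T > 0 \<longrightarrow> (\<integral>y. W j 0 y * of_bool (df j * y > T) \<partial>lborel)
      = of_bool (df j \<noteq> 0) * (\<integral>y. W j 0 y * indicator {T / \<bar>df j\<bar><..} y \<partial>lborel))
    \<and> (T < 0 \<longrightarrow> (\<integral>y. W j 0 y * of_bool (df j * y \<le> T) \<partial>lborel)
      = of_bool (df j \<noteq> 0) * (\<integral>y. W j 0 y * indicator {..T / \<bar>df j\<bar>} y \<partial>lborel))"
  proof cases
    case 2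
    then have "of_bool (df j * y > T) = (indicator {T / \<bar>df j\<bar><..} y :: real)"
      "of_bool (df j * y \<le> T) = (indicator {..T / \<bar>df j\<bar>} y :: real)" for y
      by (auto simp: indicator_def field_simps)
    with 2 show ?thesis by simp
  next
    case 3
    then have "of_bool (df j * - y > T) = (indicator {T / \<bar>df j\<bar><..} y :: real)"
      "of_bool (df j * - y \<le> T) = (indicator {..T / \<bar>df j\<bar>} y :: real)" for y
      by (auto simp: indicator_def field_simps)
    with 3 show ?thesis
      using integral_reflect_lborel[of "\<lambda>y. W j 0 y * of_bool (df j * y > T)"]
        integral_reflect_lborel[of "\<lambda>y. W j 0 y * of_bool (df j * y \<le> T)"]
      by (simp add: r)
  next
    case 1
    then have "T > 0 \<Longrightarrow> of_bool (df j * y > T) = (0 :: real)" "T < 0 \<Longrightarrow> of_bool (df j * y \<le> T) = (0 :: real)" for y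
      by simp_all
    with 1 show ?thesis by (simp only: mult_zero_right Bochner_Integration.integral_zero) simp
  qed
  then show "T > 0 \<Longrightarrow> (\<integral>y. W j 0 y * of_bool (df j * y > T) \<partial>lborel)
      = of_bool (df j \<noteq> 0) * (\<integral>y. W j 0 y * indicator {T / \<bar>df j\<bar><..} y \<partial>lborel)"
    and "T < 0 \<Longrightarrow> (\<integral>y. W j 0 y * of_bool (df j * y \<le> T) \<partial>lborel)
      = of_bool (df j \<noteq> 0) * (\<integral>y. W j 0 y * indicator {..T / \<bar>df j\<bar>} y \<partial>lborel)"
    by auto
qed

context
  fixes J' :: "'j set" and j0 and f0 x1 x2 :: real
  assumes J': "J' \<subseteq> J" and nd: "j0 \<in> J'" "m j0 = M" "df j0 \<noteq> 0"
    and on: "\<And>j. j \<in> J' \<Longrightarrow> f (a j) = f0"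
    and x12: "x1 \<in> {0..1}" "x2 \<in> {0..1}" "\<And>j. j \<in> J \<Longrightarrow> f x1 < f (a j)" "\<And>j. j \<in> J \<Longrightarrow> f (a j) < f x2"
begin

interpretation mix: laplace_mixture "dominant J'" m c df wt
  by (rule dominant_mixture[OF J' nd])

lemma upper_tail_tendsto:
  assumes off: "\<And>j. j \<in> J - J' \<Longrightarrow> f (a j) < f0" and t: "t > 0"
  shows "(\<lambda>n. measure (gibbs f g \<beta> n) {\<omega> \<in> spins n. mle f g n \<omega> > \<beta> + t * real n powr (\<theta> - 1)})
    \<longlonglongrightarrow> laplace_mixture.tail (dominant J') m c df wt total_mass greaterThan t"
proof -
  let ?T = "mix.threshold t"
  have T: "?T > 0" using mix.threshold_pos[OF t] .
  have off': "t * (f (a j) - f0) < 0" if "j \<in> J - J'" for j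
    using off[OF that] t by (simp add: mult_less_0_iff)
  \<comment> \<open>For t > 0 the limiting indicator is 0 at every maximizer outside
    \<open>J'\<close>.\<close>
  have restrict_sum: "(\<Sum>j\<in>dominant J. wt j * (\<integral>y. W j 0 y * (if j \<in> J' then of_bool (df j * y > ?T) else of_bool (t < 0)) \<partial>lborel))
    = (\<Sum>j\<in>dominant J'. wt j * (\<integral>y. W j 0 y * of_bool (df j * y > ?T) \<partial>lborel))"
  proof (rule sum.mono_neutral_cong_right)
    show "\<forall>j\<in>dominant J - dominant J'. wt j * (\<integral>y. W j 0 y * (if j \<in> J' then of_bool (df j * y > ?T) else of_bool (t < 0)) \<partial>lborel) = 0"
    proof
      fix j assume "j \<in> dominant J - dominant J'"
      then have "j \<notin> J'" by auto
      with t show "wt j * (\<integral>y. W j 0 y * (if j \<in> J' then of_bool (df j * y > ?T) else of_bool (t < 0)) \<partial>lborel) = 0"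
        by simp
    qed
    show "finite (dominant J)" using finite_J by simp
    show "dominant J' \<subseteq> dominant J" using J' by blast
    fix j assume "j \<in> dominant J'"
    then have "j \<in> J'" by simp
    then show "wt j * (\<integral>y. W j 0 y * (if j \<in> J' then of_bool (df j * y > ?T) else of_bool (t < 0)) \<partial>lborel)
        = wt j * (\<integral>y. W j 0 y * of_bool (df j * y > ?T) \<partial>lborel)"
      by (simp only: if_True)
  qed
  have eq: "(\<Sum>j\<in>dominant J. wt j * (\<integral>y. W j 0 y * (if j \<in> J' then of_bool (df j * y > ?T) else of_bool (t < 0)) \<partial>lborel))
    / total_mass = mix.tail total_mass greaterThan t"
    unfolding restrict_sum mix.tail_def sum_divide_distrib
  proof (intro sum.cong refl)
    fix j assume j: "j \<in> dominant J'"
    then have "j \<in> J" using J' by auto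
    then have "(\<integral>y. W j 0 y * of_bool (df j * y > ?T) \<partial>lborel)
      = of_bool (df j \<noteq> 0) * (\<integral>y. W j 0 y * indicator {?T / \<bar>df j\<bar><..} y \<partial>lborel)"
      by (rule integral_half_line(1)[OF _ less_imp_neq[OF T, symmetric] T])
    also have "(\<integral>y. W j 0 y * indicator {?T / \<bar>df j\<bar><..} y \<partial>lborel)
      = integral\<^sup>L lborel (W j 0) * measure (law_prop (W j 0)) {?T / \<bar>df j\<bar><..}"
      by (rule mix.W0_law(5)[OF j, symmetric]) simp
    finally have e: "(\<integral>y. W j 0 y * of_bool (df j * y > ?T) \<partial>lborel) =
      of_bool (df j \<noteq> 0) * (integral\<^sup>L lborel (W j 0) * measure (law_prop (W j 0)) {?T / \<bar>df j\<bar><..})" .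
    show "wt j * (\<integral>y. W j 0 y * of_bool (df j * y > ?T) \<partial>lborel) / total_mass =
      wt j * integral\<^sup>L lborel (W j 0) / total_mass * of_bool (df j \<noteq> 0) * measure (law_prop (W j 0)) {?T / \<bar>df j\<bar><..}"
      unfolding e by (simp only: mult_ac times_divide_eq_left times_divide_eq_right)
  qed
  have "t \<noteq> 0" using t by simp
  from mle_event_tendsto[OF J' nd on off' this x12] show ?thesis
    unfolding total_mass_def[symmetric] eq .
qed

lemma lower_tail_tendsto:
  assumes off: "\<And>j. j \<in> J - J' \<Longrightarrow> f (a j) > f0" and t: "t < 0"
  shows "(\<lambda>n. measure (gibbs f g \<beta> n) {\<omega> \<in> spins n. mle f g n \<omega> \<le> \<beta> + t * real n powr (\<theta> - 1)})
    \<longlonglongrightarrow> laplace_mixture.tail (dominant J') m c df wt total_mass atMost t"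
proof -
  let ?T = "mix.threshold t"
  have T: "?T < 0" using mix.threshold_neg[OF t] .
  have off': "t * (f (a j) - f0) < 0" if "j \<in> J - J'" for j
    using off[OF that] t by (simp add: mult_less_0_iff)
  let ?u = "\<lambda>j y. if j \<in> J' then of_bool (df j * y > ?T) else of_bool (t < 0) :: real"
  \<comment> \<open>The limit for the upper event is complemented. For t < 0 the indicator is 1 at
    every maximizer outside \<open>J'\<close>, so these contributions cancel against the total mass
    and only \<open>J'\<close> remains.\<close>
  have "total_mass - (\<Sum>j\<in>dominant J. wt j * (\<integral>y. W j 0 y * ?u j y \<partial>lborel))
      = (\<Sum>j\<in>dominant J. wt j * (integral\<^sup>L lborel (W j 0) - (\<integral>y. W j 0 y * ?u j y \<partial>lborel)))"
    by (simp add: total_mass_def right_diff_distrib sum_subtractf)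
  also have "\<dots> = (\<Sum>j\<in>dominant J'. wt j * (\<integral>y. W j 0 y * of_bool (df j * y \<le> ?T) \<partial>lborel))"
  proof (rule sum.mono_neutral_cong_right)
    fix j assume "j \<in> dominant J'"
    then have j: "j \<in> J'" "j \<in> J" using J' by auto
    have "integral\<^sup>L lborel (W j 0) - (\<integral>y. W j 0 y * ?u j y \<partial>lborel) = (\<integral>y. W j 0 y - W j 0 y * ?u j y \<partial>lborel)"
      using j m_bounds c_neg
      by (intro Bochner_Integration.integral_diff[symmetric] integrable_laplace_weight integrable_laplace_weight_times[where C = 1])
        (auto simp: of_bool_def)
    also have "\<dots> = (\<integral>y. W j 0 y * of_bool (df j * y \<le> ?T) \<partial>lborel)"
      using j by (intro Bochner_Integration.integral_cong refl) (auto simp: of_bool_def)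
    finally show "wt j * (integral\<^sup>L lborel (W j 0) - (\<integral>y. W j 0 y * ?u j y \<partial>lborel))
        = wt j * (\<integral>y. W j 0 y * of_bool (df j * y \<le> ?T) \<partial>lborel)" by simp
  next
    show "\<forall>j\<in>dominant J - dominant J'. wt j * (integral\<^sup>L lborel (W j 0) - (\<integral>y. W j 0 y * ?u j y \<partial>lborel)) = 0"
    proof
      fix j assume "j \<in> dominant J - dominant J'"
      then have "j \<notin> J'" by auto
      with t show "wt j * (integral\<^sup>L lborel (W j 0) - (\<integral>y. W j 0 y * ?u j y \<partial>lborel)) = 0"
        by simp
    qed
    show "finite (dominant J)" using finite_J by simp
    show "dominant J' \<subseteq> dominant J" using J' by blast
  qed
  finally have restrict_sum: "total_mass - (\<Sum>j\<in>dominant J. wt j * (\<integral>y. W j 0 y * ?u j y \<partial>lborel))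
      = (\<Sum>j\<in>dominant J'. wt j * (\<integral>y. W j 0 y * of_bool (df j * y \<le> ?T) \<partial>lborel))" .
  have "(total_mass - (\<Sum>j\<in>dominant J. wt j * (\<integral>y. W j 0 y * ?u j y \<partial>lborel))) / total_mass
      = mix.tail total_mass atMost t"
    unfolding restrict_sum mix.tail_def sum_divide_distrib
  proof (intro sum.cong refl)
    fix j assume j: "j \<in> dominant J'"
    then have "j \<in> J" using J' by auto
    then have "(\<integral>y. W j 0 y * of_bool (df j * y \<le> ?T) \<partial>lborel)
      = of_bool (df j \<noteq> 0) * (\<integral>y. W j 0 y * indicator {..?T / \<bar>df j\<bar>} y \<partial>lborel)"
      by (rule integral_half_line(2)[OF _ less_imp_neq[OF T] T])
    also have "(\<integral>y. W j 0 y * indicator {..?T / \<bar>df j\<bar>} y \<partial>lborel)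
      = integral\<^sup>L lborel (W j 0) * measure (law_prop (W j 0)) {..?T / \<bar>df j\<bar>}"
      by (rule mix.W0_law(5)[OF j, symmetric]) simp
    finally have e: "(\<integral>y. W j 0 y * of_bool (df j * y \<le> ?T) \<partial>lborel) =
      of_bool (df j \<noteq> 0) * (integral\<^sup>L lborel (W j 0) * measure (law_prop (W j 0)) {..?T / \<bar>df j\<bar>})" .
    show "wt j * (\<integral>y. W j 0 y * of_bool (df j * y \<le> ?T) \<partial>lborel) / total_mass =
      wt j * integral\<^sup>L lborel (W j 0) / total_mass * of_bool (df j \<noteq> 0) * measure (law_prop (W j 0)) {..?T / \<bar>df j\<bar>}"
      unfolding e by (simp only: mult_ac times_divide_eq_left times_divide_eq_right)
  qed
  then have eq: "1 - (\<Sum>j\<in>dominant J. wt j * (\<integral>y. W j 0 y * ?u j y \<partial>lborel)) / total_mass = mix.tail total_mass atMost t"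
    unfolding diff_divide_distrib divide_self[OF less_imp_neq[OF total_mass_pos, symmetric]] .
  have "t \<noteq> 0" using t by simp
  have "(\<lambda>n. 1 - measure (gibbs f g \<beta> n) {\<omega> \<in> spins n. mle f g n \<omega> > \<beta> + t * real n powr (\<theta> - 1)})
    \<longlonglongrightarrow> mix.tail total_mass atMost t"
    unfolding eq[symmetric]
    by (intro tendsto_diff tendsto_const mle_event_tendsto[OF J' nd on off' \<open>t \<noteq> 0\<close> x12, folded total_mass_def])
  moreover have "1 - measure (gibbs f g \<beta> n) {\<omega> \<in> spins n. mle f g n \<omega> > b}
      = measure (gibbs f g \<beta> n) {\<omega> \<in> spins n. mle f g n \<omega> \<le> b}" for n b
  proof -
    interpret prob_space "gibbs f g \<beta> n" by (rule prob_space_gibbs)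
    have "measure (gibbs f g \<beta> n) (space (gibbs f g \<beta> n) - {\<omega> \<in> spins n. mle f g n \<omega> > b})
        = 1 - measure (gibbs f g \<beta> n) {\<omega> \<in> spins n. mle f g n \<omega> > b}"
      by (rule prob_compl) auto
    moreover have "space (gibbs f g \<beta> n) - {\<omega> \<in> spins n. mle f g n \<omega> > b} = {\<omega> \<in> spins n. mle f g n \<omega> \<le> b}"
      by auto
    ultimately show ?thesis by simp
  qed
  ultimately show ?thesis by (simp only:)
qed

end

end

theorem theorem4p1:
  fixes f g :: "real \<Rightarrow> real" and \<beta> :: real
    and J :: "'j set" and a :: "'j \<Rightarrow> real" and m :: "'j \<Rightarrow> nat" and m_star :: nat
    and A :: "real \<Rightarrow> real"
    and J1p J2p J1m J2m J_star :: "'j set"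
    and c \<nu> p :: "'j \<Rightarrow> real"
    and w :: "'j \<Rightarrow> real \<Rightarrow> real \<Rightarrow> real"
    and q pm pp EY :: "'j \<Rightarrow> real \<Rightarrow> real"
    and Y :: "'j \<Rightarrow> real \<Rightarrow> real measure"
  assumes f_nonconst: "\<not> f constant_on {0..1}"
    and g_nonconst: "\<not> g constant_on {0..1}"
    and f_smooth: "Ck_on (2 * m_star + 1) f {0..1}"
    and g_smooth: "Ck_on (2 * m_star + 1) g {0..1}"
    and A_eq: "A = (\<lambda>x. \<beta> * f x + g x + entropy_fun x)"
    and J_finite: "finite J"
    and a_inj: "inj_on a J"
    and maximizers: "a ` J = {x \<in> {0..1}. \<forall>y\<in>{0..1}. A y \<le> A x}"
    and m_pos: "\<forall>j\<in>J. m j \<ge> 1"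
    and A_flat: "\<forall>j\<in>J. \<forall>k. 1 \<le> k \<and> k \<le> 2 * m j - 1 \<longrightarrow> (deriv ^^ k) A (a j) = 0"
    and A_neg: "\<forall>j\<in>J. (deriv ^^ (2 * m j)) A (a j) < 0"
    and m_star_eq: "m_star = Max (m ` J)"
    and J1p_eq: "J1p = {j \<in> J. f (a j) = Max ((\<lambda>k. f (a k)) ` J)}"
    and J2p_eq: "J2p = {j \<in> J1p. m j = Max (m ` J1p)}"
    and J1m_eq: "J1m = {j \<in> J. f (a j) = Min ((\<lambda>k. f (a k)) ` J)}"
    and J2m_eq: "J2m = {j \<in> J1m. m j = Max (m ` J1m)}"
    and J_star_eq: "J_star = {j \<in> J. m j = m_star}"
    and J2_sub: "J2m \<union> J2p \<subseteq> J_star"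
    and nondeg: "\<exists>j\<in>J2m. \<exists>k\<in>J2p. deriv f (a j) * deriv f (a k) \<noteq> 0"
    and c_eq: "c = (\<lambda>j. (deriv ^^ (2 * m j)) A (a j) / fact (2 * m j))"
    and \<nu>_eq: "\<nu> = (\<lambda>j. ln (sqrt (1 / ((1 - a j) * a j))))"
    and w_eq: "w = (\<lambda>j t x. exp (c j * x ^ (2 * m j) + t * deriv f (a j) * x))"
    and Y_eq: "Y = (\<lambda>j t. law_prop (w j t))"
    and EY_eq: "EY = (\<lambda>j t. \<integral>x. x \<partial>Y j t)"
    and q_eq: "q = (\<lambda>j t. \<integral>x. w j t x \<partial>lborel)"
    and p_eq: "p = (\<lambda>j. q j 0 * exp (\<nu> j) / (\<Sum>i\<in>J_star. q i 0 * exp (\<nu> i)))"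
    and pm_eq: "pm = (\<lambda>k t. q k t * exp (\<nu> k) / (\<Sum>i\<in>J2m. q i t * exp (\<nu> i)))"
    and pp_eq: "pp = (\<lambda>k t. q k t * exp (\<nu> k) / (\<Sum>i\<in>J2p. q i t * exp (\<nu> i)))"
  shows "\<exists>U :: real measure. real_distribution U \<and>
    (\<forall>t<0. measure U {..t} =
       (\<Sum>j\<in>J2m. p j * of_bool (deriv f (a j) \<noteq> 0) *
          measure (Y j 0) {..\<Sum>k\<in>J2m. deriv f (a k) / \<bar>deriv f (a j)\<bar> * pm k t * EY k t})) \<and>
    (\<forall>t>0. measure U {t<..} =
       (\<Sum>j\<in>J2p. p j * of_bool (deriv f (a j) \<noteq> 0) *
          measure (Y j 0) {(\<Sum>k\<in>J2p. deriv f (a k) / \<bar>deriv f (a j)\<bar> * pp k t * EY k t)<..})) \<and>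
    measure U {0} = 1 - 1/2 * ((\<Sum>j\<in>J2p. p j * of_bool (deriv f (a j) \<noteq> 0)) +
                               (\<Sum>j\<in>J2m. p j * of_bool (deriv f (a j) \<noteq> 0))) \<and>
    weak_conv_m
      (\<lambda>n. distr (gibbs f g \<beta> n) borel
             (\<lambda>\<omega>. (mle f g n \<omega> - \<beta>) * real n powr (1 - 1 / (2 * real m_star))))
      U"
proof -
  let ?df = "\<lambda>j. deriv f (a j)"
  obtain j0 k0 where j0: "j0 \<in> J2m" "?df j0 \<noteq> 0" and k0: "k0 \<in> J2p" "?df k0 \<noteq> 0"
    using nondeg by auto
  have J2p_J: "J2p \<subseteq> J1p" "J1p \<subseteq> J" and J2m_J: "J2m \<subseteq> J1m" "J1m \<subseteq> J"
    by (auto simp: J2p_eq J1p_eq J2m_eq J1m_eq)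
  have J: "j0 \<in> J" "k0 \<in> J" using j0 k0 J2p_J J2m_J by auto
  have m_star: "m_star \<ge> 1" "\<And>j. j \<in> J \<Longrightarrow> m j \<le> m_star" "\<exists>j\<in>J. m j = m_star"
  proof -
    show le: "m j \<le> m_star" if "j \<in> J" for j
      unfolding m_star_eq using that J_finite by (intro Max_ge) auto
    show "m_star \<ge> 1" using le[OF J(1)] m_pos J(1) by force
    have "m_star \<in> m ` J" unfolding m_star_eq using J_finite J(1) by (intro Max_in) auto
    then show "\<exists>j\<in>J. m j = m_star" by auto
  qed
  have a_max: "a j \<in> {0..1}" "\<And>y. y \<in> {0..1} \<Longrightarrow> A y \<le> A (a j)" if "j \<in> J" for j
    using maximizers that by blast+
  obtain Kf where Kf: "\<And>x y. x \<in> {0..1} \<Longrightarrow> y \<in> {0..1} \<Longrightarrow> \<bar>f x - f y\<bar> \<le> Kf * \<bar>x - y\<bar>"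
    using Ck_on_lipschitz[OF f_smooth] by auto
  obtain Kg where Kg: "\<And>x y. x \<in> {0..1} \<Longrightarrow> y \<in> {0..1} \<Longrightarrow> \<bar>g x - g y\<bar> \<le> Kg * \<bar>x - y\<bar>"
    using Ck_on_lipschitz[OF g_smooth] by auto
  have KB: "\<bar>(\<beta> * f x + g x) - (\<beta> * f y + g y)\<bar> \<le> (\<bar>\<beta>\<bar> * Kf + Kg) * \<bar>x - y\<bar>"
    if "x \<in> {0..1}" "y \<in> {0..1}" for x y
  proof -
    have "\<bar>(\<beta> * f x + g x) - (\<beta> * f y + g y)\<bar> = \<bar>\<beta> * (f x - f y) + (g x - g y)\<bar>"
      by (simp add: algebra_simps)
    also have "\<dots> \<le> \<bar>\<beta>\<bar> * \<bar>f x - f y\<bar> + \<bar>g x - g y\<bar>"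
      by (rule order.trans[OF abs_triangle_ineq]) (simp add: abs_mult)
    also have "\<dots> \<le> \<bar>\<beta>\<bar> * (Kf * \<bar>x - y\<bar>) + Kg * \<bar>x - y\<bar>"
      by (intro add_mono mult_left_mono Kf Kg that) auto
    finally show ?thesis by (simp add: distrib_right mult.assoc)
  qed
  \<comment> \<open>Interior position comes before any statement on derivatives: f and g are smooth
    only within the closed interval, while \<open>deriv\<close> is two-sided.\<close>
  have interior: "0 < a j" "a j < 1" if "j \<in> J" for j
  proof -
    have "\<beta> * f y + g y + entropy_fun y \<le> \<beta> * f (a j) + g (a j) + entropy_fun (a j)" if "y \<in> {0..1}" for y
      using a_max(2)[OF \<open>j \<in> J\<close> that] by (simp add: A_eq)
    then show "0 < a j" "a j < 1"
      using entropy_maximizer_interior[of "\<lambda>x. \<beta> * f x + g x", OF KB a_max(1)[OF that]] by auto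
  qed
  obtain Df where Df: "Df 0 = f"
    "\<And>i x. i < 2 * m_star + 1 \<Longrightarrow> 0 < x \<Longrightarrow> x < 1 \<Longrightarrow> (Df i has_real_derivative Df (Suc i) x) (at x)"
    using Ck_on_derivatives[OF f_smooth] by blast
  obtain Dg where Dg: "Dg 0 = g"
    "\<And>i x. i < 2 * m_star + 1 \<Longrightarrow> 0 < x \<Longrightarrow> x < 1 \<Longrightarrow> (Dg i has_real_derivative Dg (Suc i) x) (at x)"
    using Ck_on_derivatives[OF g_smooth] by blast
  obtain E where E: "E 0 = entropy_fun"
    "\<And>i x. 0 < x \<Longrightarrow> x < 1 \<Longrightarrow> (E i has_real_derivative E (Suc i) x) (at x)"
    using entropy_fun_derivatives by blast
  define DA where "DA i x = \<beta> * Df i x + Dg i x + E i x" for i x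
  have DA0: "DA 0 = A" by (simp add: fun_eq_iff DA_def Df(1) Dg(1) E(1) A_eq)
  have DA: "(DA i has_real_derivative DA (Suc i) x) (at x)" if "i < 2 * m_star + 1" "0 < x" "x < 1" for i x
    unfolding DA_def[abs_def] by (intro DERIV_add DERIV_cmult Df(2) Dg(2) E(2) that)
  have iter: "(deriv ^^ k) A (a j) = DA k (a j)" if "j \<in> J" "k \<le> 2 * m_star + 1" for j k
    using iterated_deriv_eq[of "{0<..<1}" "2 * m_star + 1" DA k "a j"] DA that interior
    by (auto simp: DA0)
  define Amax where "Amax = A (a j0)"
  have A_a: "A (a j) = Amax" if "j \<in> J" for j
    unfolding Amax_def using a_max that J(1) by (intro antisym) auto
  \<comment> \<open>Vanishing derivatives below order \<open>2 * m j\<close> turn A into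
    \<open>Amax\<close> plus a continuous multiple of the leading power, with value
    \<open>c j\<close> at the maximizer.\<close>
  have "\<forall>j\<in>J. \<exists>\<Psi>. isCont \<Psi> (a j) \<and> \<Psi> (a j) = c j \<and> (\<forall>x. A x = Amax + \<Psi> x * (x - a j) ^ (2 * m j))"
  proof
    fix j assume j: "j \<in> J"
    have mj: "1 \<le> m j" "m j \<le> m_star" using m_pos m_star j by auto
    obtain \<Psi> where "isCont \<Psi> (a j)" "\<Psi> (a j) = DA (2 * m j) (a j) / fact (2 * m j)"
      "\<And>x. DA 0 x = DA 0 (a j) + \<Psi> x * (x - a j) ^ (2 * m j)"
    proof (rule taylor_quotient_continuous[where N = "2 * m j" and D = DA and l = 0 and r = 1 and a = "a j"])
      show "isCont (DA (2 * m j)) (a j)"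
        using DA[of "2 * m j" "a j"] mj interior[OF j] by (intro DERIV_isCont) auto
      show "DA i (a j) = 0" if "1 \<le> i" "i < 2 * m j" for i
      proof -
        have "(deriv ^^ i) A (a j) = 0" using bspec[OF A_flat j] that by simp
        with iter[OF j, of i] that mj show ?thesis by simp
      qed
      show "(DA i has_real_derivative DA (Suc i) x) (at x)" if "i < 2 * m j" "0 < x" "x < 1" for i x
        using that mj by (intro DA) auto
      show "0 < 2 * m j" using mj by simp
    qed (rule interior[OF j] | (rule that; assumption))+
    moreover have "DA (2 * m j) (a j) / fact (2 * m j) = c j"
      using iter[OF j, of "2 * m j"] mj by (simp add: c_eq)
    ultimately show "\<exists>\<Psi>. isCont \<Psi> (a j) \<and> \<Psi> (a j) = c j \<and> (\<forall>x. A x = Amax + \<Psi> x * (x - a j) ^ (2 * m j))"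
      unfolding DA0 A_a[OF j] by (intro exI[of _ \<Psi>] conjI allI) (simp only:)+
  qed
  from bchoice[OF this] obtain \<Psi>
    where \<Psi>_all: "\<forall>j\<in>J. isCont (\<Psi> j) (a j) \<and> \<Psi> j (a j) = c j \<and> (\<forall>x. A x = Amax + \<Psi> j x * (x - a j) ^ (2 * m j))" ..
  have \<Psi>: "isCont (\<Psi> j) (a j)" "\<Psi> j (a j) = c j" "\<And>x. A x = Amax + \<Psi> j x * (x - a j) ^ (2 * m j)" if "j \<in> J" for j
    using bspec[OF \<Psi>_all that] by blast+
  have f_deriv: "(f has_real_derivative ?df j) (at (a j))" if "j \<in> J" for j
    using Df(2)[of 0 "a j"] interior[OF that] DERIV_imp_deriv[of f "Df (Suc 0) (a j)" "a j"] by (simp add: Df(1))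
  interpret linear_model f g \<beta> J a m m_star ?df c \<Psi> Amax Kf
  proof unfold_locales
    show "continuous_on {0..1} (\<lambda>x. \<beta> * f x + g x)"
      using f_smooth g_smooth by (intro continuous_intros) (auto simp: Ck_on_def)
    show "c j < 0" if "j \<in> J" for j
      using A_neg that by (simp add: c_eq divide_neg_pos)
    show "\<beta> * f x + g x + entropy_fun x = Amax + \<Psi> j x * (x - a j) ^ (2 * m j)" if "j \<in> J" for j x
      using \<Psi>(3)[OF that, of x] by (simp add: A_eq)
    show "\<beta> * f x + g x + entropy_fun x < Amax" if x: "x \<in> {0..1}" "x \<notin> a ` J" for x
    proof -
      obtain y where "y \<in> {0..1}" "A x < A y" using x unfolding maximizers by force
      moreover from this have "A y \<le> Amax" unfolding Amax_def using a_max(2)[OF J(1)] by blast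
      ultimately have "A x < Amax" by linarith
      then show ?thesis by (simp add: A_eq)
    qed
    show "J \<noteq> {}" using J(1) by auto
    show "\<bar>f x - f y\<bar> \<le> Kf * \<bar>x - y\<bar>" if "x \<in> {0..1}" "y \<in> {0..1}" for x y
      using Kf[OF that] .
    show "1 \<le> m j" if "j \<in> J" for j using m_pos that by blast
    show "isCont (\<Psi> j) (a j)" "\<Psi> j (a j) = c j" if "j \<in> J" for j
      using \<Psi>(1,2)[OF that] .
    show "(f has_real_derivative ?df j) (at (a j))" if "j \<in> J" for j
      using f_deriv[OF that] .
    show "0 < a j" "a j < 1" if "j \<in> J" for j
      using interior[OF that] .
    show "m j \<le> m_star" if "j \<in> J" for j
      using m_star(2)[OF that] .
  qed (rule J_finite a_inj m_star(3))+
  have J_star_dom: "J_star = dominant J" by (simp add: J_star_eq)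
  \<comment> \<open>Here the inclusion of \<open>J2p\<close> in \<open>J_star\<close> enters: as
    \<open>k0\<close> has order \<open>m_star\<close>, the maximal order within \<open>J1p\<close>
    is the global one, and \<open>J2p\<close> is the dominant part of \<open>J1p\<close>.\<close>
  have J2p_dom: "J2p = dominant J1p"
  proof -
    have "m k0 = m_star" using J2_sub k0 by (auto simp: J_star_eq)
    then have "Max (m ` J1p) = m_star" using k0 by (simp add: J2p_eq)
    then show ?thesis by (simp add: J2p_eq)
  qed
  have J2m_dom: "J2m = dominant J1m"
  proof -
    have "m j0 = m_star" using J2_sub j0 by (auto simp: J_star_eq)
    then have "Max (m ` J1m) = m_star" using j0 by (simp add: J2m_eq)
    then show ?thesis by (simp add: J2m_eq)
  qed
  have k0': "k0 \<in> J1p" "m k0 = m_star" and j0': "j0 \<in> J1m" "m j0 = m_star"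
    using k0(1) j0(1) by (simp_all add: J2p_dom J2m_dom)
  have on_p: "f (a j) = f (a k0)" if "j \<in> J1p" for j
    using that k0' by (simp add: J1p_eq)
  have on_m: "f (a j) = f (a j0)" if "j \<in> J1m" for j
    using that j0' by (simp add: J1m_eq)
  have le_p: "f (a j) \<le> f (a k0)" and ge_m: "f (a j0) \<le> f (a j)" if "j \<in> J" for j
    using k0' j0' that J_finite by (auto simp: J1p_eq J1m_eq intro!: Max_ge Min_le)
  have off_p: "f (a j) < f (a k0)" if "j \<in> J - J1p" for j
    using le_p[of j] that k0' by (auto simp: J1p_eq less_le)
  have off_m: "f (a j0) < f (a j)" if "j \<in> J - J1m" for j
    using ge_m[of j] that j0' by (auto simp: J1m_eq less_le)
  \<comment> \<open>Since \<open>f (a j0)\<close> is the smallest of the values of f at the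
    maximizers, a point below it lies below all of them.\<close>
  obtain x1 where x1: "x1 \<in> {0..1}" "f x1 < f (a j0)"
    using nonzero_derivative_not_extremal(1)[OF f_deriv[OF J(1)] j0(2) interior[OF J(1)]] by blast
  obtain x2 where x2: "x2 \<in> {0..1}" "f (a k0) < f x2"
    using nonzero_derivative_not_extremal(2)[OF f_deriv[OF J(2)] k0(2) interior[OF J(2)]] by blast
  have x12: "f x1 < f (a j)" "f (a j) < f x2" if "j \<in> J" for j
    using x1 x2 le_p[OF that] ge_m[OF that] by linarith+
  interpret mp: laplace_mixture "dominant J1p" m c ?df wt
    by (rule dominant_mixture[OF J2p_J(2) k0' k0(2)])
  interpret mm: laplace_mixture "dominant J1m" m c ?df wt
    by (rule dominant_mixture[OF J2m_J(2) j0' j0(2)])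
  have w_W: "w j t = W j t" for j t
    by (simp add: w_eq laplace_weight_def fun_eq_iff)
  have q_W: "q j t = integral\<^sup>L lborel (W j t)" for j t
    by (simp add: q_eq w_W)
  have wt_\<nu>: "wt j = stirling_const * exp (\<nu> j)" if "j \<in> J" for j
    using interior[OF that] by (simp add: wt_def \<nu>_eq real_sqrt_divide mult.commute)
  have p_wt: "p j = wt j * integral\<^sup>L lborel (W j 0) / total_mass" if "j \<in> J" for j
  proof -
    have "total_mass = (\<Sum>i\<in>J_star. stirling_const * (q i 0 * exp (\<nu> i)))"
      unfolding total_mass_def J_star_dom by (intro sum.cong refl) (simp add: wt_\<nu> q_W)
    also have "\<dots> = stirling_const * (\<Sum>i\<in>J_star. q i 0 * exp (\<nu> i))"
      by (rule sum_distrib_left[symmetric])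
    finally show ?thesis
      using stirling_const_pos wt_\<nu>[OF that] by (simp add: p_eq q_W)
  qed
  \<comment> \<open>Numerator and denominator of the threshold carry the same factor
    \<open>stirling_const\<close>; after cancelling it, \<open>q k t * EY k t\<close> is the
    unnormalized first moment.\<close>
  have threshold_eq: "(\<Sum>k\<in>I. ?df k / d * (q k t * exp (\<nu> k) / (\<Sum>i\<in>I. q i t * exp (\<nu> i))) * EY k t)
      = laplace_mixture.threshold I m c ?df wt t / d"
    if I: "I \<subseteq> J" and mix: "laplace_mixture I m c ?df wt" for I d t
  proof -
    define S where "S = (\<Sum>i\<in>I. q i t * exp (\<nu> i))"
    have den: "(\<Sum>j\<in>I. wt j * integral\<^sup>L lborel (W j t)) = stirling_const * S"
      unfolding S_def sum_distrib_left using I by (intro sum.cong refl) (auto simp: wt_\<nu> q_W)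
    have num: "wt k * (\<integral>y. W k t y * (?df k * y) \<partial>lborel) = stirling_const * (?df k * q k t * exp (\<nu> k) * EY k t)"
      if "k \<in> I" for k
    proof -
      have k: "k \<in> J" using that I by auto
      have q_pos: "integral\<^sup>L lborel (W k t) > 0"
        by (intro laplace_weight_integral_pos m_bounds c_neg k)
      have "EY k t = (\<integral>y. W k t y * y \<partial>lborel) / integral\<^sup>L lborel (W k t)"
        unfolding EY_eq Y_eq w_W
        by (intro integral_law_prop laplace_weight_pos integrable_laplace_weight q_pos m_bounds c_neg k) auto
      then have e: "q k t * EY k t = (\<integral>y. W k t y * y \<partial>lborel)"
        using q_pos by (simp add: q_W)
      have "(\<integral>y. W k t y * (?df k * y) \<partial>lborel) = ?df k * (q k t * EY k t)"
        unfolding e by (simp add: mult.left_commute)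
      then show ?thesis by (simp add: wt_\<nu>[OF k])
    qed
    have "laplace_mixture.threshold I m c ?df wt t
        = (\<Sum>k\<in>I. stirling_const * (?df k * q k t * exp (\<nu> k) * EY k t)) / (stirling_const * S)"
      unfolding laplace_mixture.threshold_def[OF mix] den by (intro arg_cong2[where f = "(/)"] sum.cong refl num)
    also have "\<dots> = (\<Sum>k\<in>I. ?df k * q k t * exp (\<nu> k) * EY k t) / S"
      unfolding sum_distrib_left[symmetric] using stirling_const_pos by simp
    finally show ?thesis
      unfolding S_def[symmetric] by (simp add: sum_divide_distrib mult_ac)
  qed
  have tail_p: "mp.tail total_mass R t = (\<Sum>j\<in>J2p. p j * of_bool (?df j \<noteq> 0) *
      measure (Y j 0) (R (\<Sum>k\<in>J2p. ?df k / \<bar>?df j\<bar> * pp k t * EY k t)))" for R t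
  proof -
    have "dominant J1p \<subseteq> J" using J2p_J by auto
    note th = threshold_eq[OF this mp.laplace_mixture_axioms]
    show ?thesis
      unfolding mp.tail_def J2p_dom pp_eq th Y_eq w_W using J2p_J by (intro sum.cong refl) (auto simp: p_wt)
  qed
  have tail_m: "mm.tail total_mass R t = (\<Sum>j\<in>J2m. p j * of_bool (?df j \<noteq> 0) *
      measure (Y j 0) (R (\<Sum>k\<in>J2m. ?df k / \<bar>?df j\<bar> * pm k t * EY k t)))" for R t
  proof -
    have "dominant J1m \<subseteq> J" using J2m_J by auto
    note th = threshold_eq[OF this mm.laplace_mixture_axioms]
    show ?thesis
      unfolding mm.tail_def J2m_dom pm_eq th Y_eq w_W using J2m_J by (intro sum.cong refl) (auto simp: p_wt)
  qed
  have tail_p0: "mp.tail total_mass greaterThan 0 = 1/2 * (\<Sum>j\<in>J2p. p j * of_bool (?df j \<noteq> 0))"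
    unfolding mp.tail_0 J2p_dom using J2p_J by (intro arg_cong[where f = "times (1/2)"] sum.cong refl) (auto simp: p_wt)
  have tail_m0: "mm.tail total_mass atMost 0 = 1/2 * (\<Sum>j\<in>J2m. p j * of_bool (?df j \<noteq> 0))"
    unfolding mm.tail_0 J2m_dom using J2m_J by (intro arg_cong[where f = "times (1/2)"] sum.cong refl) (auto simp: p_wt)
  let ?X = "\<lambda>n \<omega>. (mle f g n \<omega> - \<beta>) * real n powr (1 - 1 / (2 * real m_star))"
  let ?M = "\<lambda>n. distr (gibbs f g \<beta> n) borel (?X n)"
  have meas: "?X n \<in> measurable (gibbs f g \<beta> n) borel" for n
    by (auto simp: measurable_def)
  have rd: "real_distribution (?M n)" for n
    using prob_space.prob_space_distr[OF prob_space_gibbs meas]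
    by (auto simp: real_distribution_def real_distribution_axioms_def)
  \<comment> \<open>\<open>n powr (\<theta> - 1)\<close> is the reciprocal of the scaling factor in
    the theorem; n \<ge> 1 is needed because \<open>0 powr x\<close> is 0.\<close>
  have scale: "?X n \<omega> > t \<longleftrightarrow> mle f g n \<omega> > \<beta> + t * real n powr (\<theta> - 1)" if "n \<ge> 1" for n \<omega> t
  proof -
    have r: "real n powr (1 - 1 / (2 * real m_star)) > 0" using that by simp
    have "real n powr (\<theta> - 1) = 1 / real n powr (1 - 1 / (2 * real m_star))"
      unfolding powr_minus_divide[symmetric] by (simp add: \<theta>_def)
    moreover have "?X n \<omega> > t \<longleftrightarrow> mle f g n \<omega> - \<beta> > t / real n powr (1 - 1 / (2 * real m_star))"
      using r by (rule pos_divide_less_eq[symmetric])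
    ultimately show ?thesis by auto
  qed
  have up: "(\<lambda>n. measure (?M n) {t<..}) \<longlonglongrightarrow> mp.tail total_mass greaterThan t" if t: "t > 0" for t
  proof (rule Lim_transform_eventually[OF upper_tail_tendsto[OF J2p_J(2) k0' k0(2) on_p x1(1) x2(1) x12 off_p t]])
    show "\<forall>\<^sub>F n in sequentially. measure (gibbs f g \<beta> n) {\<omega> \<in> spins n. mle f g n \<omega> > \<beta> + t * real n powr (\<theta> - 1)}
        = measure (?M n) {t<..}"
    proof (rule eventually_sequentiallyI[of 1])
      fix n :: nat assume n: "1 \<le> n"
      have "?X n -` {t<..} \<inter> spins n = {\<omega> \<in> spins n. mle f g n \<omega> > \<beta> + t * real n powr (\<theta> - 1)}"
        using scale[OF n] by auto
      then show "measure (gibbs f g \<beta> n) {\<omega> \<in> spins n. mle f g n \<omega> > \<beta> + t * real n powr (\<theta> - 1)}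
        = measure (?M n) {t<..}"
        by (simp add: measure_distr[OF meas])
    qed
  qed
  have lo: "(\<lambda>n. measure (?M n) {..t}) \<longlonglongrightarrow> mm.tail total_mass atMost t" if t: "t < 0" for t
  proof (rule Lim_transform_eventually[OF lower_tail_tendsto[OF J2m_J(2) j0' j0(2) on_m x1(1) x2(1) x12 off_m t]])
    show "\<forall>\<^sub>F n in sequentially. measure (gibbs f g \<beta> n) {\<omega> \<in> spins n. mle f g n \<omega> \<le> \<beta> + t * real n powr (\<theta> - 1)}
        = measure (?M n) {..t}"
    proof (rule eventually_sequentiallyI[of 1])
      fix n :: nat assume n: "1 \<le> n"
      have "?X n -` {..t} \<inter> spins n = {\<omega> \<in> spins n. mle f g n \<omega> \<le> \<beta> + t * real n powr (\<theta> - 1)}"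
        using scale[OF n] by (auto simp flip: not_less)
      then show "measure (gibbs f g \<beta> n) {\<omega> \<in> spins n. mle f g n \<omega> \<le> \<beta> + t * real n powr (\<theta> - 1)}
        = measure (?M n) {..t}"
        by (simp add: measure_distr[OF meas])
    qed
  qed
  obtain U where U: "real_distribution U" "\<And>t. t < 0 \<Longrightarrow> measure U {..t} = mm.tail total_mass atMost t"
    "\<And>t. t > 0 \<Longrightarrow> measure U {t<..} = mp.tail total_mass greaterThan t"
    "measure U {0} = 1 - (mp.tail total_mass greaterThan 0 + mm.tail total_mass atMost 0)" "weak_conv_m ?M U"
    using weak_limit_from_tails[OF rd lo up mm.isCont_tail(1) mp.isCont_tail(2) mm.tail_at_bot mp.tail_at_top]
    by blast
  show ?thesis
  proof (intro exI[of _ U] conjI allI impI)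
    show "measure U {0} = 1 - 1/2 * ((\<Sum>j\<in>J2p. p j * of_bool (deriv f (a j) \<noteq> 0)) +
                               (\<Sum>j\<in>J2m. p j * of_bool (deriv f (a j) \<noteq> 0)))"
      unfolding U(4) tail_p0 tail_m0 by (simp only: distrib_left)
    show "measure U {..t} = (\<Sum>j\<in>J2m. p j * of_bool (?df j \<noteq> 0) *
      measure (Y j 0) {..\<Sum>k\<in>J2m. ?df k / \<bar>?df j\<bar> * pm k t * EY k t})" if "t < 0" for t
      unfolding U(2)[OF that] by (rule tail_m)
    show "measure U {t<..} = (\<Sum>j\<in>J2p. p j * of_bool (?df j \<noteq> 0) *
      measure (Y j 0) {(\<Sum>k\<in>J2p. ?df k / \<bar>?df j\<bar> * pp k t * EY k t)<..})" if "t > 0" for t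
      unfolding U(3)[OF that] by (rule tail_p)
  qed (rule U(1,5))+
qed

end
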